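(* Let $\alpha>-1/2$. Then, as $s\to0+$ ($s$ real), $$\big(s^{1/2+\alpha}D(\alpha;1/2+sz)\big)_{z\in H_0}\Longrightarrow(\mathcal{I}(\alpha;z))_{z\in H_0}$$ weakly in the space of probability measures on $\mathcal{A}(H_0)$, the space of analytic functions on $H_0$ endowed with the topology of uniform convergence on compact subsets of $H_0$.
   Context: Let $(\eta,\theta)$ be an $\mathbb{R}^2$-valued random vector with $\mathbb{E}\eta=\mathbb{E}\theta=0$ and $0<\mathbb{E}\eta^2+\mathbb{E}\theta^2<\infty$, and let $(\eta_n,\theta_n)_{n\in\mathbb N}$ be independent copies of it. For $\alpha\in\mathbb{R}$ define the random Dirichlet series $D(\alpha;z)=\sum_{n\ge2}(\log n)^\alpha(\eta_n+{\rm i}\theta_n)n^{-z}$; it converges a.s. for $\Re z>1/2$ and $z\mapsto D(\alpha;1/2+z)$ is a random analytic function on $H_0=\{z\in\mathbb{C}:\Re z>0\}$. Put $\sigma_1^2={\rm Var}\,\eta$, $\sigma_2^2={\rm Var}\,\theta$, $\rho={\rm Cov}(\eta,\theta)$, $\mathfrak{C}=\begin{pmatrix}\sigma_1^2&\rho\\ \rho&\sigma_2^2\end{pmatrix}$, $\mathfrak{C}^{1/2}$ its symmetric nonnegative square root. Let $(B_1,B_2)$ be a standard two-dimensional Brownian motion with independent components; for $\alpha>-1/2$, $z\in H_0$, $j=1,2$, let $\mathcal{I}_j(\alpha;z)=\int_{[0,\infty)}y^\alpha e^{-zy}\,dB_j(y)$ and $\mathcal{I}(\alpha;z)=(1,{\rm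 i})\mathfrak{C}^{1/2}(\mathcal{I}_1(\alpha;z),\mathcal{I}_2(\alpha;z))^\intercal$ (with $(a,b)(c,d)^\intercal=ac+bd$), a centered Gaussian random analytic function on $H_0$. *)

theory Defs
  imports "HOL-Probability.Probability"
begin

definition H0 :: "complex set" where
  "H0 = {z. Re z > 0}"

definition dir_term :: "real \<Rightarrow> (nat \<Rightarrow> 'a \<Rightarrow> real) \<Rightarrow> (nat \<Rightarrow> 'a \<Rightarrow> real) \<Rightarrow> 'a \<Rightarrow> complex \<Rightarrow> nat \<Rightarrow> complex" where
  "dir_term \<alpha> eta theta \<omega> w n =
     (if 2 \<le> n then complex_of_real (ln (real n) powr \<alpha>)
        * (complex_of_real (eta n \<omega>) + \<i> * complex_of_real (theta n \<omega>))
        * (of_nat n powr (- w))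
      else 0)"

definition dir_series :: "real \<Rightarrow> (nat \<Rightarrow> 'a \<Rightarrow> real) \<Rightarrow> (nat \<Rightarrow> 'a \<Rightarrow> real) \<Rightarrow> 'a \<Rightarrow> complex \<Rightarrow> complex" where
  "dir_series \<alpha> eta theta \<omega> w = (\<Sum>n. dir_term \<alpha> eta theta \<omega> w n)"

text \<open>The rescaled random function z \<mapsto> s^(1/2+alpha) D(alpha; 1/2 + s z). On the (null) event
  where the series fails to converge somewhere on Re w > 1/2 it is set to 0.\<close>
definition rescaled_D :: "real \<Rightarrow> (nat \<Rightarrow> 'a \<Rightarrow> real) \<Rightarrow> (nat \<Rightarrow> 'a \<Rightarrow> real) \<Rightarrow> real \<Rightarrow> 'a \<Rightarrow> complex \<Rightarrow> complex" where
  "rescaled_D \<alpha> eta theta s \<omega> z =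
     (if (\<forall>w. Re w > 1/2 \<longrightarrow> summable (dir_term \<alpha> eta theta \<omega> w))
      then complex_of_real (s powr (1/2 + \<alpha>)) * dir_series \<alpha> eta theta \<omega> (1/2 + complex_of_real s * z)
      else 0)"

definition std_BM2 :: "'b measure \<Rightarrow> (real \<Rightarrow> 'b \<Rightarrow> real) \<Rightarrow> (real \<Rightarrow> 'b \<Rightarrow> real) \<Rightarrow> bool" where
  "std_BM2 P B1 B2 \<longleftrightarrow>
     prob_space P \<and>
     (\<forall>t. B1 t \<in> borel_measurable P \<and> B2 t \<in> borel_measurable P) \<and>
     (\<forall>\<omega>\<in>space P. B1 0 \<omega> = 0 \<and> B2 0 \<omega> = 0) \<and>
     (\<forall>\<omega>\<in>space P. continuous_on {0..} (\<lambda>t. B1 t \<omega>) \<and> continuous_on {0..} (\<lambda>t. B2 t \<omega>)) \<and>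
     (\<forall>s t. 0 \<le> s \<and> s < t \<longrightarrow>
        distributed P lborel (\<lambda>\<omega>. B1 t \<omega> - B1 s \<omega>) (normal_density 0 (sqrt (t - s))) \<and>
        distributed P lborel (\<lambda>\<omega>. B2 t \<omega> - B2 s \<omega>) (normal_density 0 (sqrt (t - s)))) \<and>
     (\<forall>ts :: nat \<Rightarrow> real. strict_mono ts \<and> 0 \<le> ts 0 \<longrightarrow>
        prob_space.indep_vars P (\<lambda>_. borel)
          (\<lambda>(j, k) \<omega>. (if j then B1 else B2) (ts (Suc k)) \<omega> - (if j then B1 else B2) (ts k) \<omega>)
          (UNIV :: (bool \<times> nat) set))"

definition step_fun :: "(complex \<times> real \<times> real) list \<Rightarrow> real \<Rightarrow> complex" where
  "step_fun xs y = (\<Sum>(c, a, b) \<leftarrow> xs. c * indicator {a<..b} y)"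

definition step_int :: "(real \<Rightarrow> 'b \<Rightarrow> real) \<Rightarrow> (complex \<times> real \<times> real) list \<Rightarrow> 'b \<Rightarrow> complex" where
  "step_int B xs \<omega> = (\<Sum>(c, a, b) \<leftarrow> xs. c * complex_of_real (B b \<omega> - B a \<omega>))"

definition wiener_integral :: "'b measure \<Rightarrow> (real \<Rightarrow> 'b \<Rightarrow> real) \<Rightarrow> (real \<Rightarrow> complex) \<Rightarrow> ('b \<Rightarrow> complex) \<Rightarrow> bool" where
  "wiener_integral P B g W \<longleftrightarrow>
     W \<in> borel_measurable P \<and>
     (\<integral>\<^sup>+ \<omega>. ennreal ((cmod (W \<omega>))\<^sup>2) \<partial>P) < \<infinity> \<and>
     (\<forall>hs :: nat \<Rightarrow> (complex \<times> real \<times> real) list.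
        (\<forall>n. \<forall>(c, a, b) \<in> set (hs n). 0 \<le> a \<and> a \<le> b) \<and>
        (\<lambda>n. \<integral>\<^sup>+ y. ennreal ((cmod (g y - step_fun (hs n) y))\<^sup>2) * indicator {0..} y \<partial>lborel)
          \<longlonglongrightarrow> 0
        \<longrightarrow> (\<lambda>n. \<integral>\<^sup>+ \<omega>. ennreal ((cmod (W \<omega> - step_int B (hs n) \<omega>))\<^sup>2) \<partial>P) \<longlonglongrightarrow> 0)"

definition I_kernel :: "real \<Rightarrow> complex \<Rightarrow> real \<Rightarrow> complex" where
  "I_kernel \<alpha> z y = complex_of_real (y powr \<alpha>) * exp (- z * complex_of_real y)"

text \<open>Symmetric nonnegative square root [[p,q],[q,r]] of the 2x2 matrix [[a,b],[b,d]].\<close>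
definition psd_sqrt2 :: "real \<Rightarrow> real \<Rightarrow> real \<Rightarrow> real \<times> real \<times> real" where
  "psd_sqrt2 a b d = (THE (p, q, r). 0 \<le> p \<and> 0 \<le> r \<and> q\<^sup>2 \<le> p * r \<and>
       p\<^sup>2 + q\<^sup>2 = a \<and> p * q + q * r = b \<and> q\<^sup>2 + r\<^sup>2 = d)"

text \<open>Bounded functionals on the space of analytic functions on H0 that are continuous for the
  topology of locally uniform convergence (metrizable, so sequential continuity suffices).
  These are the test functions for weak convergence of probability measures on A(H0).\<close>
definition hol_test_fun :: "((complex \<Rightarrow> complex) \<Rightarrow> real) \<Rightarrow> bool" where
  "hol_test_fun F \<longleftrightarrow>
     (\<exists>K. \<forall>f. f holomorphic_on H0 \<longrightarrow> \<bar>F f\<bar> \<le> K) \<and>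
     (\<forall>f fs. f holomorphic_on H0 \<and> (\<forall>n. fs n holomorphic_on H0) \<and>
        (\<forall>K. compact K \<and> K \<subseteq> H0 \<longrightarrow> uniform_limit K fs f sequentially)
        \<longrightarrow> (\<lambda>n. F (fs n)) \<longlonglongrightarrow> F f)"

end

(* An analytic function f on the half-plane H0 is determined by the Taylor coefficients of its pullback
   to the unit disc under the Cayley transform, and the test functionals are continuous in these
   coefficients on the compact sets cut out by subexponential bounds. Clamping the coefficients with
   arcsin o sin and applying Stone-Weierstrass on an infinite-dimensional cube, a test functional is
   approximated by trigonometric polynomials in the coefficients, with a bound that holds everywhere
   and an error that is small off an event controlled by second moments. Weak convergence thus reduces
   to second moment bounds and to the convergence of the characteristic functions of finite linear
   combinations of coefficients. For the Dirichlet series these combinations are weighted sums of i.i.d.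
   pairs: they are handled by Lindeberg's argument, and the limiting variance is a Riemann sum in
   y = s log n. For the limit process the coefficients are limits of averages of finitely many
   evaluations, and the latter are L2 limits of Gaussian step integrals. Almost sure convergence of the
   Dirichlet series is Kolmogorov's one-series theorem together with Abel summation. *)

theory Submission
  imports Defs "HOL-Complex_Analysis.Complex_Analysis" "HOL-Real_Asymp.Real_Asymp"
begin

section \<open>Taylor coefficients in Cayley coordinates\<close>

text \<open>The obstacle is that an approximation valid on a compact set says nothing off it, and
  that a polynomial in the coefficients would be unbounded there. Clamping makes the approximant
  bounded by nearly the same constant as the functional at every point, so leaving the compact set
  costs at most a constant times the probability of doing so. This takes the place of tightness and
  Prokhorov's theorem. The probability is controlled by a union bound over all coefficients, which
  needs second moments growing subexponentially in the index, uniformly in \<open>s\<close>. They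
  grow polynomially: Cauchy's estimate for the \<open>k\<close>-th coefficient of
  \<open>exp (- z * y)\<close> on the circle of radius \<open>1 - 1 / (k + 2)\<close> costs a factor
  at most \<open>e\<close> and keeps a decay in \<open>y\<close> at a rate of order
  \<open>1 / k\<close>. Gaussian laws are treated through characteristic functions, because the
  limiting variance of a linear combination may vanish.\<close>

definition cayley :: "complex \<Rightarrow> complex" where
  "cayley w = (1 + w) / (1 - w)"

definition cayley_inv :: "complex \<Rightarrow> complex" where
  "cayley_inv z = (z - 1) / (z + 1)"

lemma open_H0: "open H0"
  unfolding H0_def by (rule open_halfspace_Re_gt)

lemma H0_neq: "z \<in> H0 \<Longrightarrow> z + 1 \<noteq> 0"
  by (auto simp: H0_def complex_eq_iff)

lemma norm_cayley_inv: 
  assumes "z \<in> H0" shows "cmod (cayley_inv z) < 1"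
proof -
  have "(cmod (z - 1))\<^sup>2 < (cmod (z + 1))\<^sup>2"
    using assms unfolding cmod_power2 H0_def by (simp add: power2_eq_square algebra_simps)
  then have "cmod (z - 1) < cmod (z + 1)"
    by (rule power2_less_imp_less) simp
  then show ?thesis using H0_neq[OF assms]
    by (simp add: cayley_inv_def norm_divide divide_simps)
qed

lemma cayley_cayley_inv: "z \<in> H0 \<Longrightarrow> cayley (cayley_inv z) = z"
proof -
  assume z: "z \<in> H0"
  have "1 + cayley_inv z = 2 * z / (z + 1)" "1 - cayley_inv z = 2 / (z + 1)"
    using H0_neq[OF z] by (auto simp: cayley_inv_def field_simps)
  then show ?thesis using H0_neq[OF z] by (simp add: cayley_def)
qed

text \<open>\<open>Re (cayley w)\<close> is the Poisson kernel \<open>(1 - r^2) / |1 - w|^2\<close>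
  with \<open>r = cmod w\<close>, smallest at \<open>w = - r\<close>. The bound turns a radius in
  the disc into a decay rate for \<open>exp (- z * y)\<close>.\<close>

lemma Re_cayley:
  assumes "cmod w < 1" shows "(1 - cmod w) / (1 + cmod w) \<le> Re (cayley w)"
proof -
  define r where "r = cmod w"
  have r: "0 \<le> r" "r < 1" using assms by (auto simp: r_def)
  have ne: "1 - w \<noteq> 0" using assms by auto
  have "cmod (1 - w) \<le> 1 + r" using norm_triangle_ineq4[of 1 w] by (simp add: r_def)
  then have le: "(cmod (1 - w))\<^sup>2 \<le> (1 + r)\<^sup>2" by (intro power_mono) auto
  have eq: "Re (cayley w) = (1 - r\<^sup>2) / (cmod (1 - w))\<^sup>2"
    unfolding cayley_def Re_divide r_def cmod_power2 by (simp add: power2_eq_square algebra_simps)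
  have "(1 - r) / (1 + r) = (1 - r\<^sup>2) / (1 + r)\<^sup>2" 
  proof -
    have "1 - r\<^sup>2 = (1 - r) * (1 + r)" by (simp add: power2_eq_square algebra_simps)
    then show ?thesis using r by (simp add: power2_eq_square)
  qed
  also have "\<dots> \<le> (1 - r\<^sup>2) / (cmod (1 - w))\<^sup>2"
    using le r ne by (intro divide_left_mono mult_pos_pos) (auto simp: power_le_one)
  finally show ?thesis using eq by (simp add: r_def)
qed

lemma cayley_in_H0: 
  assumes "cmod w < 1" shows "cayley w \<in> H0"
proof -
  have "0 < (1 - cmod w) / (1 + cmod w)" using assms
    by (intro divide_pos_pos) (auto intro: add_pos_nonneg)
  with Re_cayley[OF assms] show ?thesis by (simp add: H0_def)
qed

lemma holomorphic_cayley_inv: "cayley_inv holomorphic_on H0"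
  unfolding cayley_inv_def using H0_neq by (intro holomorphic_intros) auto

lemma holomorphic_comp_cayley:
  assumes "f holomorphic_on H0" shows "(f \<circ> cayley) holomorphic_on ball 0 1"
proof (rule holomorphic_on_compose_gen[OF _ assms])
  show "cayley holomorphic_on ball 0 1"
    unfolding cayley_def by (intro holomorphic_intros) auto
  show "cayley ` ball 0 1 \<subseteq> H0" using cayley_in_H0 by auto
qed

lemma tannery_sequence:
  fixes a :: "nat \<Rightarrow> nat \<Rightarrow> 'a :: {real_normed_algebra, banach}"
  assumes "\<And>k. (\<lambda>n. a k n) \<longlonglongrightarrow> b k" "\<And>k n. norm (a k n) \<le> M k" "summable M"
  shows "(\<lambda>n. \<Sum>k. a k n) \<longlonglongrightarrow> suminf b"
  using tannerys_theorem[of a b sequentially M] assms by (auto intro: always_eventually)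

text \<open>A Taylor expansion at the point 1 of \<open>H0\<close> is only guaranteed to converge on
  the disc of radius 1; in the Cayley coordinate one sequence describes \<open>f\<close> on the
  whole half-plane.\<close>

definition coef :: "(complex \<Rightarrow> complex) \<Rightarrow> nat \<Rightarrow> complex" where
  "coef f k = (deriv ^^ k) (f \<circ> cayley) 0 / fact k"

lemma coef_sums_disc:
  assumes "f holomorphic_on H0" "cmod w < 1"
  shows "(\<lambda>k. coef f k * w ^ k) sums f (cayley w)"
  using holomorphic_power_series[OF holomorphic_comp_cayley[OF assms(1)], of w] assms(2)
  by (simp add: coef_def)

lemma coef_sums:
  assumes "f holomorphic_on H0" "z \<in> H0"
  shows "(\<lambda>k. coef f k * cayley_inv z ^ k) sums f z"
  using coef_sums_disc[OF assms(1) norm_cayley_inv[OF assms(2)]] cayley_cayley_inv[OF assms(2)]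
    by simp

lemma summable_norm_coef:
  assumes "f holomorphic_on H0" "0 \<le> r" "r < 1"
  shows "summable (\<lambda>k. cmod (coef f k) * r ^ k)"
proof -
  define \<rho> where "\<rho> = (1 + r) / 2"
  have rho: "r < \<rho>" "\<rho> < 1" "0 < \<rho>" using assms by (auto simp: \<rho>_def)
  have "summable (\<lambda>k. coef f k * complex_of_real \<rho> ^ k)"
    using coef_sums_disc[OF assms(1), of "of_real \<rho>"] rho by (auto simp: sums_iff)
  from powser_insidea[OF this, of "complex_of_real r"] show ?thesis
    using assms rho by (simp add: norm_mult norm_power)
qed

text \<open>A discretised Cauchy integral for the \<open>k\<close>-th coefficient. It uses finitely many
  evaluations, and these are all that is known about the law of the limit process.\<close>

definition circle_avg :: "real \<Rightarrow> nat \<Rightarrow> nat \<Rightarrow> (complex \<Rightarrow> complex) \<Rightarrow> complex" where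
  "circle_avg r m k f = (\<Sum>j<m. cis (- 2 * pi * real j * real k / real m)
    / (of_nat m * of_real (r ^ k))
      * f (cayley (of_real r * cis (2 * pi * real j / real m))))"

text \<open>Orthogonality of the characters of the cyclic group of order \<open>m\<close>: the
  summands are powers of one root of unity, and the sum is geometric.\<close>

lemma sum_cis_multiples:
  assumes "m > 0"
  shows "(\<Sum>j<m. cis (2 * pi * real j * (real l - real k) / real m))
     = (if int m dvd int l - int k then of_nat m else 0)"
proof -
  define d where "d = int l - int k"
  define \<zeta> where "\<zeta> = cis (2 * pi * of_int d / real m)"
  have d: "real l - real k = of_int d" by (simp add: d_def)
  have eq: "cis (2 * pi * real j * (real l - real k) / real m) = \<zeta> ^ j" for j
    unfolding \<zeta>_def Complex.DeMoivre d by (simp add: mult_ac)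
  have pow: "\<zeta> ^ m = 1"
  proof -
    have "\<zeta> ^ m = cis (2 * pi * of_int d)" unfolding \<zeta>_def Complex.DeMoivre using assms by simp
    also have "\<dots> = 1" by (rule cis_multiple_2pi) simp
    finally show ?thesis .
  qed
  have one: "\<zeta> = 1 \<longleftrightarrow> int m dvd d"
  proof
    assume "\<zeta> = 1"
    then have "cos (2 * pi * of_int d / real m) = 1" by (auto simp: \<zeta>_def complex_eq_iff)
    then obtain n :: int where "2 * pi * of_int d / real m = of_int n * 2 * pi"
      unfolding cos_one_2pi_int by blast
    then have "real_of_int d = of_int n * of_int (int m)" using assms by (simp add: field_simps)
    then have "d = n * int m" by (metis of_int_eq_iff of_int_mult)
    then show "int m dvd d" by simp
  next
    assume "int m dvd d"
    then obtain n where "d = int m * n" by auto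
    then have "2 * pi * of_int d / real m = 2 * pi * of_int n" using assms by simp
    then show "\<zeta> = 1" unfolding \<zeta>_def by (simp only: cis_multiple_2pi Ints_of_int)
  qed
  show ?thesis
  proof (cases "\<zeta> = 1")
    case True then show ?thesis using one by (simp add: eq d_def)
  next
    case False
    then have "(\<Sum>j<m. \<zeta> ^ j) = 0" using pow by (simp add: geometric_sum)
    then show ?thesis using False one unfolding eq d_def[symmetric] by simp
  qed
qed

text \<open>By orthogonality the average sees every coefficient whose index \<open>l\<close> is
  congruent to \<open>k\<close> modulo \<open>m\<close>, weighted by \<open>r ^ l / r ^ k\<close>.
  For \<open>l \<noteq> k\<close> this stops once \<open>m > l + k\<close>, and absolute convergence
  at radius \<open>r\<close> allows the limit inside the series.\<close>

lemma circle_avg_tendsto: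
  assumes f: "f holomorphic_on H0" and r: "0 < r" "r < 1"
  shows "(\<lambda>m. circle_avg r m k f) \<longlonglongrightarrow> coef f k"
proof -
  define a where "a = (\<lambda>l m. (if int m dvd int l - int k then coef f l * of_real (r ^ l)
    / of_real (r ^ k) else 0))"
  define b where "b = (\<lambda>l. if l = k then coef f l else 0)"
  have circle_avg: "circle_avg r m k f = (\<Sum>l. a l m)" if m: "m > 0" for m
  proof -
    have s: "(\<lambda>l. coef f l * (of_real r * cis (2 * pi * real j / real m)) ^ l) 
       sums f (cayley (of_real r * cis (2 * pi * real j / real m)))" for j
      using coef_sums_disc[OF f, of "of_real r * cis (2 * pi * real j / real m)"] r
        by (simp add: norm_mult)
    have "(\<lambda>l. \<Sum>j<m. cis (- 2 * pi * real j * real k / real m) / (of_nat m * of_real (r ^ k)) *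
        (coef f l * (of_real r * cis (2 * pi * real j / real m)) ^ l)) sums circle_avg r m k f"
      unfolding circle_avg_def by (intro sums_sum sums_mult s)
    moreover have "(\<Sum>j<m. cis (- 2 * pi * real j * real k / real m) / (of_nat m * of_real (r ^ k)) *
        (coef f l * (of_real r * cis (2 * pi * real j / real m)) ^ l)) = a l m" for l
    proof -
      have *: "cis (- 2 * pi * real j * real k / real m) * cis (2 * pi * real j / real m) ^ l
         = cis (2 * pi * real j * (real l - real k) / real m)" for j
        unfolding Complex.DeMoivre cis_mult
          by (rule arg_cong[of _ _ cis]) (simp add: field_simps diff_divide_distrib)
      have "(\<Sum>j<m. cis (- 2 * pi * real j * real k / real m) / (of_nat m * of_real (r ^ k)) *
        (coef f l * (of_real r * cis (2 * pi * real j / real m)) ^ l)) = 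
        (\<Sum>j<m. (coef f l * of_real (r ^ l) / (of_nat m * of_real (r ^ k)))
          * cis (2 * pi * real j * (real l - real k) / real m))"
        unfolding *[symmetric] by (intro sum.cong refl) (simp add: power_mult_distrib field_simps)
      also have "\<dots> = a l m" unfolding sum_distrib_left[symmetric] sum_cis_multiples[OF m] a_def
        using m by simp
      finally show ?thesis .
    qed
    ultimately show ?thesis by (simp add: sums_iff)
  qed
  have lim: "(\<lambda>m. a l m) \<longlonglongrightarrow> b l" for l
  proof (cases "l = k")
    case True then show ?thesis using r by (simp add: a_def b_def)
  next
    case False
    have "\<forall>\<^sub>F m in sequentially. a l m = b l"
      using eventually_gt_at_top[of "l + k"]
    proof eventually_elim
      case (elim m)
      have "\<not> int m dvd int l - int k" using False elim zdvd_imp_le[of "int m" "\<bar>int l - int k\<bar>"]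
        by auto
      then show ?case using False by (simp add: a_def b_def)
    qed
    then show ?thesis by (rule tendsto_eventually)
  qed
  have "(\<lambda>m. \<Sum>l. a l m) \<longlonglongrightarrow> suminf b"
  proof (rule tannery_sequence[of a b "\<lambda>l. cmod (coef f l) * r ^ l / r ^ k"])
    show "cmod (a l n) \<le> cmod (coef f l) * r ^ l / r ^ k" for l n
      using r by (auto simp: a_def norm_mult norm_divide norm_power)
    show "summable (\<lambda>l. cmod (coef f l) * r ^ l / r ^ k)"
      using r by (intro summable_divide summable_norm_coef[OF f]) auto
  qed (use lim in auto)
  moreover have "suminf b = coef f k"
    unfolding b_def by (subst suminf_finite[of "{k}"]) auto
  moreover have "\<forall>\<^sub>F m in sequentially. (\<Sum>l. a l m) = circle_avg r m k f"
    using eventually_gt_at_top[of 0] by eventually_elim (simp add: circle_avg)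
  ultimately show ?thesis by (auto elim: Lim_transform_eventually)
qed

text \<open>Cauchy's estimate already for the discrete average. Being uniform in \<open>m\<close>,
  it also provides the domination when \<open>m\<close> tends to infinity under an integral.\<close>

lemma norm_circle_avg_le:
  assumes r: "0 < r" "r < 1" and B: "\<And>w. cmod w = r \<Longrightarrow> cmod (f (cayley w)) \<le> B"
  shows "cmod (circle_avg r m k f) \<le> B / r ^ k"
proof (cases "m = 0")
  case False
  have "cmod (circle_avg r m k f) \<le> (\<Sum>j<m. 1 / (real m * r ^ k) * B)"
    unfolding circle_avg_def
  proof (rule sum_norm_le)
    fix j
    have "cmod (f (cayley (of_real r * cis (2 * pi * real j / real m)))) \<le> B"
      using r by (intro B) (simp add: norm_mult)
    then show "cmod (cis (- 2 * pi * real j * real k / real m) / (of_nat m * of_real (r ^ k))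
      * f (cayley (of_real r * cis (2 * pi * real j / real m)))) \<le> 1 / (real m * r ^ k) * B"
      unfolding norm_mult norm_divide using r by (intro mult_mono) (auto simp: norm_power)
  qed
  also have "\<dots> = B / r ^ k" using False by simp
  finally show ?thesis .
next
  case True
  \<comment> \<open>For \<open>m = 0\<close> the average is an empty sum; only
    \<open>0 \<le> B\<close> has to be shown.\<close>
  have "cmod (f (cayley (of_real r))) \<le> B" using r by (intro B) simp
  then have "0 \<le> B" using norm_ge_zero order_trans by blast
  then show ?thesis using True r by (simp add: circle_avg_def)
qed

lemma norm_coef_le:
  assumes f: "f holomorphic_on H0" and r: "0 < r" "r < 1" 
    and B: "\<And>w. cmod w = r \<Longrightarrow> cmod (f (cayley w)) \<le> B"
  shows "cmod (coef f k) \<le> B / r ^ k"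
  by (rule LIMSEQ_le_const2[OF tendsto_norm[OF circle_avg_tendsto[OF f r]]])
    (use norm_circle_avg_le[of r f B, OF r] B in blast)

lemma circle_avg_sum_scale: "circle_avg r m k (\<lambda>z. \<Sum>i\<in>I. c i * f i z)
  = (\<Sum>i\<in>I. c i * circle_avg r m k (f i))"
  unfolding circle_avg_def sum_distrib_left by (subst sum.swap) (simp add: mult_ac)

text \<open>Linearity is a finite identity for the averages and survives their limit; no iterated
  derivatives are needed.\<close>

lemma coef_sum_scale:
  assumes "\<And>i. i \<in> I \<Longrightarrow> f i holomorphic_on H0"
  shows "coef (\<lambda>z. \<Sum>i\<in>I. c i * f i z) k = (\<Sum>i\<in>I. c i * coef (f i) k)"
proof (rule LIMSEQ_unique)
  show "(\<lambda>m. circle_avg (1/2) m k (\<lambda>z. \<Sum>i\<in>I. c i * f i z)) \<longlonglongrightarrow> coef (\<lambda>z. \<Sum>i\<in>I. c i * f i z) k"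
    using assms by (intro circle_avg_tendsto holomorphic_intros) auto
  show "(\<lambda>m. circle_avg (1/2) m k (\<lambda>z. \<Sum>i\<in>I. c i * f i z)) \<longlonglongrightarrow> (\<Sum>i\<in>I. c i * coef (f i) k)"
    unfolding circle_avg_sum_scale using assms by (intro tendsto_intros circle_avg_tendsto) auto
qed

lemma coef_diff:
  assumes "f holomorphic_on H0" "g holomorphic_on H0"
  shows "coef (\<lambda>z. f z - g z) k = coef f k - coef g k"
  using coef_sum_scale[of "UNIV :: bool set" "\<lambda>b. if b then f else g" "\<lambda>b. if b then 1 else - 1"
    k] assms
  by (auto simp: UNIV_bool)

text \<open>Cauchy's estimate for the difference on the circle of radius 1/2, whose Cayley image is
  a compact subset of \<open>H0\<close>.\<close>

lemma coef_tendsto: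
  assumes f: "f holomorphic_on H0" and fs: "\<And>n. fs n holomorphic_on H0"
    and lim: "\<And>K. compact K \<Longrightarrow> K \<subseteq> H0 \<Longrightarrow> uniform_limit K fs f sequentially"
  shows "(\<lambda>n. coef (fs n) k) \<longlonglongrightarrow> coef f k"
proof (rule tendstoI)
  fix e :: real assume e: "e > 0"
  define K where "K = cayley ` sphere 0 (1/2)"
  have "compact K" unfolding K_def
  proof (rule compact_continuous_image)
    show "continuous_on (sphere 0 (1/2)) cayley" unfolding cayley_def
      by (intro continuous_intros) auto
  qed simp
  moreover have "K \<subseteq> H0" by (auto simp: K_def intro!: cayley_in_H0)
  ultimately have "uniform_limit K fs f sequentially" by (rule lim)
  moreover have "e / 2 * (1/2) ^ k > 0" using e by simp
  ultimately have "\<forall>\<^sub>F n in sequentially. \<forall>z\<in>K. dist (fs n z) (f z) < e / 2 * (1/2) ^ k"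
    unfolding uniform_limit_iff by blast
  then show "\<forall>\<^sub>F n in sequentially. dist (coef (fs n) k) (coef f k) < e"
  proof eventually_elim
    case (elim n)
    have "cmod (coef (\<lambda>z. fs n z - f z) k) \<le> (e / 2 * (1/2) ^ k) / (1/2) ^ k"
    proof (rule norm_coef_le)
      show "(\<lambda>z. fs n z - f z) holomorphic_on H0" using fs f by (intro holomorphic_intros) auto
      fix w :: complex assume "cmod w = 1/2"
      then have "cayley w \<in> K" by (auto simp: K_def)
      then show "cmod (fs n (cayley w) - f (cayley w)) \<le> e / 2 * (1/2) ^ k"
        using elim by (auto simp: dist_norm intro: less_imp_le)
    qed auto
    also have "\<dots> < e" using e by simp
    finally show ?case unfolding coef_diff[OF fs f] dist_norm .
  qed
qed

text \<open>The coefficients are \<open>exp (- y)\<close> times the Laguerre polynomials of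
  parameter -1 at \<open>2 * y\<close>. The radius in Cauchy's estimate depends on \<open>k\<close>:
  for \<open>r = (k + 1) / (k + 2)\<close> the loss \<open>1 / r ^ k\<close> stays below
  \<open>exp 1\<close>, while \<open>Re_cayley\<close> still gives the decay rate
  \<open>(1 - r) / (1 + r) = 1 / (2 * k + 3)\<close>.\<close>

lemma norm_coef_exp:
  assumes "0 \<le> y"
  shows "cmod (coef (\<lambda>z. exp (- z * of_real y)) k) \<le> exp 1 * exp (- y / (2 * real k + 3))"
proof -
  define r where "r = (real k + 1) / (real k + 2)"
  have r: "0 < r" "r < 1" by (auto simp: r_def)
  have rr: "(1 - r) / (1 + r) = 1 / (2 * real k + 3)" by (simp add: r_def field_simps)
  have "cmod (coef (\<lambda>z. exp (- z * of_real y)) k) \<le> exp (- y / (2 * real k + 3)) / r ^ k"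
  proof (rule norm_coef_le[OF _ r])
    show "(\<lambda>z. exp (- z * of_real y)) holomorphic_on H0" by (intro holomorphic_intros)
    fix w :: complex assume w: "cmod w = r"
    have "1 / (2 * real k + 3) * y \<le> Re (cayley w) * y"
      using Re_cayley[of w] w r rr assms by (intro mult_right_mono) auto
    then show "cmod (exp (- cayley w * of_real y)) \<le> exp (- y / (2 * real k + 3))"
      by simp
  qed
  also have "1 / r ^ k \<le> exp 1"
  proof -
    have "1 / r ^ k = (1 + 1 / (real k + 1)) ^ k" by (simp add: r_def power_divide field_simps)
    also have "\<dots> \<le> (exp (1 / (real k + 1))) ^ k" by (intro power_mono exp_ge_add_one_self) auto
    also have "\<dots> = exp (real k / (real k + 1))" by (simp add: exp_of_nat_mult[symmetric])
    also have "\<dots> \<le> exp 1" by (simp add: field_simps)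
    finally show ?thesis .
  qed
  then have "exp (- y / (2 * real k + 3)) / r ^ k \<le> exp 1 * exp (- y / (2 * real k + 3))"
    using mult_left_mono[of "1 / r ^ k" "exp 1" "exp (- y / (2 * real k + 3))"]
      by (simp add: mult.commute)
  finally show ?thesis .
qed

section \<open>From coefficient sequences back to analytic functions and test functionals\<close>

definition cayley_series :: "(nat \<Rightarrow> complex) \<Rightarrow> complex \<Rightarrow> complex" where
  "cayley_series b z = (\<Sum>k. b k * cayley_inv z ^ k)"

text \<open>The growth condition satisfied by the coefficients of every analytic function on the unit disc.\<close>

definition subexp :: "(nat \<Rightarrow> real) \<Rightarrow> bool" where
  "subexp L \<longleftrightarrow> (\<forall>r. 0 \<le> r \<and> r < 1 \<longrightarrow> summable (\<lambda>k. L k * r ^ k))"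

text \<open>\<open>cayley_inv\<close> maps the compact set into a closed disc of radius
  \<open>r < 1\<close>. There the difference is at most the sum of
  \<open>cmod (bn n k - b k) * r ^ k\<close>, which tends to 0 by domination with
  \<open>2 * L k * r ^ k\<close>.\<close>

lemma cayley_series_uniform_limit:
  assumes L: "subexp L" and bn: "\<And>n k. cmod (bn n k) \<le> L k" and lim: "\<And>k. (\<lambda>n. bn n k) \<longlonglongrightarrow> b k"
    and K: "compact K" "K \<subseteq> H0"
  shows "uniform_limit K (\<lambda>n. cayley_series (bn n)) (cayley_series b) sequentially"
proof (cases "K = {}")
  case False
  have b: "cmod (b k) \<le> L k" for k
    by (rule LIMSEQ_le_const2[OF tendsto_norm[OF lim]]) (use bn in auto)
  have "continuous_on K (\<lambda>z. cmod (cayley_inv z))"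
    by (intro continuous_intros holomorphic_on_imp_continuous_on holomorphic_on_subset[OF
      holomorphic_cayley_inv K(2)])
  then obtain z0 where z0: "z0 \<in> K" "\<And>z. z \<in> K \<Longrightarrow> cmod (cayley_inv z) \<le> cmod (cayley_inv z0)"
    using continuous_attains_sup[OF K(1) False] by blast
  define r where "r = cmod (cayley_inv z0)"
  have r: "0 \<le> r" "r < 1" using norm_cayley_inv z0 K by (auto simp: r_def)
  have sL: "summable (\<lambda>k. L k * r ^ k)" using L r by (auto simp: subexp_def)
  define d where "d = (\<lambda>n. \<Sum>k. cmod (bn n k - b k) * r ^ k)"
  have dle: "cmod (bn n k - b k) \<le> 2 * L k" for n k
    using norm_triangle_ineq4[of "bn n k" "b k"] bn[of n k] b[of k] by simp
  have "d \<longlonglongrightarrow> (\<Sum>k. 0)" unfolding d_def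
  proof (rule tannery_sequence[where M = "\<lambda>k. 2 * (L k * r ^ k)"])
    fix k have "(\<lambda>n. cmod (bn n k - b k) * r ^ k) \<longlonglongrightarrow> cmod (b k - b k) * r ^ k"
      by (intro tendsto_intros lim)
    then show "(\<lambda>n. cmod (bn n k - b k) * r ^ k) \<longlonglongrightarrow> 0" by simp
  next
    show "norm (cmod (bn n k - b k) * r ^ k) \<le> 2 * (L k * r ^ k)" for k n
      using dle r by (auto simp: mult.assoc[symmetric] intro!: mult_right_mono)
  qed (use sL in \<open>auto intro: summable_mult\<close>)
  then have d0: "d \<longlonglongrightarrow> 0" by simp
  show ?thesis
  proof (rule uniform_limitI)
    fix e :: real assume "e > 0"
    with d0 have "\<forall>\<^sub>F n in sequentially. d n < e" by (rule order_tendstoD)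
    then show "\<forall>\<^sub>F n in sequentially. \<forall>z\<in>K. dist (cayley_series (bn n) z) (cayley_series b z) < e"
    proof eventually_elim
      case (elim n)
      show ?case
      proof
        fix z assume z: "z \<in> K"
        have le: "cmod (cayley_inv z) \<le> r" using z0 z by (simp add: r_def)
        have s: "summable (\<lambda>k. c k * cayley_inv z ^ k)" if "\<And>k. cmod (c k) \<le> L k" for c
          by (rule summable_comparison_test'[OF sL, of 0])
            (auto simp: norm_mult norm_power intro!: mult_mono power_mono that le order_trans[OF
              norm_ge_zero that])
        have le2: "norm ((bn n k - b k) * cayley_inv z ^ k) \<le> cmod (bn n k - b k) * r ^ k" for k
          by (auto simp: norm_mult norm_power intro!: mult_mono power_mono le)
        have s3: "summable (\<lambda>k. cmod (bn n k - b k) * r ^ k)"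
          by (rule summable_comparison_test'[OF summable_mult[OF sL, of 2], of 0])
            (use dle r in \<open>auto simp: mult.assoc[symmetric] intro!: mult_right_mono\<close>)
        have "cayley_series (bn n) z - cayley_series b z = (\<Sum>k. (bn n k - b k) * cayley_inv z ^ k)"
          unfolding cayley_series_def using suminf_diff[OF s[of "bn n"] s[of b]] bn b
            by (simp add: algebra_simps)
        also have "cmod \<dots> \<le> d n" unfolding d_def
          by (rule norm_suminf_le[OF le2 s3])
        finally show "dist (cayley_series (bn n) z) (cayley_series b z) < e" using elim
          by (simp add: dist_norm)
      qed
    qed
  qed
qed auto

lemma cayley_series_holomorphic:
  assumes L: "subexp L" and b: "\<And>k. cmod (b k) \<le> L k"
  shows "cayley_series b holomorphic_on H0"
proof (rule holomorphic_uniform_sequence[OF open_H0])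
  have eq: "cayley_series (\<lambda>k. if k < n then b k else 0) = (\<lambda>z. \<Sum>k<n. b k * cayley_inv z ^ k)" for n
    unfolding cayley_series_def by (rule ext, subst suminf_finite[of "{..<n}"]) auto
  show "cayley_series (\<lambda>k. if k < n then b k else 0) holomorphic_on H0" for n
    unfolding eq by (intro holomorphic_intros holomorphic_cayley_inv)
  fix x assume "x \<in> H0"
  then obtain d where d: "d > 0" "cball x d \<subseteq> H0" using open_H0 open_contains_cball by blast
  have "uniform_limit (cball x d) (\<lambda>n. cayley_series (\<lambda>k. if k < n then b k else 0))
    (cayley_series b) sequentially"
  proof (rule cayley_series_uniform_limit[OF L _ _ _ d(2)])
    show "cmod (if k < n then b k else 0) \<le> L k" for n k
      using b[of k] order_trans[OF norm_ge_zero b[of k]] by simp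
    show "(\<lambda>n. if k < n then b k else 0) \<longlonglongrightarrow> b k" for k
      by (rule tendsto_eventually, rule eventually_mono[OF eventually_gt_at_top[of k]]) auto
  qed simp
  then show "\<exists>d>0. cball x d \<subseteq> H0 \<and> uniform_limit (cball x d)
    (\<lambda>n. cayley_series (\<lambda>k. if k < n then b k else 0)) (cayley_series b) sequentially"
    using d by blast
qed

lemma subexp_coef: "f holomorphic_on H0 \<Longrightarrow> subexp (\<lambda>k. cmod (coef f k))"
  unfolding subexp_def using summable_norm_coef by blast

lemma cayley_series_coef: "f holomorphic_on H0 \<Longrightarrow> z \<in> H0 \<Longrightarrow> cayley_series (coef f) z = f z"
  unfolding cayley_series_def using coef_sums[of f z] by (simp add: sums_iff)

lemma hol_test_fun_tendsto:
  assumes "hol_test_fun F" "f holomorphic_on H0" "\<And>n. fs n holomorphic_on H0"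
    "\<And>K. compact K \<Longrightarrow> K \<subseteq> H0 \<Longrightarrow> uniform_limit K fs f sequentially"
  shows "(\<lambda>n. F (fs n)) \<longlonglongrightarrow> F f"
  using assms unfolding hol_test_fun_def by blast

text \<open>Inside a box with subexponential radii, continuity for locally uniform convergence
  becomes continuity for the product topology. This is what makes the functional accessible to
  Stone-Weierstrass on a cube.\<close>

lemma hol_test_fun_series_tendsto:
  assumes F: "hol_test_fun F" and L: "subexp L" and bn: "\<And>n k. cmod (bn n k) \<le> L k" 
    and lim: "\<And>k. (\<lambda>n. bn n k) \<longlonglongrightarrow> b k"
  shows "(\<lambda>n. F (cayley_series (bn n))) \<longlonglongrightarrow> F (cayley_series b)"
proof (rule hol_test_fun_tendsto[OF F])
  have b: "cmod (b k) \<le> L k" for k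
    by (rule LIMSEQ_le_const2[OF tendsto_norm[OF lim]]) (use bn in auto)
  show "cayley_series b holomorphic_on H0" by (rule cayley_series_holomorphic[OF L b])
  show "cayley_series (bn n) holomorphic_on H0" for n by (rule cayley_series_holomorphic[OF L bn])
  show "uniform_limit K (\<lambda>n. cayley_series (bn n)) (cayley_series b) sequentially"
    if "compact K" "K \<subseteq> H0" for K
    by (rule cayley_series_uniform_limit[OF L bn lim that])
qed

text \<open>In particular the value of a test functional depends only on the restriction of its argument
  to \<open>H0\<close>: a constant sequence converges to any function that agrees with it there.\<close>

lemma hol_test_fun_series_coef:
  assumes F: "hol_test_fun F" and f: "f holomorphic_on H0"
  shows "F (cayley_series (coef f)) = F f"
proof -
  have h: "cayley_series (coef f) holomorphic_on H0"
    by (rule cayley_series_holomorphic[OF subexp_coef[OF f]]) simp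
  have "(\<lambda>n::nat. F f) \<longlonglongrightarrow> F (cayley_series (coef f))"
  proof (rule hol_test_fun_tendsto[OF F h])
    fix K :: "complex set" assume "compact K" "K \<subseteq> H0"
    then show "uniform_limit K (\<lambda>n::nat. f) (cayley_series (coef f)) sequentially"
      by (intro uniform_limitI always_eventually allI ballI) (use cayley_series_coef[OF f] in auto)
  qed (use f in auto)
  then show ?thesis by (simp add: LIMSEQ_const_iff)
qed

lemma measurable_coef:
  assumes X: "\<And>\<omega>. \<omega> \<in> space M \<Longrightarrow> X \<omega> holomorphic_on H0"
    and meas: "\<And>z. z \<in> H0 \<Longrightarrow> (\<lambda>\<omega>. X \<omega> z) \<in> borel_measurable M"
  shows "(\<lambda>\<omega>. coef (X \<omega>) k) \<in> borel_measurable M"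
proof (rule borel_measurable_LIMSEQ_metric)
  fix \<omega> assume "\<omega> \<in> space M"
  then show "(\<lambda>m. circle_avg (1/2) m k (X \<omega>)) \<longlonglongrightarrow> coef (X \<omega>) k"
    by (intro circle_avg_tendsto X) auto
next
  fix m
  have "(\<lambda>\<omega>. X \<omega> (cayley (of_real (1/2) * cis t))) \<in> borel_measurable M" for t
    by (intro meas cayley_in_H0) (simp add: norm_mult)
  then show "(\<lambda>\<omega>. circle_avg (1/2) m k (X \<omega>)) \<in> borel_measurable M"
    unfolding circle_avg_def by measurable
qed

text \<open>No measurable structure on the space of analytic functions is needed. On sequences cut
  off at \<open>n\<close> the functional is continuous in the product topology, hence Borel, and
  \<open>n\<close> tending to infinity recovers \<open>F\<close> pointwise.\<close>

lemma measurable_hol_test_fun: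
  assumes F: "hol_test_fun F" and X: "\<And>\<omega>. \<omega> \<in> space M \<Longrightarrow> X \<omega> holomorphic_on H0"
    and meas: "\<And>z. z \<in> H0 \<Longrightarrow> (\<lambda>\<omega>. X \<omega> z) \<in> borel_measurable M"
  shows "(\<lambda>\<omega>. F (X \<omega>)) \<in> borel_measurable M"
proof -
  define T where "T = (\<lambda>n (b :: nat \<Rightarrow> complex) k. if k < n then b k else 0)"
  have mc: "(\<lambda>\<omega>. coef (X \<omega>)) \<in> borel_measurable M"
    by (rule measurable_coordinatewise_then_product[OF measurable_coef[OF X meas]])
  have cont: "continuous_on UNIV (\<lambda>b. F (cayley_series (T n b)))" for n
  proof (rule continuous_at_imp_continuous_on, rule ballI, rule continuous_at_sequentiallyI)
    fix b and u :: "nat \<Rightarrow> nat \<Rightarrow> complex" assume u: "u \<longlonglongrightarrow> b"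
    have uk: "(\<lambda>m. u m k) \<longlonglongrightarrow> b k" for k
      by (rule continuous_on_tendsto_compose[OF continuous_on_product_coordinates u]) auto
    \<comment> \<open>A convergent sequence of coordinates is bounded. Only the bounds below the
      cut-off enter, so the resulting box is trivially subexponential.\<close>
    have "\<exists>c. \<forall>m. cmod (u m k) \<le> c" for k
    proof -
      have "Bseq (\<lambda>m. u m k)" by (rule convergent_imp_Bseq[OF convergentI[OF uk]])
      then show ?thesis by (metis BseqE)
    qed
    then obtain c where c: "\<And>k m. cmod (u m k) \<le> c k" by metis
    show "(\<lambda>m. F (cayley_series (T n (u m)))) \<longlonglongrightarrow> F (cayley_series (T n b))"
    proof (rule hol_test_fun_series_tendsto[OF F])
      show "subexp (\<lambda>k. if k < n then c k else 0)" unfolding subexp_def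
        by (intro allI impI summable_finite[of "{..<n}"]) auto
      show "cmod (T n (u m) k) \<le> (if k < n then c k else 0)" for m k
        using c by (auto simp: T_def)
      show "(\<lambda>m. T n (u m) k) \<longlonglongrightarrow> T n b k" for k
        using uk by (auto simp: T_def)
    qed
  qed
  have "(\<lambda>\<omega>. F (cayley_series (T n (coef (X \<omega>))))) \<in> borel_measurable M" for n
    using measurable_compose[OF mc borel_measurable_continuous_onI[OF cont]] .
  then show ?thesis
  proof (rule borel_measurable_LIMSEQ_real[rotated])
    fix \<omega> assume w: "\<omega> \<in> space M"
    have "(\<lambda>n. F (cayley_series (T n (coef (X \<omega>))))) \<longlonglongrightarrow> F (cayley_series (coef (X \<omega>)))"
    proof (rule hol_test_fun_series_tendsto[OF F subexp_coef[OF X[OF w]]])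
      show "cmod (T n (coef (X \<omega>)) k) \<le> cmod (coef (X \<omega>) k)" for n k by (simp add: T_def)
      show "(\<lambda>n. T n (coef (X \<omega>)) k) \<longlonglongrightarrow> coef (X \<omega>) k" for k unfolding T_def
        by (rule tendsto_eventually, rule eventually_mono[OF eventually_gt_at_top[of k]]) auto
    qed
    then show "(\<lambda>n. F (cayley_series (T n (coef (X \<omega>))))) \<longlonglongrightarrow> F (X \<omega>)"
      using hol_test_fun_series_coef[OF F X[OF w]] by simp
  qed
qed

section \<open>Weak convergence from characteristic functions of coefficients\<close>

text \<open>The expectation of a base element is a value of the joint characteristic function of
  finitely many coefficients: \<open>Re (t k * x k)\<close> with complex \<open>t k\<close> runs
  through all real-linear forms in \<open>x k\<close>.\<close>

inductive trig_poly :: "((nat \<Rightarrow> complex) \<Rightarrow> complex) \<Rightarrow> bool" where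
  base: "trig_poly (\<lambda>x. iexp (Re (\<Sum>k<K. t k * x k)))"
| scale: "trig_poly p \<Longrightarrow> trig_poly (\<lambda>x. c * p x)"
| add: "trig_poly p \<Longrightarrow> trig_poly q \<Longrightarrow> trig_poly (\<lambda>x. p x + q x)"

lemma trig_poly_const: "trig_poly (\<lambda>x. c)"
  using trig_poly.scale[OF trig_poly.base[of "\<lambda>_. 0" 0], of c] by simp

text \<open>Frequencies add, after padding the shorter vector with zeros. Closure under products
  makes the class an algebra, as Stone-Weierstrass requires.\<close>

lemma trig_poly_mult:
  assumes "trig_poly p" "trig_poly q" shows "trig_poly (\<lambda>x. p x * q x)"
  using assms
proof (induction arbitrary: q)
  case (base t K)
  show ?case using base.prems
  proof induction
    case (base t' K')
    define u where "u = (\<lambda>k. (if k < K then t k else 0) + (if k < K' then t' k else 0))"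
    have "(\<Sum>k<max K K'. u k * x k) = (\<Sum>k<K. t k * x k) + (\<Sum>k<K'. t' k * x k)" for x
    proof -
      have "(\<Sum>k<max K K'. u k * x k) = (\<Sum>k<max K K'. (if k < K then t k * x k else 0)
        + (if k < K' then t' k * x k else 0))"
        by (intro sum.cong) (auto simp: u_def algebra_simps)
      moreover have "(\<Sum>k<max K K'. if k < K then t k * x k else 0) = (\<Sum>k<K. t k * x k)"
        by (intro sum.mono_neutral_cong_right) auto
      moreover have "(\<Sum>k<max K K'. if k < K' then t' k * x k else 0) = (\<Sum>k<K'. t' k * x k)"
        by (intro sum.mono_neutral_cong_right) auto
      ultimately show ?thesis by (simp add: sum.distrib)
    qed
    then have "(\<lambda>x. iexp (Re (\<Sum>k<K. t k * x k)) * iexp (Re (\<Sum>k<K'. t' k * x k)))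
      = (\<lambda>x. iexp (Re (\<Sum>k<max K K'. u k * x k)))"
      by (simp add: exp_add[symmetric] algebra_simps)
    then show ?case using trig_poly.base[of u "max K K'"] by simp
  next
    case (scale q c)
    show ?case using trig_poly.scale[OF scale.IH, of c] by (simp add: mult_ac)
  next
    case (add q q')
    show ?case using trig_poly.add[OF add.IH] by (simp add: algebra_simps)
  qed
next
  case (scale p c)
  show ?case using trig_poly.scale[OF scale.IH[OF scale.prems], of c] by (simp add: mult_ac)
next
  case (add p p')
  show ?case using trig_poly.add[OF add.IH(1)[OF add.prems] add.IH(2)[OF add.prems]]
    by (simp add: algebra_simps)
qed

text \<open>Euler's formula. The complex factor \<open>c\<close> allows both the real and the
  imaginary part of a coordinate as argument.\<close>

lemma trig_poly_sin: "trig_poly (\<lambda>x. of_real (sin (Re (c * x k))))"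
proof -
  have *: "trig_poly (\<lambda>x. iexp (Re (d * x k)))" for d
  proof -
    have "(\<Sum>j<Suc k. (if j = k then d else 0) * x j) = d * x k" for x :: "nat \<Rightarrow> complex"
      by (subst sum.mono_neutral_right[of _ "{k}"]) auto
    then show ?thesis using trig_poly.base[of "\<lambda>j. if j = k then d else 0" "Suc k"] by simp
  qed
  have eq: "complex_of_real (sin r) = (1 / (2 * \<i>)) * iexp r + (- 1 / (2 * \<i>)) * iexp (- r)" for r
    by (simp add: sin_of_real[symmetric] sin_exp_eq field_simps)
  have "(\<lambda>x. complex_of_real (sin (Re (c * x k)))) = (\<lambda>x. (1 / (2 * \<i>)) * iexp (Re (c * x k)) 
     + (- 1 / (2 * \<i>)) * iexp (Re ((- c) * x k)))"
    unfolding eq by simp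
  then show ?thesis by (simp only:) (intro trig_poly.add trig_poly.scale *)
qed

lemma trig_poly_measurable:
  assumes "trig_poly p" "\<And>k. (\<lambda>\<omega>. x \<omega> k) \<in> borel_measurable M"
  shows "(\<lambda>\<omega>. p (x \<omega>)) \<in> borel_measurable M"
  using assms(1)
proof induction
  case (base t K) show ?case using assms(2) by measurable
qed (auto intro: borel_measurable_add borel_measurable_times)

lemma trig_poly_bounded:
  assumes "trig_poly p" shows "\<exists>B. \<forall>x. cmod (p x) \<le> B"
  using assms
proof induction
  case (base t K) then show ?case by (intro exI[of _ 1]) simp
next
  case (scale p c) 
  then obtain B where "\<And>x. cmod (p x) \<le> B" by blast
  then show ?case by (intro exI[of _ "cmod c * B"]) (auto simp: norm_mult intro: mult_left_mono)
next
  case (add p q) 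
  then obtain B B' where "\<And>x. cmod (p x) \<le> B" "\<And>x. cmod (q x) \<le> B'" by blast
  then show ?case by (intro exI[of _ "B + B'"]) (auto intro: norm_triangle_mono)
qed

lemma (in prob_space) trig_poly_integrable:
  assumes "trig_poly p" "\<And>k. (\<lambda>\<omega>. x \<omega> k) \<in> borel_measurable M"
  shows "integrable M (\<lambda>\<omega>. p (x \<omega>))"
proof -
  obtain B where "\<And>x. cmod (p x) \<le> B" using trig_poly_bounded[OF assms(1)] by blast
  then show ?thesis
    by (intro integrable_const_bound[of _ B] trig_poly_measurable[OF assms]) auto
qed

text \<open>\<open>arcsine_coords\<close> after \<open>sine_coords\<close> is a clamping map: it is the
  identity on the box of radii \<open>L k\<close>, it has bounded range, and it factors through the compact cube
  where Stone-Weierstrass applies.\<close>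

definition sine_coords :: "(nat \<Rightarrow> real) \<Rightarrow> (nat \<Rightarrow> complex) \<Rightarrow> nat \<Rightarrow> complex" where
  "sine_coords L x k = Complex (sin (Re (x k) / L k)) (sin (Im (x k) / L k))"

definition arcsine_coords :: "(nat \<Rightarrow> real) \<Rightarrow> (nat \<Rightarrow> complex) \<Rightarrow> nat \<Rightarrow> complex" where
  "arcsine_coords L v k = of_real (L k) * Complex (arcsin (Re (v k))) (arcsin (Im (v k)))"

definition unit_cube :: "(nat \<Rightarrow> complex) set" where
  "unit_cube = (\<Pi>\<^sub>E k\<in>UNIV. cbox (Complex (- 1) (- 1)) (Complex 1 1))"

lemma unit_cube_iff: "v \<in> unit_cube \<longleftrightarrow> (\<forall>k. \<bar>Re (v k)\<bar> \<le> 1 \<and> \<bar>Im (v k)\<bar> \<le> 1)"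
proof -
  have "v \<in> unit_cube \<longleftrightarrow> (\<forall>k. - 1 \<le> Re (v k) \<and> Re (v k) \<le> 1 \<and> - 1 \<le> Im (v k) \<and> Im (v k) \<le> 1)"
    unfolding unit_cube_def PiE_UNIV_domain by (auto simp: Pi_iff in_cbox_complex_iff)
  moreover have "- 1 \<le> a \<and> a \<le> 1 \<and> - 1 \<le> b \<and> b \<le> 1 \<longleftrightarrow> \<bar>a\<bar> \<le> 1 \<and> \<bar>b\<bar> \<le> 1" for a b :: real
    by linarith
  ultimately show ?thesis by presburger
qed

text \<open>Tychonoff's theorem.\<close>

lemma compact_unit_cube: "compact unit_cube"
proof -
  have "compactin (product_topology (\<lambda>k::nat. euclidean) UNIV) unit_cube"
    unfolding unit_cube_def compactin_PiE by auto
  then show ?thesis by (simp add: euclidean_product_topology)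
qed

lemma sine_coords_in_cube: "sine_coords L x \<in> unit_cube"
  by (simp add: unit_cube_iff sine_coords_def)

lemma arcsine_sine_coords:
  assumes "L k > 0" "cmod (x k) \<le> L k"
  shows "arcsine_coords L (sine_coords L x) k = x k"
proof -
  have *: "arcsin (sin (u / L k)) = u / L k" if "\<bar>u\<bar> \<le> L k" for u
  proof (rule arcsin_sin)
    have "\<bar>u / L k\<bar> \<le> 1" using that assms by simp
    \<comment> \<open>\<open>arcsin\<close> inverts \<open>sin\<close> on
      \<open>[-pi/2, pi/2]\<close>, which contains \<open>[-1, 1]\<close>.\<close>
    then show "- (pi / 2) \<le> u / L k" "u / L k \<le> pi / 2" using pi_gt3 by linarith+
  qed
  have "\<bar>Re (x k)\<bar> \<le> L k" "\<bar>Im (x k)\<bar> \<le> L k"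
    using assms(2) abs_Re_le_cmod abs_Im_le_cmod order_trans by blast+
  then show ?thesis using assms(1)
    by (simp add: arcsine_coords_def sine_coords_def * complex_eq_iff)
qed

text \<open>The real and the imaginary part contribute at most \<open>pi / 2 < 2\<close> each,
  whence the factor 4.\<close>

lemma norm_arcsine_coords:
  assumes "v \<in> unit_cube" "L k > 0" shows "cmod (arcsine_coords L v k) \<le> 4 * L k"
proof -
  have *: "\<bar>arcsin u\<bar> \<le> 2" if "\<bar>u\<bar> \<le> 1" for u
    using arcsin_bounded[of u] that pi_less_4 by linarith
  have "cmod (Complex (arcsin (Re (v k))) (arcsin (Im (v k)))) \<le> 4"
    using cmod_le[of "Complex (arcsin (Re (v k))) (arcsin (Im (v k)))"] *[of "Re (v k)"]
      *[of "Im (v k)"] assms(1)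
    unfolding unit_cube_iff by simp
  then show ?thesis using assms(2) by (simp add: arcsine_coords_def norm_mult)
qed

lemma subexp_scale: "subexp L \<Longrightarrow> subexp (\<lambda>k. c * L k)"
  unfolding subexp_def by (auto simp: mult.assoc intro: summable_mult)

lemma continuous_series_arcsine:
  assumes F: "hol_test_fun F" and L: "subexp L" "\<And>k. L k > 0"
  shows "continuous_on unit_cube (\<lambda>v. F (cayley_series (arcsine_coords L v)))"
  unfolding continuous_on_sequentially
proof (intro allI ballI impI)
  fix u v assume v: "v \<in> unit_cube" and "(\<forall>n. u n \<in> unit_cube) \<and> u \<longlonglongrightarrow> v"
  then have un: "\<And>n. u n \<in> unit_cube" and u: "u \<longlonglongrightarrow> v" by auto
  have uk: "(\<lambda>m. u m k) \<longlonglongrightarrow> v k" for k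
    by (rule continuous_on_tendsto_compose[OF continuous_on_product_coordinates u]) auto
  have as: "(\<lambda>n. arcsin (a n)) \<longlonglongrightarrow> arcsin b" if "a \<longlonglongrightarrow> b" "\<And>n. \<bar>a n\<bar> \<le> 1" "\<bar>b\<bar> \<le> 1" for a b
  proof (rule continuous_on_tendsto_compose[OF continuous_on_arcsin' that(1)])
    show "b \<in> {-1..1}" using that(3) unfolding atLeastAtMost_iff by linarith
    show "\<forall>\<^sub>F n in sequentially. a n \<in> {-1..1}"
    proof (intro always_eventually allI)
      fix n show "a n \<in> {-1..1}" using that(2)[of n] unfolding atLeastAtMost_iff by linarith
    qed
  qed
  show "((\<lambda>v. F (cayley_series (arcsine_coords L v))) \<circ> u) \<longlonglongrightarrow> F (cayley_series (arcsine_coords L v))"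
    unfolding o_def
  proof (rule hol_test_fun_series_tendsto[OF F subexp_scale[OF L(1), of 4]])
    show "cmod (arcsine_coords L (u n) k) \<le> 4 * L k" for n k
      by (rule norm_arcsine_coords[OF un L(2)])
    show "(\<lambda>n. arcsine_coords L (u n) k) \<longlonglongrightarrow> arcsine_coords L v k" for k
      unfolding arcsine_coords_def
      by (intro tendsto_intros as uk) (use un v in \<open>auto simp: unit_cube_iff\<close>)
  qed
qed

text \<open>The approximant is a polynomial on the cube composed with \<open>sine_coords\<close>.
  The composition always lands in the cube, so the bound \<open>K + e\<close> holds at every
  \<open>x\<close>, whereas closeness to \<open>F\<close> holds only where the clamping is the
  identity.\<close>

lemma trig_poly_approximation:
  assumes F: "hol_test_fun F" and K: "\<And>f. f holomorphic_on H0 \<Longrightarrow> \<bar>F f\<bar> \<le> K"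
    and L: "subexp L" "\<And>k. L k > 0" and e: "0 < e"
  obtains P :: "(nat \<Rightarrow> complex) \<Rightarrow> real" where "trig_poly (\<lambda>x. of_real (P x))" "\<And>x. \<bar>P x\<bar> \<le> K + e"
    "\<And>x. (\<And>k. cmod (x k) \<le> L k) \<Longrightarrow> \<bar>P x - F (cayley_series x)\<bar> \<le> e"
proof -
  define G where "G = (\<lambda>v. F (cayley_series (arcsine_coords L v)))"
  \<comment> \<open>The ring to which Stone-Weierstrass is applied: continuous functions on the cube
    whose pullback under \<open>sine_coords\<close> is a trigonometric polynomial.\<close>
  define R where "R = {P. continuous_on unit_cube P \<and> trig_poly (\<lambda>x. of_real (P (sine_coords L
    x)))}"
  have cReIm: "continuous_on unit_cube (\<lambda>v. Re (v k))" "continuous_on unit_cube (\<lambda>v. Im (v k))"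
    for k
    by (auto intro!: continuous_on_Re continuous_on_Im continuous_on_subset[OF
      continuous_on_product_coordinates])
  \<comment> \<open>The factor \<open>- i\<close> turns the imaginary part into a real part. These
    two families are the coordinate functions, which separate points.\<close>
  have "trig_poly (\<lambda>x. of_real (sin (Re (of_real (1 / L k) * x k))))"
    "trig_poly (\<lambda>x. of_real (sin (Re ((- \<i> * of_real (1 / L k)) * x k))))" for k
    by (rule trig_poly_sin)+
  then have RReIm: "(\<lambda>v. Re (v k)) \<in> R" "(\<lambda>v. Im (v k)) \<in> R" for k
    unfolding R_def using cReIm by (auto simp: sine_coords_def)
  interpret function_ring_on R unit_cube
  proof
    fix x y assume "x \<in> unit_cube" "y \<in> unit_cube" "x \<noteq> y"
    then obtain k where "x k \<noteq> y k" by auto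
    then have "Re (x k) \<noteq> Re (y k) \<or> Im (x k) \<noteq> Im (y k)" by (auto simp: complex_eq_iff)
    then show "\<exists>f\<in>R. f x \<noteq> f y" using RReIm by (meson)
  qed (auto simp: R_def compact_unit_cube trig_poly_const intro!: continuous_intros trig_poly_mult
    trig_poly.add)
  obtain g where g: "g \<in> R" "\<And>v. v \<in> unit_cube \<Longrightarrow> \<bar>G v - g v\<bar> < e"
    using Stone_Weierstrass_basic[OF continuous_series_arcsine[OF F L] e] unfolding G_def by blast
  show thesis
  proof (rule that[of "\<lambda>x. g (sine_coords L x)"])
    show "trig_poly (\<lambda>x. of_real (g (sine_coords L x)))" using g(1) by (simp add: R_def)
    fix x
    have "\<bar>G (sine_coords L x)\<bar> \<le> K" unfolding G_def
      by (intro K cayley_series_holomorphic[OF subexp_scale[OF L(1), of 4]]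
        norm_arcsine_coords sine_coords_in_cube L(2))
    then show "\<bar>g (sine_coords L x)\<bar> \<le> K + e" using g(2)[OF sine_coords_in_cube[of L x]] by linarith
    assume "\<And>k. cmod (x k) \<le> L k"
    then have "arcsine_coords L (sine_coords L x) = x" by (intro ext arcsine_sine_coords L(2))
    then show "\<bar>g (sine_coords L x) - F (cayley_series x)\<bar> \<le> e"
      using g(2)[OF sine_coords_in_cube[of L x]]
      unfolding G_def by simp
  qed
qed

section \<open>Exchanging the functional for a trigonometric polynomial under the
  expectation\<close>

lemma summable_inverse_Suc_squares: "summable (\<lambda>k. 1 / (real k + 1)\<^sup>2)"
  using summable_Suc_iff[of "\<lambda>n. 1 / (real n)\<^sup>2"] inverse_power_summable[of 2, where 'a = real]
  by (simp add: inverse_eq_divide add.commute)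

text \<open>Chebyshev's inequality with a union bound over all coefficients. The factor
  \<open>1 / (k + 1)\<close> in the moment hypothesis makes the sum of the bounds finite, and
  enlarging the box by \<open>C\<close> makes it small.\<close>

lemma (in prob_space) expectation_trig_poly_close:
  assumes F: "hol_test_fun F" and K: "\<And>f. f holomorphic_on H0 \<Longrightarrow> \<bar>F f\<bar> \<le> K"
    and L: "\<And>k. L k > 0" and e: "0 < e" and C: "C > 0"
    and P: "trig_poly (\<lambda>x. of_real (P x))" "\<And>x. \<bar>P x\<bar> \<le> K + e"
    "\<And>x. (\<And>k. cmod (x k) \<le> C * L k) \<Longrightarrow> \<bar>P x - F (cayley_series x)\<bar> \<le> e"
    and X: "\<And>\<omega>. \<omega> \<in> space M \<Longrightarrow> X \<omega> holomorphic_on H0"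
    and meas: "\<And>z. z \<in> H0 \<Longrightarrow> (\<lambda>\<omega>. X \<omega> z) \<in> borel_measurable M"
    and mom: "\<And>k. (\<integral>\<^sup>+\<omega>. ennreal ((cmod (coef (X \<omega>) k))\<^sup>2) \<partial>M) \<le> ennreal ((L k / (real k + 1))\<^sup>2)"
  shows "\<bar>(\<integral>\<omega>. F (X \<omega>) \<partial>M) - (\<integral>\<omega>. P (coef (X \<omega>)) \<partial>M)\<bar>
    \<le> e + (2 * K + e) * (\<Sum>k. 1 / (real k + 1)\<^sup>2) / C\<^sup>2"
proof -
  define S where "S = (\<Sum>k. 1 / (real k + 1)\<^sup>2)"
  have S0: "0 \<le> S" unfolding S_def by (intro suminf_nonneg summable_inverse_Suc_squares) auto
  have K0: "0 \<le> K" using K[of "\<lambda>_. 0"] by force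
  have mc: "(\<lambda>\<omega>. coef (X \<omega>) k) \<in> borel_measurable M" for k by (rule measurable_coef[OF X meas])
  have mF: "(\<lambda>\<omega>. F (X \<omega>)) \<in> borel_measurable M" by (rule measurable_hol_test_fun[OF F X meas])
  have mP: "(\<lambda>\<omega>. P (coef (X \<omega>))) \<in> borel_measurable M"
    using measurable_compose[OF trig_poly_measurable[where x = "\<lambda>\<omega>. coef (X \<omega>)", OF P(1) mc]
      borel_measurable_Re] by simp
  have iF: "integrable M (\<lambda>\<omega>. F (X \<omega>))"
    by (rule integrable_const_bound[of _ K]) (use K X mF in auto)
  have iP: "integrable M (\<lambda>\<omega>. P (coef (X \<omega>)))"
    by (rule integrable_const_bound[of _ "K + e"]) (use P(2) mP in auto)
  have mq: "(\<lambda>\<omega>. ennreal ((cmod (coef (X \<omega>) k) / (C * L k))\<^sup>2)) \<in> borel_measurable M" for k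
    using mc[of k] by (intro measurable_compose[OF _ measurable_ennreal] borel_measurable_power 
      borel_measurable_divide measurable_compose[OF _ borel_measurable_norm] borel_measurable_const)
  \<comment> \<open>\<open>h\<close> is at least 1 as soon as one coefficient leaves its box, so it
    dominates the indicator of the bad event.\<close>
  define h where "h = (\<lambda>\<omega>. \<Sum>k. ennreal ((cmod (coef (X \<omega>) k) / (C * L k))\<^sup>2))"
  have "(\<integral>\<^sup>+\<omega>. h \<omega> \<partial>M) = (\<Sum>k. \<integral>\<^sup>+\<omega>. ennreal ((cmod (coef (X \<omega>) k) / (C * L k))\<^sup>2) \<partial>M)"
    unfolding h_def by (intro nn_integral_suminf mq)
  also have "\<dots> \<le> (\<Sum>k. ennreal (1 / C\<^sup>2 * (1 / (real k + 1)\<^sup>2)))"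
  proof (intro suminf_le)
    fix k
    have "(\<integral>\<^sup>+\<omega>. ennreal ((cmod (coef (X \<omega>) k) / (C * L k))\<^sup>2) \<partial>M)
       = (\<integral>\<^sup>+\<omega>. ennreal (1 / (C * L k)\<^sup>2) * ennreal ((cmod (coef (X \<omega>) k))\<^sup>2) \<partial>M)"
      by (intro nn_integral_cong) (simp add: ennreal_mult[symmetric] power_divide)
    also have "\<dots> = ennreal (1 / (C * L k)\<^sup>2) * (\<integral>\<^sup>+\<omega>. ennreal ((cmod (coef (X \<omega>) k))\<^sup>2) \<partial>M)"
      using mc by (intro nn_integral_cmult) measurable
    also have "\<dots> \<le> ennreal (1 / (C * L k)\<^sup>2) * ennreal ((L k / (real k + 1))\<^sup>2)"
      by (intro mult_left_mono mom) auto
    also have "\<dots> = ennreal (1 / C\<^sup>2 * (1 / (real k + 1)\<^sup>2))" 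
      using L[of k] C by (simp add: ennreal_mult[symmetric] power_divide power_mult_distrib)
    finally show "(\<integral>\<^sup>+\<omega>. ennreal ((cmod (coef (X \<omega>) k) / (C * L k))\<^sup>2) \<partial>M)
      \<le> ennreal (1 / C\<^sup>2 * (1 / (real k + 1)\<^sup>2))" .
  qed auto
  also have "\<dots> = ennreal (1 / C\<^sup>2 * S)"
    unfolding S_def suminf_mult[OF summable_inverse_Suc_squares, symmetric]
    by (intro suminf_ennreal2 summable_mult summable_inverse_Suc_squares) auto
  finally have h: "(\<integral>\<^sup>+\<omega>. h \<omega> \<partial>M) \<le> ennreal (1 / C\<^sup>2 * S)" .
  have pt: "ennreal \<bar>F (X \<omega>) - P (coef (X \<omega>))\<bar> \<le> ennreal e + ennreal (2 * K + e) * h \<omega>"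
    if w: "\<omega> \<in> space M" for \<omega>
  proof (cases "\<forall>k. cmod (coef (X \<omega>) k) \<le> C * L k")
    case True
    then have "\<bar>F (X \<omega>) - P (coef (X \<omega>))\<bar> \<le> e" 
      using P(3)[of "coef (X \<omega>)"] hol_test_fun_series_coef[OF F X[OF w]]
        by (simp add: abs_minus_commute)
    then show ?thesis by (intro add_increasing2) (auto intro: ennreal_leI)
  next
    case False
    then obtain k where k: "C * L k < cmod (coef (X \<omega>) k)" by (auto simp: not_le)
    have "1 \<le> cmod (coef (X \<omega>) k) / (C * L k)" using k C L[of k] by simp
    then have "ennreal 1 \<le> ennreal ((cmod (coef (X \<omega>) k) / (C * L k))\<^sup>2)"
      by (intro ennreal_leI one_le_power)
    also have "\<dots> = (\<Sum>j\<in>{k}. ennreal ((cmod (coef (X \<omega>) j) / (C * L j))\<^sup>2))" by simp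
    also have "\<dots> \<le> h \<omega>" unfolding h_def by (intro sum_le_suminf) auto
    finally have h1: "1 \<le> h \<omega>" by simp
    \<comment> \<open>The crude bound is \<open>K + (K + e)\<close>; the additional \<open>e\<close>
      gives both cases the common form \<open>e + (2 * K + e) * h\<close>.\<close>
    have "\<bar>F (X \<omega>) - P (coef (X \<omega>))\<bar> \<le> e + (2 * K + e)"
      using K[OF X[OF w]] P(2)[of "coef (X \<omega>)"] e by linarith
    then have "ennreal \<bar>F (X \<omega>) - P (coef (X \<omega>))\<bar> \<le> ennreal e + ennreal (2 * K + e) * 1"
      using K0 e by (simp add: ennreal_plus[symmetric] ennreal_leI del: ennreal_plus)
    also have "\<dots> \<le> ennreal e + ennreal (2 * K + e) * h \<omega>"
      using h1 by (intro add_left_mono mult_left_mono) auto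
    finally show ?thesis .
  qed
  have mh: "h \<in> borel_measurable M" unfolding h_def by (rule borel_measurable_suminf_order[OF mq])
  have "ennreal \<bar>\<integral>\<omega>. F (X \<omega>) - P (coef (X \<omega>)) \<partial>M\<bar> \<le> (\<integral>\<^sup>+\<omega>. ennreal \<bar>F (X \<omega>) - P (coef (X \<omega>))\<bar> \<partial>M)"
    using integral_norm_bound_ennreal[of M "\<lambda>\<omega>. F (X \<omega>) - P (coef (X \<omega>))"] iF iP by simp
  also have "\<dots> \<le> (\<integral>\<^sup>+\<omega>. ennreal e + ennreal (2 * K + e) * h \<omega> \<partial>M)"
    by (intro nn_integral_mono pt)
  also have "\<dots> = ennreal e + ennreal (2 * K + e) * (\<integral>\<^sup>+\<omega>. h \<omega> \<partial>M)"
    using mh by (simp add: nn_integral_add nn_integral_cmult emeasure_space_1)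
  also have "\<dots> \<le> ennreal e + ennreal (2 * K + e) * ennreal (1 / C\<^sup>2 * S)"
    by (intro add_left_mono mult_left_mono h) auto
  also have "\<dots> = ennreal (e + (2 * K + e) * S / C\<^sup>2)"
    using K0 e S0 by (simp add: ennreal_mult[symmetric] ennreal_plus[symmetric] del: ennreal_plus)
  finally have "\<bar>\<integral>\<omega>. F (X \<omega>) - P (coef (X \<omega>)) \<partial>M\<bar> \<le> e + (2 * K + e) * S / C\<^sup>2"
    using K0 e S0 by (subst (asm) ennreal_le_iff) (auto intro!: add_nonneg_nonneg
      divide_nonneg_nonneg mult_nonneg_nonneg)
  then show ?thesis using iF iP by (simp add: S_def)
qed

text \<open>The same polynomial \<open>P\<close> serves for all \<open>X n\<close> and for
  \<open>Y\<close>, because the moment bounds share the radii \<open>L\<close>. Its expectations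
  converge, being finite combinations of characteristic functions.\<close>

theorem hol_test_fun_convergence:
  fixes X :: "nat \<Rightarrow> 'a \<Rightarrow> complex \<Rightarrow> complex" and Y :: "'b \<Rightarrow> complex \<Rightarrow> complex"
  assumes M: "prob_space M" and N: "prob_space N"
    and F: "hol_test_fun F" and L: "subexp L" "\<And>k. L k > 0"
    and X: "\<And>n \<omega>. \<omega> \<in> space M \<Longrightarrow> X n \<omega> holomorphic_on H0"
    and measX: "\<And>n z. z \<in> H0 \<Longrightarrow> (\<lambda>\<omega>. X n \<omega> z) \<in> borel_measurable M"
    and momX: "\<And>n k. (\<integral>\<^sup>+\<omega>. ennreal ((cmod (coef (X n \<omega>) k))\<^sup>2) \<partial>M) \<le> ennreal ((L k / (real k + 1))\<^sup>2)"
    and Y: "\<And>\<omega>. \<omega> \<in> space N \<Longrightarrow> Y \<omega> holomorphic_on H0"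
    and measY: "\<And>z. z \<in> H0 \<Longrightarrow> (\<lambda>\<omega>. Y \<omega> z) \<in> borel_measurable N"
    and momY: "\<And>k. (\<integral>\<^sup>+\<omega>. ennreal ((cmod (coef (Y \<omega>) k))\<^sup>2) \<partial>N) \<le> ennreal ((L k / (real k + 1))\<^sup>2)"
    and chf: "\<And>K t. (\<lambda>n. \<integral>\<omega>. iexp (Re (\<Sum>k<K. t k * coef (X n \<omega>) k)) \<partial>M)
       \<longlonglongrightarrow> (\<integral>\<omega>. iexp (Re (\<Sum>k<K. t k * coef (Y \<omega>) k)) \<partial>N)"
  shows "(\<lambda>n. \<integral>\<omega>. F (X n \<omega>) \<partial>M) \<longlonglongrightarrow> (\<integral>\<omega>. F (Y \<omega>) \<partial>N)"
proof -
  interpret M: prob_space M by fact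
  interpret N: prob_space N by fact
  note mcX = measurable_coef[OF X measX] and mcY = measurable_coef[OF Y measY]
  have trig: "(\<lambda>n. \<integral>\<omega>. p (coef (X n \<omega>)) \<partial>M) \<longlonglongrightarrow> (\<integral>\<omega>. p (coef (Y \<omega>)) \<partial>N)" if "trig_poly p" for p
    using that
  proof induction
    case (base t K) show ?case by (rule chf)
  next
    case (scale p c) then show ?case by (simp add: tendsto_mult_left)
  next
    case (add p q)
    then show ?case using M.trig_poly_integrable[where x = "\<lambda>\<omega>. coef (X n \<omega>)" for n, OF _ mcX]
      N.trig_poly_integrable[where x = "\<lambda>\<omega>. coef (Y \<omega>)", OF _ mcY] by (simp add: tendsto_add)
  qed
  obtain K where K: "\<And>f. f holomorphic_on H0 \<Longrightarrow> \<bar>F f\<bar> \<le> K" using F unfolding hol_test_fun_def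
    by blast
  have K0: "0 \<le> K" using K[of "\<lambda>_. 0"] by force
  define S where "S = (\<Sum>k. 1 / (real k + 1)\<^sup>2)"
  have S0: "0 \<le> S" unfolding S_def by (intro suminf_nonneg summable_inverse_Suc_squares) auto
  show ?thesis
  proof (rule LIMSEQ_I)
    fix d :: real assume d: "0 < d"
    \<comment> \<open>The three errors \<open>2 * e\<close>, \<open>e\<close> and
      \<open>2 * e\<close> add up to less than \<open>d\<close>.\<close>
    define e where "e = d / 8"
    have e: "0 < e" using d by (simp add: e_def)
    \<comment> \<open>Chosen so that the Chebyshev term \<open>(2 * K + e) * S / C^2\<close> is at
      most \<open>e\<close>; the summand 1 keeps \<open>C\<close> positive.\<close>
    define C where "C = sqrt ((2 * K + e) * S / e + 1)"
    have Cpos: "0 < (2 * K + e) * S / e + 1" using K0 S0 e by (intro add_nonneg_pos) auto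
    have C: "C > 0" using Cpos by (simp add: C_def)
    have "(2 * K + e) * S / C\<^sup>2 \<le> e"
    proof -
      have "(2 * K + e) * S \<le> e * C\<^sup>2" using Cpos e by (simp add: C_def field_simps)
      then show ?thesis using C by (simp add: pos_divide_le_eq)
    qed
    then have small: "e + (2 * K + e) * S / C\<^sup>2 \<le> 2 * e" by simp
    obtain P where P: "trig_poly (\<lambda>x. of_real (P x))" "\<And>x. \<bar>P x\<bar> \<le> K + e"
      "\<And>x. (\<And>k. cmod (x k) \<le> C * L k) \<Longrightarrow> \<bar>P x - F (cayley_series x)\<bar> \<le> e"
      by (rule trig_poly_approximation[OF F K subexp_scale[OF L(1)] _ e, of C]) (use C L in auto)
    have cX: "\<bar>(\<integral>\<omega>. F (X n \<omega>) \<partial>M) - (\<integral>\<omega>. P (coef (X n \<omega>)) \<partial>M)\<bar> \<le> 2 * e" for n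
      by (rule order_trans[OF M.expectation_trig_poly_close[OF F K L(2) e C P X measX momX]
        small[unfolded S_def]])
    have cY: "\<bar>(\<integral>\<omega>. F (Y \<omega>) \<partial>N) - (\<integral>\<omega>. P (coef (Y \<omega>)) \<partial>N)\<bar> \<le> 2 * e"
      by (rule order_trans[OF N.expectation_trig_poly_close[OF F K L(2) e C P Y measY momY]
        small[unfolded S_def]])
    have "(\<lambda>n. \<integral>\<omega>. P (coef (X n \<omega>)) \<partial>M) \<longlonglongrightarrow> (\<integral>\<omega>. P (coef (Y \<omega>)) \<partial>N)"
      using trig[OF P(1)] by (simp add: tendsto_of_real_iff)
    then obtain n0 where "\<And>n. n \<ge> n0 \<Longrightarrow> \<bar>(\<integral>\<omega>. P (coef (X n \<omega>)) \<partial>M) - (\<integral>\<omega>. P (coef (Y \<omega>)) \<partial>N)\<bar> < e"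
      using LIMSEQ_D[OF _ e] by (metis real_norm_def)
    then have n0: "\<bar>(\<integral>\<omega>. P (coef (X n \<omega>)) \<partial>M) - (\<integral>\<omega>. P (coef (Y \<omega>)) \<partial>N)\<bar> < e" if "n \<ge> n0" for n
      using that by blast
    have "\<bar>(\<integral>\<omega>. F (X n \<omega>) \<partial>M) - (\<integral>\<omega>. F (Y \<omega>) \<partial>N)\<bar> < d" if "n \<ge> n0" for n
      using cX[of n] cY n0[OF that] d unfolding e_def by linarith
    then show "\<exists>n0. \<forall>n\<ge>n0. norm ((\<integral>\<omega>. F (X n \<omega>) \<partial>M) - (\<integral>\<omega>. F (Y \<omega>) \<partial>N)) < d" by auto
  qed
qed

section \<open>Convergence of the Dirichlet series\<close>

text \<open>The mean value inequality along the real segment from \<open>n\<close> to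
  \<open>n + 1\<close>. The exponent \<open>- \<sigma> - 1\<close> is summable, as Abel summation
  needs.\<close>

lemma norm_powr_diff_le:
  assumes n: "n \<ge> 1" and v: "\<sigma> \<le> Re v" "0 < \<sigma>"
  shows "cmod (of_nat (Suc n) powr (- v) - of_nat n powr (- v)) \<le> cmod v * real n powr (- \<sigma> - 1)"
proof -
  define S where "S = complex_of_real ` {real n..real (Suc n)}"
  have "cmod (of_nat (Suc n) powr (- v) - of_nat n powr (- v)) 
    \<le> (cmod v * real n powr (- \<sigma> - 1)) * cmod (of_nat (Suc n) - of_nat n :: complex)"
  proof (rule field_differentiable_bound[where S = S and f' = "\<lambda>z. - v * z powr (- v - 1)"])
    show "convex S" unfolding S_def
      by (intro convex_linear_image) (auto intro: bounded_linear.linear bounded_linear_of_real)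
    show "of_nat (Suc n) \<in> S" using imageI[of "real (Suc n)" "{real n..real (Suc n)}"
      complex_of_real] unfolding S_def by simp
    show "of_nat n \<in> S" using imageI[of "real n" "{real n..real (Suc n)}" complex_of_real]
      unfolding S_def by simp
    fix z assume "z \<in> S"
    then obtain x where x: "z = of_real x" "real n \<le> x" by (auto simp: S_def)
    have x1: "x \<ge> 1" using x(2) n by linarith
    show "((\<lambda>a. a powr - v) has_field_derivative - v * z powr (- v - 1)) (at z within S)"
      using x1 by (intro has_field_derivative_at_within[OF has_field_derivative_powr])
        (simp add: x(1) complex_nonpos_Reals_iff)
    have "cmod (z powr (- v - 1)) = x powr (- Re v - 1)"
      using x1 unfolding x(1) by (subst norm_powr_real_powr) auto
    also have "\<dots> \<le> x powr (- \<sigma> - 1)" using x1 v by (intro powr_mono) auto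
    also have "\<dots> \<le> real n powr (- \<sigma> - 1)" using x n v by (intro powr_mono2') auto
    finally show "cmod (- v * z powr (- v - 1)) \<le> cmod v * real n powr (- \<sigma> - 1)"
      by (simp add: norm_mult mult_left_mono)
  qed
  then show ?thesis by simp
qed

lemma sum_by_parts_tail:
  fixes R u :: "nat \<Rightarrow> 'a :: comm_ring"
  shows "(\<Sum>n<N. (R n - R (Suc n)) * u n) = R 0 * u 0 - R N * u N + (\<Sum>n<N. R (Suc n) * (u (Suc n)
    - u n))"
  by (induction N) (auto simp: algebra_simps)

text \<open>Convergence of a Dirichlet series at one point gives locally uniform convergence in the
  open half-plane to its right. Summation by parts moves the differences onto
  \<open>n powr (- (w - w0))\<close>, leaving a normally convergent series and a boundary term that
  vanishes uniformly.\<close>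

lemma dirichlet_series_uniformly_convergent:
  fixes b :: "nat \<Rightarrow> complex"
  assumes conv: "summable (\<lambda>n. b n * of_nat n powr (- w0))" 
    and K: "compact K" "\<And>w. w \<in> K \<Longrightarrow> Re w0 < Re w"
  shows "uniformly_convergent_on K (\<lambda>N w. \<Sum>n<N. b n * of_nat n powr (- w))"
proof (cases "K = {}")
  case True then show ?thesis by (auto simp: uniformly_convergent_on_def)
next
  case False
  define c where "c = (\<lambda>n. b n * of_nat n powr (- w0))"
  \<comment> \<open>Tails rather than partial sums: they tend to 0, which is what removes the
    boundary term.\<close>
  define R where "R = (\<lambda>n. suminf c - (\<Sum>i<n. c i))"
  have c: "c n = R n - R (Suc n)" for n by (simp add: R_def)
  have R0: "R \<longlonglongrightarrow> 0"
    using tendsto_diff[OF tendsto_const summable_LIMSEQ[OF conv[folded c_def]], of "suminf c"]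
      by (simp add: R_def)
  then have "Bseq R" by (intro convergent_imp_Bseq convergentI)
  then obtain B where B: "\<And>n. cmod (R n) \<le> B" "B > 0" using BseqE by metis
  have "continuous_on K Re" by (intro continuous_intros)
  then obtain wm where wm: "wm \<in> K" "\<And>w. w \<in> K \<Longrightarrow> Re wm \<le> Re w"
    using continuous_attains_inf[OF K(1) False] by blast
  have "continuous_on K (\<lambda>w. cmod (w - w0))" by (intro continuous_intros)
  then obtain wM where wM: "wM \<in> K" "\<And>w. w \<in> K \<Longrightarrow> cmod (w - w0) \<le> cmod (wM - w0)"
    using continuous_attains_sup[OF K(1) False] by blast
  define \<sigma> where "\<sigma> = Re wm - Re w0"
  define T where "T = cmod (wM - w0)"
  have s: "0 < \<sigma>" using K(2)[OF wm(1)] by (simp add: \<sigma>_def)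
  define u where "u = (\<lambda>w n. complex_of_nat n powr (- (w - w0)))"
  \<comment> \<open>At \<open>n = 0\<close> both sides are 0, since
    \<open>0 powr w = 0\<close>.\<close>
  have term_eq: "b n * of_nat n powr (- w) = c n * u w n" for n w
    by (cases "n = 0") (auto simp: c_def u_def mult.assoc powr_add[symmetric])
  have ub: "cmod (u w n) \<le> 1" if "w \<in> K" for w n
  proof (cases "n = 0")
    case False
    have "cmod (u w n) = real n powr (- (Re w - Re w0))"
      unfolding u_def using False by (subst norm_powr_real_powr) auto
    also have "\<dots> \<le> real n powr 0" using False K(2)[OF that] by (intro powr_mono) auto
    finally show ?thesis using False by simp
  qed (simp add: u_def)
  have "uniformly_convergent_on K (\<lambda>N w. \<Sum>n<N. R (Suc n) * (u w (Suc n) - u w n))"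
  proof (rule Weierstrass_m_test'_ev)
    show "summable (\<lambda>n. B * (T * real n powr (- \<sigma> - 1)))"
      using s by (intro summable_mult) (simp add: summable_real_powr_iff)
    show "\<forall>\<^sub>F n in sequentially. \<forall>w\<in>K. cmod (R (Suc n) * (u w (Suc n) - u w n))
      \<le> B * (T * real n powr (- \<sigma> - 1))"
      using eventually_ge_at_top[of 1]
    proof eventually_elim
      case (elim n)
      show ?case
      proof
        fix w assume w: "w \<in> K"
        have "cmod (u w (Suc n) - u w n) \<le> cmod (w - w0) * real n powr (- \<sigma> - 1)"
          unfolding u_def using wm(2)[OF w] s by (intro norm_powr_diff_le elim) (auto simp: \<sigma>_def)
        also have "\<dots> \<le> T * real n powr (- \<sigma> - 1)" using wM(2)[OF w]
          by (intro mult_right_mono) (auto simp: T_def)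
        finally show "cmod (R (Suc n) * (u w (Suc n) - u w n)) \<le> B * (T * real n powr (- \<sigma> - 1))"
          unfolding norm_mult using B by (intro mult_mono) (auto intro: less_imp_le)
      qed
    qed
  qed
  then obtain l where l: "uniform_limit K (\<lambda>N w. \<Sum>n<N. R (Suc n) * (u w (Suc n) - u w n))
    l sequentially"
    by (auto simp: uniformly_convergent_on_def)
  have Ru: "uniform_limit K (\<lambda>N w. R N * u w N) (\<lambda>w. 0) sequentially"
  proof (rule uniform_limitI)
    fix e :: real assume "e > 0"
    then have "\<forall>\<^sub>F N in sequentially. dist (R N) 0 < e" using R0 by (rule tendstoD[rotated])
    then show "\<forall>\<^sub>F N in sequentially. \<forall>w\<in>K. dist (R N * u w N) 0 < e"
    proof eventually_elim
      case (elim N)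
      show ?case
      proof
        fix w assume "w \<in> K"
        then have "cmod (R N) * cmod (u w N) \<le> cmod (R N) * 1" by (intro mult_left_mono ub) auto
        then show "dist (R N * u w N) 0 < e" using elim by (simp add: norm_mult)
      qed
    qed
  qed
  have eq: "(\<Sum>n<N. b n * of_nat n powr (- w))
    = R 0 * u w 0 - R N * u w N + (\<Sum>n<N. R (Suc n) * (u w (Suc n) - u w n))" for N w
    unfolding sum_by_parts_tail[of R "u w" N, symmetric]
      by (intro sum.cong refl) (simp only: term_eq c)
  have "uniform_limit K (\<lambda>N w. R 0 * u w 0 - R N * u w N + (\<Sum>n<N. R (Suc n) * (u w (Suc n)
    - u w n)))
     (\<lambda>w. R 0 * u w 0 - 0 + l w) sequentially"
    by (intro uniform_limit_add uniform_limit_minus l Ru uniform_limit_const)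
  then show ?thesis unfolding uniformly_convergent_on_def eq
    by (intro exI[of _ "\<lambda>w. R 0 * u w 0 - 0 + l w"])
qed

section \<open>The rescaled Dirichlet series as a random analytic function\<close>

definition dir_coeff :: "real \<Rightarrow> (nat \<Rightarrow> 'a \<Rightarrow> real) \<Rightarrow> (nat \<Rightarrow> 'a \<Rightarrow> real) \<Rightarrow> 'a \<Rightarrow> nat \<Rightarrow> complex" where
  "dir_coeff \<alpha> eta theta \<omega> n = (if 2 \<le> n then of_real (ln (real n) powr \<alpha>)
     * (of_real (eta n \<omega>) + \<i> * of_real (theta n \<omega>)) else 0)"

lemma dir_term_eq: "dir_term \<alpha> eta theta \<omega> w n = dir_coeff \<alpha> eta theta \<omega> n * of_nat n powr (- w)"
  by (simp add: dir_term_def dir_coeff_def)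

definition convergent_event :: "real \<Rightarrow> (nat \<Rightarrow> 'a \<Rightarrow> real) \<Rightarrow> (nat \<Rightarrow> 'a \<Rightarrow> real) \<Rightarrow> 'a \<Rightarrow> bool" where
  "convergent_event \<alpha> eta theta \<omega> \<longleftrightarrow> (\<forall>w. Re w > 1/2 \<longrightarrow> summable (dir_term \<alpha> eta theta \<omega> w))"

text \<open>Convergence propagates to the right, so countably many abscissae decreasing to 1/2
  suffice. This makes the event measurable and reduces its almost sure validity to one abscissa at a
  time.\<close>

lemma convergent_event_iff:
  "convergent_event \<alpha> eta theta \<omega> \<longleftrightarrow> 
    (\<forall>j::nat. summable (dir_term \<alpha> eta theta \<omega> (of_real (1/2 + 1 / (real j + 1)))))"
proof
  assume *: "\<forall>j::nat. summable (dir_term \<alpha> eta theta \<omega> (of_real (1/2 + 1 / (real j + 1))))"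
  show "convergent_event \<alpha> eta theta \<omega>" unfolding convergent_event_def
  proof (intro allI impI)
    fix w :: complex assume "Re w > 1/2"
    then obtain j where j: "inverse (real (Suc j)) < Re w - 1/2"
      using reals_Archimedean[of "Re w - 1/2"] by auto
    have "uniformly_convergent_on {w} (\<lambda>N w. \<Sum>n<N. dir_coeff \<alpha> eta theta \<omega> n * of_nat n powr (- w))"
      using * j by (intro dirichlet_series_uniformly_convergent[of _ "of_real (1/2 + 1 / (real j +
        1))"])
        (auto simp: dir_term_eq[abs_def] field_simps)
    then show "summable (dir_term \<alpha> eta theta \<omega> w)" 
      unfolding dir_term_eq[abs_def] summable_iff_convergent
      by (auto dest: uniformly_convergent_imp_convergent)
  qed
qed (auto simp: convergent_event_def)

definition dir_weight :: "real \<Rightarrow> real \<Rightarrow> nat \<Rightarrow> real" where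
  "dir_weight \<alpha> s n = (if 2 \<le> n then s powr (1/2 + \<alpha>) * ln (real n) powr \<alpha> * real n powr (- 1/2)
    else 0)"

text \<open>With \<open>y = s * ln n\<close> the factor \<open>n powr (- s * z)\<close> becomes
  \<open>exp (- z * y)\<close>: the series is a random sum of exponential kernels placed at the
  points \<open>s * ln n\<close>.\<close>

lemma scaled_dir_term:
  "of_real (s powr (1/2 + \<alpha>)) * dir_term \<alpha> eta theta \<omega> (1/2 + of_real s * z) n
   = of_real (dir_weight \<alpha> s n) * (of_real (eta n \<omega>) + \<i> * of_real (theta n \<omega>))
     * exp (- z * of_real (s * ln (real n)))"
proof (cases "2 \<le> n")
  case True
  have "complex_of_nat n powr (- (1/2 + of_real s * z))
    = of_nat n powr (of_real (- 1/2)) * of_nat n powr (- of_real s * z)"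
    by (simp add: powr_add[symmetric])
  also have "of_nat n powr (of_real (- 1/2)) = complex_of_real (real n powr (- 1/2))"
    using powr_of_real[of "real n" "- 1/2"] by simp
  also have "of_nat n powr (- of_real s * z) = exp (- z * of_real (s * ln (real n)))"
    using True by (simp add: powr_def mult_ac)
  finally show ?thesis using True by (simp add: dir_term_def dir_weight_def mult_ac)
qed (simp add: dir_term_def dir_weight_def)

lemma rescaled_D_uniform_limit:
  assumes ev: "convergent_event \<alpha> eta theta \<omega>" and s: "s > 0" and K: "compact K" "K \<subseteq> H0"
  shows "uniform_limit K (\<lambda>N z. \<Sum>n<N. of_real (dir_weight \<alpha> s n) * (of_real (eta n \<omega>)
    + \<i> * of_real (theta n \<omega>))
       * exp (- z * of_real (s * ln (real n)))) (rescaled_D \<alpha> eta theta s \<omega>) sequentially"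
proof (cases "K = {}")
  case False
  define K' where "K' = (\<lambda>z. 1/2 + of_real s * z) ` K"
  have K': "compact K'" unfolding K'_def
    by (intro compact_continuous_image K) (auto intro!: continuous_intros)
  have "continuous_on K Re" by (intro continuous_intros)
  then obtain z0 where z0: "z0 \<in> K" "\<And>z. z \<in> K \<Longrightarrow> Re z0 \<le> Re z"
    using continuous_attains_inf[OF K(1) False] by blast
  have z0p: "Re z0 > 0" using z0 K by (auto simp: H0_def)
  \<comment> \<open>Half of the smallest real part on \<open>K\<close> gives a reference abscissa
    right of 1/2 and strictly left of the image of \<open>K\<close>.\<close>
  have re: "1/2 < Re (1/2 + of_real (s * (Re z0 / 2)))" using s z0p by simp
  have "uniformly_convergent_on K' (\<lambda>N w. \<Sum>n<N. dir_coeff \<alpha> eta theta \<omega> n * of_nat n powr (- w))"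
  proof (rule dirichlet_series_uniformly_convergent[of _ "1/2 + of_real (s * (Re z0 / 2))",
    OF _ K'])
    show "summable (\<lambda>n. dir_coeff \<alpha> eta theta \<omega> n * of_nat n powr - (1/2 + of_real (s * (Re z0 /
      2))))"
      using ev[unfolded convergent_event_def, rule_format, OF re] unfolding dir_term_eq[abs_def] .
    fix w assume "w \<in> K'"
    then obtain z where z: "z \<in> K" "w = 1/2 + of_real s * z" by (auto simp: K'_def)
    have "Re z0 / 2 < Re z" using z0(2)[OF z(1)] z0p by linarith
    then show "Re (1/2 + of_real (s * (Re z0 / 2))) < Re w" using s by (simp add: z(2))
  qed
  then obtain l where l: "uniform_limit K' (\<lambda>N w. \<Sum>n<N. dir_term \<alpha> eta theta \<omega> w n) l sequentially"
    unfolding uniformly_convergent_on_def dir_term_eq[symmetric] by blast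
  have lw: "l w = dir_series \<alpha> eta theta \<omega> w" if "w \<in> K'" for w
    using tendsto_uniform_limitI[OF l that] unfolding dir_series_def
      by (simp add: sums_def[symmetric] sums_iff)
  have "uniform_limit K (\<lambda>N z. \<Sum>n<N. dir_term \<alpha> eta theta \<omega> (1/2 + of_real s * z) n)
    (\<lambda>z. l (1/2 + of_real s * z)) sequentially"
    unfolding uniform_limit_iff
  proof (intro allI impI)
    fix e :: real assume "e > 0"
    with l have "\<forall>\<^sub>F N in sequentially. \<forall>w\<in>K'. dist (\<Sum>n<N. dir_term \<alpha> eta theta \<omega> w n) (l w) < e"
      unfolding uniform_limit_iff by blast
    then show "\<forall>\<^sub>F N in sequentially. \<forall>z\<in>K. dist (\<Sum>n<N. dir_term \<alpha> eta theta \<omega> (1/2 + of_real s *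
      z) n) (l (1/2 + of_real s * z)) < e"
      by eventually_elim (unfold K'_def, fast)
  qed
  then have lim: "uniform_limit K (\<lambda>N z. of_real (s powr (1/2 + \<alpha>))
    * (\<Sum>n<N. dir_term \<alpha> eta theta \<omega> (1/2 + of_real s * z) n)) 
     (\<lambda>z. of_real (s powr (1/2 + \<alpha>)) * l (1/2 + of_real s * z)) sequentially"
    by (rule bounded_linear_uniform_limit_intros)
  have eqs: "of_real (s powr (1/2 + \<alpha>)) * l (1/2 + of_real s * z) = rescaled_D \<alpha> eta theta s \<omega> z"
    if "z \<in> K" for z
  proof -
    have "1/2 + of_real s * z \<in> K'" using that unfolding K'_def by (rule imageI)
    then show ?thesis
      unfolding rescaled_D_def if_P[OF ev[unfolded convergent_event_def]] by (simp only: lw)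
  qed
  have "uniform_limit K (\<lambda>N z. \<Sum>n<N. of_real (s powr (1/2 + \<alpha>))
    * dir_term \<alpha> eta theta \<omega> (1/2 + of_real s * z) n) 
     (rescaled_D \<alpha> eta theta s \<omega>) sequentially"
    unfolding sum_distrib_left[symmetric]
    by (rule uniform_limit_cong'[THEN iffD1, OF _ _ lim]) (rule refl, erule eqs)
  then show ?thesis unfolding scaled_dir_term .
qed auto

lemma rescaled_D_not_convergent: "\<not> convergent_event \<alpha> eta theta \<omega> \<Longrightarrow> rescaled_D \<alpha> eta theta s \<omega>
  = (\<lambda>z. 0)"
  by (rule ext, unfold rescaled_D_def convergent_event_def, erule if_not_P)

lemma rescaled_D_holomorphic:
  assumes "s > 0" shows "rescaled_D \<alpha> eta theta s \<omega> holomorphic_on H0"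
proof (cases "convergent_event \<alpha> eta theta \<omega>")
  case True
  show ?thesis
  proof (rule holomorphic_uniform_sequence[OF open_H0])
    fix x assume "x \<in> H0"
    then obtain d where d: "d > 0" "cball x d \<subseteq> H0" using open_H0 open_contains_cball by blast
    then show "\<exists>d>0. cball x d \<subseteq> H0 \<and> uniform_limit (cball x d)
      (\<lambda>N z. \<Sum>n<N. of_real (dir_weight \<alpha> s n) * (of_real (eta n \<omega>) + \<i> * of_real (theta n \<omega>))
       * exp (- z * of_real (s * ln (real n)))) (rescaled_D \<alpha> eta theta s \<omega>) sequentially"
      using rescaled_D_uniform_limit[OF True assms _ d(2)] by auto
  qed (intro holomorphic_intros)
qed (simp add: rescaled_D_not_convergent)

text \<open>Each coefficient is continuous for locally uniform convergence and so passes through the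
  limit of the partial sums.\<close>

lemma coef_rescaled_D:
  assumes ev: "convergent_event \<alpha> eta theta \<omega>" and s: "s > 0"
  shows "(\<lambda>n. of_real (dir_weight \<alpha> s n) * (of_real (eta n \<omega>) + \<i> * of_real (theta n \<omega>))
      * coef (\<lambda>z. exp (- z * of_real (s * ln (real n)))) k) sums coef (rescaled_D \<alpha> eta theta s \<omega>)
        k"
proof -
  have hol: "(\<lambda>z. exp (- z * of_real (s * ln (real n)))) holomorphic_on H0" for n :: nat
    by (intro holomorphic_intros)
  have "(\<lambda>N. coef (\<lambda>z. \<Sum>n<N. of_real (dir_weight \<alpha> s n) * (of_real (eta n \<omega>)
    + \<i> * of_real (theta n \<omega>))
      * exp (- z * of_real (s * ln (real n)))) k) \<longlonglongrightarrow> coef (rescaled_D \<alpha> eta theta s \<omega>) k"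
    using rescaled_D_uniform_limit[OF ev s]
      by (intro coef_tendsto rescaled_D_holomorphic s) (auto intro!: holomorphic_intros)
  then show ?thesis unfolding coef_sum_scale[OF hol] sums_def .
qed

lemma rescaled_D_sums:
  assumes ev: "convergent_event \<alpha> eta theta \<omega>" and s: "s > 0" and z: "z \<in> H0"
  shows "(\<lambda>n. of_real (dir_weight \<alpha> s n) * (of_real (eta n \<omega>) + \<i> * of_real (theta n \<omega>))
      * exp (- z * of_real (s * ln (real n)))) sums rescaled_D \<alpha> eta theta s \<omega> z"
  using tendsto_uniform_limitI[OF rescaled_D_uniform_limit[OF ev s, of "{z}"], of z] z
    by (simp add: sums_def)

lemma measurable_convergent_event:
  assumes [measurable]: "\<And>n. eta n \<in> borel_measurable M" "\<And>n. theta n \<in> borel_measurable M"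
  shows "{\<omega>\<in>space M. convergent_event \<alpha> eta theta \<omega>} \<in> sets M"
proof -
  have mp: "(\<lambda>\<omega>. \<Sum>n<N. dir_term \<alpha> eta theta \<omega> w n) \<in> borel_measurable M" for w and N :: nat
    unfolding dir_term_def by measurable
  define w where "w = (\<lambda>j::nat. complex_of_real (1/2 + 1 / (real j + 1)))"
  define E where "E = (\<lambda>j. {\<omega>\<in>space M. Cauchy (\<lambda>N. \<Sum>n<N. dir_term \<alpha> eta theta \<omega> (w j) n)})"
  have E: "E j \<in> sets M" for j unfolding E_def by (intro sets_Collect_Cauchy mp)
  have "{\<omega>\<in>space M. convergent_event \<alpha> eta theta \<omega>} = (\<Inter>j. E j)"
    unfolding convergent_event_iff E_def summable_iff_convergent Cauchy_convergent_iff w_def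
      by blast
  also have "\<dots> \<in> sets M"
    by (intro sets.countable_INT image_subsetI E) auto
  finally show ?thesis .
qed

lemma measurable_rescaled_D:
  assumes [measurable]: "\<And>n. eta n \<in> borel_measurable M" "\<And>n. theta n \<in> borel_measurable M"
    and s: "s > 0" and z: "z \<in> H0"
  shows "(\<lambda>\<omega>. rescaled_D \<alpha> eta theta s \<omega> z) \<in> borel_measurable M"
proof -
  define A where "A = {\<omega>\<in>space M. convergent_event \<alpha> eta theta \<omega>}"
  have A: "A \<in> sets M" unfolding A_def by (rule measurable_convergent_event[OF assms(1,2)])
  define T where "T = (\<lambda>\<omega> n. of_real (dir_weight \<alpha> s n) * (of_real (eta n \<omega>)
    + \<i> * of_real (theta n \<omega>))
      * exp (- z * of_real (s * ln (real n))))"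
  have T: "(\<lambda>\<omega>. T \<omega> n) \<in> borel_measurable M" for n
    unfolding T_def by (intro borel_measurable_times borel_measurable_add borel_measurable_const 
      measurable_compose[OF assms(1) borel_measurable_of_real] measurable_compose[OF assms(2)
        borel_measurable_of_real])
  \<comment> \<open>The indicator makes the partial sums converge at every point of the space, to 0
    off the convergence event.\<close>
  have "(\<lambda>\<omega>. indicator A \<omega> * (\<Sum>n<N. T \<omega> n)) \<in> borel_measurable M" for N
    by (intro borel_measurable_times borel_measurable_indicator A borel_measurable_sum T)
  then show ?thesis
  proof (rule borel_measurable_LIMSEQ_metric)
    fix \<omega> assume w: "\<omega> \<in> space M"
    show "(\<lambda>N. indicator A \<omega> * (\<Sum>n<N. T \<omega> n)) \<longlonglongrightarrow> rescaled_D \<alpha> eta theta s \<omega> z"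
    proof (cases "convergent_event \<alpha> eta theta \<omega>")
      case True
      then have "indicator A \<omega> = (1 :: complex)" using w by (simp add: A_def)
      then show ?thesis using rescaled_D_sums[OF True s z] unfolding T_def sums_def
        by (simp only: mult_1_left)
    next
      case False
      then have "indicator A \<omega> = (0 :: complex)" by (simp add: A_def)
      then show ?thesis unfolding rescaled_D_not_convergent[OF False] by simp
    qed
  qed
qed

section \<open>Kolmogorov's one-series theorem\<close>

context prob_space begin

text \<open>Supplies the vanishing cross terms, both for the variance of a sum and for the
  first-passage decomposition in Kolmogorov's inequality.\<close>

lemma indep_var_past_future:
  fixes X :: "nat \<Rightarrow> 'a \<Rightarrow> real"
  assumes X: "indep_vars (\<lambda>_. borel) X UNIV"
    and g: "g \<in> borel_measurable (PiM {..<k} (\<lambda>_. borel))" and i: "k \<le> i"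
  shows "indep_var borel (\<lambda>\<omega>. g (restrict (\<lambda>j. X j \<omega>) {..<k}) :: real) borel (X i)"
proof -
  have "indep_var (PiM {..<k} (\<lambda>_. borel)) (\<lambda>\<omega>. restrict (\<lambda>j. X j \<omega>) {..<k})
     (PiM {i} (\<lambda>_. borel)) (\<lambda>\<omega>. restrict (\<lambda>j. X j \<omega>) {i})"
    by (rule indep_var_restrict[OF X]) (use i in auto)
  moreover have "(\<lambda>x. x i) \<in> borel_measurable (PiM {i} (\<lambda>_. borel :: real measure))"
    by (rule measurable_component_singleton) simp
  ultimately have "indep_var borel (g \<circ> (\<lambda>\<omega>. restrict (\<lambda>j. X j \<omega>) {..<k})) borel ((\<lambda>x. x i)
    \<circ> (\<lambda>\<omega>. restrict (\<lambda>j. X j \<omega>) {i}))"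
    by (intro indep_var_compose[OF _ g])
  then show ?thesis by (simp add: o_def)
qed

lemma integrable_of_square:
  assumes "f \<in> borel_measurable M" "integrable M (\<lambda>\<omega>. (f \<omega>)\<^sup>2 :: real)" shows "integrable M f"
proof (rule Bochner_Integration.integrable_bound[of M "\<lambda>\<omega>. 1 + (f \<omega>)\<^sup>2"])
  show "AE \<omega> in M. norm (f \<omega>) \<le> norm (1 + (f \<omega>)\<^sup>2)"
  proof (rule AE_I2)
    fix \<omega>
    have "0 \<le> (\<bar>f \<omega>\<bar> - 1)\<^sup>2" by simp
    then have "2 * \<bar>f \<omega>\<bar> \<le> 1 + (f \<omega>)\<^sup>2" by (simp add: power2_eq_square algebra_simps)
    then show "norm (f \<omega>) \<le> norm (1 + (f \<omega>)\<^sup>2)" by simp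
  qed
qed (use assms in auto)

lemma expectation_square_indep_sum:
  fixes X :: "nat \<Rightarrow> 'a \<Rightarrow> real"
  assumes X: "indep_vars (\<lambda>_. borel) X UNIV" and sq: "\<And>i. integrable M (\<lambda>\<omega>. (X i \<omega>)\<^sup>2)"
    and mean: "\<And>i. expectation (X i) = 0"
  shows "integrable M (\<lambda>\<omega>. (\<Sum>i<n. X i \<omega>)\<^sup>2)"
    and "expectation (\<lambda>\<omega>. (\<Sum>i<n. X i \<omega>)\<^sup>2) = (\<Sum>i<n. expectation (\<lambda>\<omega>. (X i \<omega>)\<^sup>2))"
proof -
  have mX: "X i \<in> borel_measurable M" for i using X by (auto simp: indep_vars_def)
  have iX: "integrable M (X i)" for i by (rule integrable_of_square[OF mX sq])
  have "integrable M (\<lambda>\<omega>. (\<Sum>i<n. X i \<omega>)\<^sup>2) \<and>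
    expectation (\<lambda>\<omega>. (\<Sum>i<n. X i \<omega>)\<^sup>2) = (\<Sum>i<n. expectation (\<lambda>\<omega>. (X i \<omega>)\<^sup>2))"
  proof (induction n)
    case (Suc n)
    have "indep_var borel (\<lambda>\<omega>. (\<lambda>x. \<Sum>i<n. x i) (restrict (\<lambda>j. X j \<omega>) {..<n})) borel (X n)"
      by (rule indep_var_past_future[OF X]) (auto intro!: borel_measurable_sum
        measurable_component_singleton)
    then have ind: "indep_var borel (\<lambda>\<omega>. \<Sum>i<n. X i \<omega>) borel (X n)" by simp
    have iS: "integrable M (\<lambda>\<omega>. \<Sum>i<n. X i \<omega>)" by (intro Bochner_Integration.integrable_sum iX)
    have int: "integrable M (\<lambda>\<omega>. (\<Sum>i<n. X i \<omega>) * X n \<omega>)"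
      by (rule indep_var_integrable[OF ind iS iX])
    have ex: "expectation (\<lambda>\<omega>. (\<Sum>i<n. X i \<omega>) * X n \<omega>) = 0"
      unfolding indep_var_lebesgue_integral[OF ind iS iX] mean by simp
    have eq: "(\<Sum>i<Suc n. X i \<omega>)\<^sup>2 = (\<Sum>i<n. X i \<omega>)\<^sup>2 + 2 * ((\<Sum>i<n. X i \<omega>) * X n \<omega>) + (X n \<omega>)\<^sup>2" for \<omega>
      by (simp add: power2_eq_square algebra_simps)
    show ?case unfolding eq using Suc int ex sq[of n] by simp
  qed simp
  then show "integrable M (\<lambda>\<omega>. (\<Sum>i<n. X i \<omega>)\<^sup>2)"
    "expectation (\<lambda>\<omega>. (\<Sum>i<n. X i \<omega>)\<^sup>2) = (\<Sum>i<n. expectation (\<lambda>\<omega>. (X i \<omega>)\<^sup>2))" by auto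
qed

text \<open>Decomposition by the first passage time: where it equals \<open>k\<close>,
  \<open>S n^2 \<ge> S k^2 + 2 * S k * (S n - S k)\<close>. The cross term has mean 0, since
  \<open>S k\<close> restricted to that event depends on the past only.\<close>

lemma kolmogorov_inequality:
  fixes X :: "nat \<Rightarrow> 'a \<Rightarrow> real"
  assumes X: "indep_vars (\<lambda>_. borel) X UNIV" and sq: "\<And>i. integrable M (\<lambda>\<omega>. (X i \<omega>)\<^sup>2)"
    and mean: "\<And>i. expectation (X i) = 0" and \<epsilon>: "\<epsilon> > 0"
  shows "\<epsilon>\<^sup>2 * prob {\<omega>\<in>space M. \<exists>k\<le>n. \<epsilon> \<le> \<bar>\<Sum>i<k. X i \<omega>\<bar>} \<le> (\<Sum>i<n. expectation (\<lambda>\<omega>. (X i \<omega>)\<^sup>2))"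
proof -
  have mX[measurable]: "X i \<in> borel_measurable M" for i using X by (auto simp: indep_vars_def)
  have iX: "integrable M (X i)" for i by (rule integrable_of_square[OF mX sq])
  define S where "S = (\<lambda>k (x :: nat \<Rightarrow> real). \<Sum>i<k. x i)"
  \<comment> \<open>\<open>Q k\<close> says that the level is reached for the first time at
    \<open>k\<close>.\<close>
  define Q where "Q = (\<lambda>k x. \<epsilon> \<le> \<bar>S k x\<bar> \<and> (\<forall>j<k. \<bar>S j x\<bar> < \<epsilon>))"
  define g where "g = (\<lambda>k x. if Q k x then S k x else 0)"
  define h where "h = (\<lambda>k \<omega>. if Q k (\<lambda>i. X i \<omega>) then (1::real) else 0)"
  have Srestr: "S j (restrict x {..<k}) = S j x" if "j \<le> k" for j k x
    unfolding S_def using that by (intro sum.cong) auto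
  \<comment> \<open>\<open>g k\<close> reads only the coordinates below \<open>k\<close>, so it is
    independent of \<open>X i\<close> for \<open>i \<ge> k\<close>.\<close>
  have grestr: "g k (restrict x {..<k}) = g k x" for k x
  proof -
    have "(\<forall>j<k. \<bar>S j (restrict x {..<k})\<bar> < \<epsilon>) \<longleftrightarrow> (\<forall>j<k. \<bar>S j x\<bar> < \<epsilon>)"
      using Srestr[of _ k x] less_imp_le by fastforce
    then show ?thesis unfolding g_def Q_def by (simp only: Srestr[OF order_refl])
  qed
  have Smeas: "S j \<in> borel_measurable (PiM {..<k} (\<lambda>_. borel))" if "j \<le> k" for j k
    unfolding S_def using that by (intro borel_measurable_sum measurable_component_singleton) auto
  have gmeas: "g k \<in> borel_measurable (PiM {..<k} (\<lambda>_. borel))" for k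
  proof -
    \<comment> \<open>Capping the index at \<open>k\<close> makes every \<open>S' j\<close>
      measurable on the product over \<open>{..<k}\<close>, also for \<open>j\<close> outside the
      range that matters.\<close>
    define S' where "S' = (\<lambda>j. S (min j k))"
    have [measurable]: "S' j \<in> borel_measurable (PiM {..<k} (\<lambda>_. borel))" for j
      unfolding S'_def by (rule Smeas) simp
    have "g k = (\<lambda>x. if \<epsilon> \<le> \<bar>S' k x\<bar> \<and> (\<forall>j<k. \<bar>S' j x\<bar> < \<epsilon>) then S' k x else 0)"
      by (rule ext) (auto simp: g_def Q_def S'_def min_def)
    also have "\<dots> \<in> borel_measurable (PiM {..<k} (\<lambda>_. borel))" by measurable
    finally show ?thesis .
  qed
  have SX: "(\<lambda>\<omega>. S k (\<lambda>i. X i \<omega>)) \<in> borel_measurable M" for k unfolding S_def by measurable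
  have Qmeas: "{\<omega>\<in>space M. Q k (\<lambda>i. X i \<omega>)} \<in> sets M" for k
    unfolding Q_def S_def by measurable
  have hmeas: "h k \<in> borel_measurable M" for k 
    unfolding h_def by (rule measurable_If) (use Qmeas in auto)
  have gX: "(\<lambda>\<omega>. g k (\<lambda>i. X i \<omega>)) \<in> borel_measurable M" for k
    unfolding g_def by (rule measurable_If) (use Qmeas SX in auto)
  have iS: "integrable M (\<lambda>\<omega>. S k (\<lambda>i. X i \<omega>))" for k unfolding S_def
    by (intro Bochner_Integration.integrable_sum iX)
  have ig: "integrable M (\<lambda>\<omega>. g k (\<lambda>i. X i \<omega>))" for k
    by (rule Bochner_Integration.integrable_bound[OF iS[of k] gX]) (auto simp: g_def)
  have ih: "integrable M (h k)" for k
    by (rule integrable_const_bound[of _ 1, OF _ hmeas]) (auto simp: h_def)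
  have ind: "indep_var borel (\<lambda>\<omega>. g k (\<lambda>j. X j \<omega>)) borel (X i)" if "k \<le> i" for k i
    using indep_var_past_future[OF X gmeas that] by (simp only: grestr)
  have igX: "integrable M (\<lambda>\<omega>. g k (\<lambda>j. X j \<omega>) * X i \<omega>)" if "k \<le> i" for k i
    by (rule indep_var_integrable[OF ind[OF that] ig iX])
  have EgX: "expectation (\<lambda>\<omega>. g k (\<lambda>j. X j \<omega>) * X i \<omega>) = 0" if "k \<le> i" for k i
    unfolding indep_var_lebesgue_integral[OF ind[OF that] ig iX] mean by simp
  \<comment> \<open>At most one first passage index exists, so the sum over \<open>k\<close>
    collapses to a single term and the inequality is pathwise.\<close>
  have pt: "(\<Sum>k\<le>n. \<epsilon>\<^sup>2 * h k \<omega> + 2 * (\<Sum>i\<in>{k..<n}. g k (\<lambda>j. X j \<omega>) * X i \<omega>))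
    \<le> (\<Sum>i<n. X i \<omega>)\<^sup>2" (is "?L \<le> _")
    and hsum: "(\<Sum>k\<le>n. h k \<omega>) = indicator {\<omega>\<in>space M. \<exists>k\<le>n. \<epsilon> \<le> \<bar>\<Sum>i<k. X i \<omega>\<bar>} \<omega>" 
      if w: "\<omega> \<in> space M" for \<omega>
  proof -
    let ?x = "\<lambda>i. X i \<omega>"
    have "?L \<le> (\<Sum>i<n. X i \<omega>)\<^sup>2 \<and> (\<Sum>k\<le>n. h k \<omega>) = indicator {\<omega>\<in>space M. \<exists>k\<le>n. \<epsilon> \<le> \<bar>\<Sum>i<k. X i \<omega>\<bar>} \<omega>"
    proof (cases "\<exists>k\<le>n. \<epsilon> \<le> \<bar>S k ?x\<bar>")
      case False
      then have "\<not> Q k ?x" if "k \<le> n" for k using that by (auto simp: Q_def)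
      then have "h k \<omega> = 0" "g k ?x = 0" if "k \<le> n" for k using that by (auto simp: h_def g_def)
      then show ?thesis using False w by (auto simp: S_def)
    next
      case True
      define k where "k = (LEAST k. \<epsilon> \<le> \<bar>S k ?x\<bar>)"
      have k1: "\<epsilon> \<le> \<bar>S k ?x\<bar>" using True unfolding k_def by (metis (mono_tags, lifting) LeastI)
      have k2: "\<bar>S j ?x\<bar> < \<epsilon>" if "j < k" for j using not_less_Least[of j "\<lambda>k. \<epsilon> \<le> \<bar>S k ?x\<bar>"] that
        unfolding k_def by simp
      have kn: "k \<le> n" using True unfolding k_def by (meson Least_le order_trans)
      have Q: "Q j ?x \<longleftrightarrow> j = k" for j
        using k1 k2 unfolding Q_def by (metis linorder_neqE_nat not_less)
      have hk: "h j \<omega> = (if j = k then 1 else 0)" for j by (simp add: h_def Q)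
      have gk: "g j ?x = (if j = k then S k ?x else 0)" for j by (simp add: g_def Q)
      have "?L = (\<Sum>j\<le>n. if j = k then \<epsilon>\<^sup>2 + 2 * (\<Sum>i\<in>{k..<n}. S k ?x * X i \<omega>) else 0)"
        by (intro sum.cong refl) (simp add: hk gk)
      also have "\<dots> = \<epsilon>\<^sup>2 + 2 * (S k ?x * (\<Sum>i\<in>{k..<n}. X i \<omega>))" using kn
        by (simp add: sum_distrib_left)
      also have "(\<Sum>i\<in>{k..<n}. X i \<omega>) = S n ?x - S k ?x" 
        using kn sum.atLeastLessThan_concat[of 0 k n ?x]
          by (simp add: S_def atLeast0LessThan[symmetric])
      also have "\<epsilon>\<^sup>2 + 2 * (S k ?x * (S n ?x - S k ?x)) \<le> (S n ?x)\<^sup>2"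
      proof -
        have "\<epsilon>\<^sup>2 \<le> (S k ?x)\<^sup>2" using k1 \<epsilon> by (metis abs_le_square_iff abs_of_pos)
        moreover have "0 \<le> (S n ?x - S k ?x)\<^sup>2" by simp
        ultimately show ?thesis by (simp add: power2_eq_square algebra_simps)
      qed
      finally have "?L \<le> (\<Sum>i<n. X i \<omega>)\<^sup>2" by (simp add: S_def)
      moreover have "(\<Sum>k\<le>n. h k \<omega>) = 1" using kn by (simp add: hk)
      moreover have "\<exists>k\<le>n. \<epsilon> \<le> \<bar>\<Sum>i<k. X i \<omega>\<bar>" using True by (simp add: S_def)
      ultimately show ?thesis using w by simp
    qed
    then show "?L \<le> (\<Sum>i<n. X i \<omega>)\<^sup>2" "(\<Sum>k\<le>n. h k \<omega>) = indicator {\<omega>\<in>space M. \<exists>k\<le>n. \<epsilon>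
      \<le> \<bar>\<Sum>i<k. X i \<omega>\<bar>} \<omega>" by auto
  qed
  have "prob {\<omega>\<in>space M. \<exists>k\<le>n. \<epsilon> \<le> \<bar>\<Sum>i<k. X i \<omega>\<bar>} = expectation (indicator {\<omega>\<in>space M. \<exists>k\<le>n. \<epsilon>
    \<le> \<bar>\<Sum>i<k. X i \<omega>\<bar>})"
    by (subst Bochner_Integration.integral_indicator)
      (auto simp: Int_def intro!: arg_cong[of _ _ prob])
  also have "\<dots> = expectation (\<lambda>\<omega>. \<Sum>k\<le>n. h k \<omega>)"
    by (intro Bochner_Integration.integral_cong refl) (simp add: hsum)
  also have "\<dots> = (\<Sum>k\<le>n. expectation (h k))" using ih by simp
  finally have p: "\<epsilon>\<^sup>2 * prob {\<omega>\<in>space M. \<exists>k\<le>n. \<epsilon> \<le> \<bar>\<Sum>i<k. X i \<omega>\<bar>} = (\<Sum>k\<le>n. \<epsilon>\<^sup>2 * expectation (h k))"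
    by (simp add: sum_distrib_left)
  have iR: "integrable M (\<lambda>\<omega>. \<Sum>i\<in>{k..<n}. g k (\<lambda>j. X j \<omega>) * X i \<omega>)" for k
    by (intro Bochner_Integration.integrable_sum igX) auto
  have ER: "expectation (\<lambda>\<omega>. \<Sum>i\<in>{k..<n}. g k (\<lambda>j. X j \<omega>) * X i \<omega>) = 0" for k
    by (subst Bochner_Integration.integral_sum) (auto intro!: igX sum.neutral EgX)
  have iT: "integrable M (\<lambda>\<omega>. \<epsilon>\<^sup>2 * h k \<omega> + 2 * (\<Sum>i\<in>{k..<n}. g k (\<lambda>j. X j \<omega>) * X i \<omega>))" for k
    by (intro Bochner_Integration.integrable_add integrable_mult_right ih iR)
  have ET: "expectation (\<lambda>\<omega>. \<epsilon>\<^sup>2 * h k \<omega> + 2 * (\<Sum>i\<in>{k..<n}. g k (\<lambda>j. X j \<omega>) * X i \<omega>))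
    = \<epsilon>\<^sup>2 * expectation (h k)" for k
    by (subst Bochner_Integration.integral_add) (auto intro!: integrable_mult_right ih iR simp: ER)
  have "(\<Sum>k\<le>n. \<epsilon>\<^sup>2 * expectation (h k)) = expectation (\<lambda>\<omega>. \<Sum>k\<le>n. \<epsilon>\<^sup>2 * h k \<omega> + 2 * (\<Sum>i\<in>{k..<n}. g k
    (\<lambda>j. X j \<omega>) * X i \<omega>))"
    using iT ET by (subst Bochner_Integration.integral_sum) auto
  also have "\<dots> \<le> expectation (\<lambda>\<omega>. (\<Sum>i<n. X i \<omega>)\<^sup>2)"
    by (rule integral_mono) (use pt iT expectation_square_indep_sum(1)[OF X sq mean] in auto)
  also have "\<dots> = (\<Sum>i<n. expectation (\<lambda>\<omega>. (X i \<omega>)\<^sup>2))"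
    by (rule expectation_square_indep_sum(2)[OF X sq mean])
  finally show ?thesis using p by simp
qed

text \<open>The maximal inequality is applied to the series with its first \<open>m\<close> terms
  set to 0, whose total variance \<open>T m\<close> tends to 0. Outside a null set the partial sums
  then form a Cauchy sequence.\<close>

theorem kolmogorov_one_series:
  fixes X :: "nat \<Rightarrow> 'a \<Rightarrow> real"
  assumes X: "indep_vars (\<lambda>_. borel) X UNIV" and sq: "\<And>i. integrable M (\<lambda>\<omega>. (X i \<omega>)\<^sup>2)"
    and mean: "\<And>i. expectation (X i) = 0" and summ: "summable (\<lambda>i. expectation (\<lambda>\<omega>. (X i \<omega>)\<^sup>2))"
  shows "AE \<omega> in M. summable (\<lambda>i. X i \<omega>)"
proof -
  have mX[measurable]: "X i \<in> borel_measurable M" for i using X by (auto simp: indep_vars_def)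
  define v where "v = (\<lambda>i. expectation (\<lambda>\<omega>. (X i \<omega>)\<^sup>2))"
  define T where "T = (\<lambda>m. \<Sum>i. if m \<le> i then v i else 0)"
  have v0: "0 \<le> v i" for i unfolding v_def by simp
  have sv: "summable v" using summ by (simp add: v_def)
  have T0: "T \<longlonglongrightarrow> (\<Sum>i. 0)" unfolding T_def
  proof (rule tannery_sequence[OF _ _ sv])
    show "(\<lambda>m. if m \<le> i then v i else 0) \<longlonglongrightarrow> 0" for i
      by (rule tendsto_eventually, rule eventually_mono[OF eventually_gt_at_top[of i]]) auto
  qed (use v0 in auto)
  define B where "B = (\<lambda>m \<epsilon> n. {\<omega>\<in>space M. \<exists>k\<le>n. \<epsilon> \<le> \<bar>\<Sum>i<k. if m \<le> i then X i \<omega> else 0\<bar>})"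
  have Bm[measurable]: "B m \<epsilon> n \<in> sets M" for m \<epsilon> n unfolding B_def by measurable
  have PB: "prob (B m \<epsilon> n) \<le> T m / \<epsilon>\<^sup>2" if "\<epsilon> > 0" for m \<epsilon> n
  proof -
    define X' where "X' = (\<lambda>i \<omega>. if m \<le> i then X i \<omega> else 0)"
    have Beq: "B m \<epsilon> n = {\<omega>\<in>space M. \<exists>k\<le>n. \<epsilon> \<le> \<bar>\<Sum>i<k. X' i \<omega>\<bar>}"
      by (simp add: B_def X'_def)
    have e: "expectation (\<lambda>\<omega>. (X' i \<omega>)\<^sup>2) = (if m \<le> i then v i else 0)" for i
      by (simp add: X'_def v_def)
    have "\<epsilon>\<^sup>2 * prob (B m \<epsilon> n) \<le> (\<Sum>i<n. expectation (\<lambda>\<omega>. (X' i \<omega>)\<^sup>2))"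
      unfolding Beq
    proof (rule kolmogorov_inequality[OF _ _ _ that])
      show "indep_vars (\<lambda>_. borel) X' UNIV"
        using indep_vars_compose2[OF X, of "\<lambda>i x. if m \<le> i then x else 0" "\<lambda>_. borel"]
          unfolding X'_def by simp
      show "integrable M (\<lambda>\<omega>. (X' i \<omega>)\<^sup>2)" "expectation (X' i) = 0" for i
        using sq mean by (cases "m \<le> i"; simp add: X'_def)+
    qed
    also have "\<dots> \<le> T m" unfolding e T_def
      by (intro sum_le_suminf) (auto intro!: summable_comparison_test'[OF sv, of 0] simp: v0)
    finally show ?thesis using that by (simp add: field_simps)
  qed
  have PU: "prob (\<Union>n. B m \<epsilon> n) \<le> T m / \<epsilon>\<^sup>2" if "\<epsilon> > 0" for m \<epsilon>
  proof (rule LIMSEQ_le_const2)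
    show "(\<lambda>n. prob (B m \<epsilon> n)) \<longlonglongrightarrow> prob (\<Union>n. B m \<epsilon> n)"
      by (rule finite_Lim_measure_incseq) (auto simp: incseq_def B_def intro: order_trans)
  qed (use PB[OF that] in auto)
  \<comment> \<open>For a fixed level, almost surely some tail has all its partial sums below it:
    the probability of the contrary is at most \<open>T m / \<epsilon>^2\<close> for every
    \<open>m\<close>.\<close>
  have AEp: "AE \<omega> in M. \<exists>m. \<omega> \<notin> (\<Union>n. B m (1 / (real p + 1)) n)" for p
  proof -
    define \<epsilon> where "\<epsilon> = 1 / (real p + 1)"
    have l: "\<epsilon> > 0" by (simp add: \<epsilon>_def)
    have Um: "(\<Union>n. B m \<epsilon> n) \<in> sets M" for m by measurable
    have Im: "(\<Inter>m. \<Union>n. B m \<epsilon> n) \<in> sets M" using Um by (intro sets.countable_INT) auto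
    have "prob (\<Inter>m. \<Union>n. B m \<epsilon> n) \<le> T m / \<epsilon>\<^sup>2" for m
      by (rule order_trans[OF finite_measure_mono PU[OF l]]) (use Um in auto)
    moreover have "(\<lambda>m. T m / \<epsilon>\<^sup>2) \<longlonglongrightarrow> 0 / \<epsilon>\<^sup>2" using T0 l by (intro tendsto_intros) auto
    ultimately have "prob (\<Inter>m. \<Union>n. B m \<epsilon> n) \<le> 0" using LIMSEQ_le_const by fastforce
    then have "prob (\<Inter>m. \<Union>n. B m \<epsilon> n) = 0" using measure_nonneg by (metis antisym)
    then have "(\<Inter>m. \<Union>n. B m \<epsilon> n) \<in> null_sets M" using Im by (auto simp: emeasure_eq_measure)
    then have "AE \<omega> in M. \<omega> \<notin> (\<Inter>m. \<Union>n. B m \<epsilon> n)" by (rule AE_not_in)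
    then show ?thesis unfolding \<epsilon>_def by simp
  qed
  then have "AE \<omega> in M. \<forall>p. \<exists>m. \<omega> \<notin> (\<Union>n. B m (1 / (real p + 1)) n)" by (simp add: AE_all_countable)
  with AE_space show ?thesis
  proof eventually_elim
    case (elim \<omega>)
      show ?case unfolding summable_Cauchy
      proof (intro allI impI)
        fix e :: real assume e: "e > 0"
        \<comment> \<open>A block sum is the difference of two partial sums of the tail, each below
          \<open>e / 2\<close>.\<close>
        then obtain p where p: "inverse (real (Suc p)) < e / 2" using reals_Archimedean[of "e/2"]
          by auto
        have p': "1 / (real p + 1) < e / 2" using p by (simp add: inverse_eq_divide add.commute)
        obtain m where "\<omega> \<notin> (\<Union>n. B m (1 / (real p + 1)) n)" using elim(2) by blast
        then have lt: "\<bar>\<Sum>i<k. if m \<le> i then X i \<omega> else 0\<bar> < 1 / (real p + 1)" for k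
          using elim(1) unfolding B_def by (auto simp: not_le)
        show "\<exists>N. \<forall>a\<ge>N. \<forall>n. norm (sum (\<lambda>i. X i \<omega>) {a..<n}) < e"
        proof (intro exI[of _ m] allI impI)
          fix a n assume a: "m \<le> a"
          show "norm (sum (\<lambda>i. X i \<omega>) {a..<n}) < e"
          proof (cases "a \<le> n")
            case an: True
            let ?x = "\<lambda>i. if m \<le> i then X i \<omega> else 0"
            have "sum (\<lambda>i. X i \<omega>) {a..<n} = sum ?x {a..<n}" using a by (intro sum.cong) auto
            also have "\<dots> = sum ?x {..<n} - sum ?x {..<a}"
              using an sum.atLeastLessThan_concat[of 0 a n ?x]
                by (simp add: atLeast0LessThan[symmetric])
            finally show ?thesis using lt[of n] lt[of a] p' unfolding real_norm_def by linarith
          qed (use e in simp)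
        qed
      qed
  qed
qed

end

text \<open>The square is a power of the logarithm times \<open>n powr (- 1 - 2 * e)\<close>; one of
  the two \<open>e\<close> absorbs the logarithm.\<close>

lemma summable_ln_powr:
  assumes "e > 0" shows "summable (\<lambda>n. (ln (real n) powr \<alpha> * real n powr (- (1/2 + e)))\<^sup>2)"
proof (rule summable_comparison_test_bigo)
  show "summable (\<lambda>n. norm (real n powr (- 1 - e)))" using assms
    by (simp add: summable_real_powr_iff)
  show "(\<lambda>n. (ln (real n) powr \<alpha> * real n powr (- (1/2 + e)))\<^sup>2) \<in> O(\<lambda>n. real n powr (- 1 - e))"
    using assms by real_asymp
qed

section \<open>A weighted central limit theorem\<close>

locale iid_pairs = prob_space M for M :: "'a measure" +
  fixes eta theta :: "nat \<Rightarrow> 'a \<Rightarrow> real"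
  assumes meas: "eta n \<in> borel_measurable M" "theta n \<in> borel_measurable M"
    and indep: "indep_vars (\<lambda>_. borel) (\<lambda>n \<omega>. (eta n \<omega>, theta n \<omega>)) UNIV"
    and ident: "distr M borel (\<lambda>\<omega>. (eta n \<omega>, theta n \<omega>)) = distr M borel (\<lambda>\<omega>. (eta 0 \<omega>, theta 0 \<omega>))"
    and mean0: "expectation (eta 0) = 0" "expectation (theta 0) = 0"
    and int2: "integrable M (\<lambda>\<omega>. (eta 0 \<omega>)\<^sup>2)" "integrable M (\<lambda>\<omega>. (theta 0 \<omega>)\<^sup>2)"
begin

declare meas [measurable]

lemma pair_measurable: "(\<lambda>\<omega>. (eta n \<omega>, theta n \<omega>)) \<in> borel_measurable M"
  by measurable

lemma integrable_ident:
  fixes g :: "real \<times> real \<Rightarrow> 'b :: {banach, second_countable_topology}"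
  assumes "g \<in> borel_measurable borel"
  shows "integrable M (\<lambda>\<omega>. g (eta n \<omega>, theta n \<omega>)) \<longleftrightarrow> integrable M (\<lambda>\<omega>. g (eta 0 \<omega>, theta 0 \<omega>))"
  using integrable_distr_eq[OF pair_measurable[of n] assms]
    integrable_distr_eq[OF pair_measurable[of 0] assms]
  by (simp add: ident[of n])

lemma expectation_ident:
  fixes g :: "real \<times> real \<Rightarrow> 'b :: {banach, second_countable_topology}"
  assumes "g \<in> borel_measurable borel"
  shows "(\<integral>\<omega>. g (eta n \<omega>, theta n \<omega>) \<partial>M) = (\<integral>\<omega>. g (eta 0 \<omega>, theta 0 \<omega>) \<partial>M)"
  using integral_distr[OF pair_measurable[of n] assms] integral_distr[OF pair_measurable[of 0]
    assms]
  by (simp add: ident[of n])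

text \<open>The covariance form: the second moment of \<open>lin_comb u v n\<close> for every
  \<open>n\<close>.\<close>

definition qform :: "real \<Rightarrow> real \<Rightarrow> real" where
  "qform u v = u\<^sup>2 * expectation (\<lambda>\<omega>. (eta 0 \<omega>)\<^sup>2) + 2 * u * v * expectation (\<lambda>\<omega>. eta 0 \<omega> * theta 0 \<omega>)
     + v\<^sup>2 * expectation (\<lambda>\<omega>. (theta 0 \<omega>)\<^sup>2)"

definition total_variance :: real where
  "total_variance = expectation (\<lambda>\<omega>. (eta 0 \<omega>)\<^sup>2) + expectation (\<lambda>\<omega>. (theta 0 \<omega>)\<^sup>2)"

lemma total_variance_nonneg: "0 \<le> total_variance"
  unfolding total_variance_def by (intro add_nonneg_nonneg) auto

definition lin_comb :: "real \<Rightarrow> real \<Rightarrow> nat \<Rightarrow> 'a \<Rightarrow> real" where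
  "lin_comb u v n \<omega> = u * eta n \<omega> + v * theta n \<omega>"

lemma lin_comb_measurable[measurable]: "lin_comb u v n \<in> borel_measurable M"
  unfolding lin_comb_def by measurable

lemma int1: "integrable M (eta 0)" "integrable M (theta 0)"
  by (rule integrable_of_square[OF meas(1) int2(1)], rule integrable_of_square[OF meas(2) int2(2)])

lemma int_prod: "integrable M (\<lambda>\<omega>. eta 0 \<omega> * theta 0 \<omega>)"
proof (rule Bochner_Integration.integrable_bound[OF Bochner_Integration.integrable_add[OF int2]])
  show "AE \<omega> in M. norm (eta 0 \<omega> * theta 0 \<omega>) \<le> norm ((eta 0 \<omega>)\<^sup>2 + (theta 0 \<omega>)\<^sup>2)"
  proof (rule AE_I2)
    fix \<omega>
    have "2 * (\<bar>eta 0 \<omega>\<bar> * \<bar>theta 0 \<omega>\<bar>) \<le> (eta 0 \<omega>)\<^sup>2 + (theta 0 \<omega>)\<^sup>2"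
      using sum_squares_bound[of "\<bar>eta 0 \<omega>\<bar>" "\<bar>theta 0 \<omega>\<bar>"] by simp
    moreover have "0 \<le> \<bar>eta 0 \<omega>\<bar> * \<bar>theta 0 \<omega>\<bar>" by simp
    ultimately show "norm (eta 0 \<omega> * theta 0 \<omega>) \<le> norm ((eta 0 \<omega>)\<^sup>2 + (theta 0 \<omega>)\<^sup>2)"
      unfolding real_norm_def abs_mult by linarith
  qed
qed measurable

lemma lin_comb_square: "(lin_comb u v n \<omega>)\<^sup>2
  = u\<^sup>2 * (eta n \<omega>)\<^sup>2 + 2 * u * v * (eta n \<omega> * theta n \<omega>) + v\<^sup>2 * (theta n \<omega>)\<^sup>2"
  by (simp add: lin_comb_def power2_eq_square algebra_simps)

lemma lin_comb_borel: "(\<lambda>p. u * fst p + v * snd p :: real) \<in> borel_measurable borel"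
  by (intro borel_measurable_continuous_onI continuous_intros)

lemma
  shows integrable_lin_comb: "integrable M (lin_comb u v n)"
    and expectation_lin_comb: "expectation (lin_comb u v n) = 0"
    and integrable_lin_comb_square: "integrable M (\<lambda>\<omega>. (lin_comb u v n \<omega>)\<^sup>2)"
    and expectation_lin_comb_square: "expectation (\<lambda>\<omega>. (lin_comb u v n \<omega>)\<^sup>2) = qform u v"
proof -
  have b2: "(\<lambda>p. (u * fst p + v * snd p :: real)\<^sup>2) \<in> borel_measurable borel"
    using lin_comb_borel by measurable
  show "integrable M (lin_comb u v n)"
    using integrable_ident[OF lin_comb_borel[of u v], of n] int1
      by (simp add: lin_comb_def[abs_def])
  show "expectation (lin_comb u v n) = 0"
    using expectation_ident[OF lin_comb_borel[of u v], of n] int1 mean0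
      by (simp add: lin_comb_def[abs_def])
  have i0: "integrable M (\<lambda>\<omega>. (lin_comb u v 0 \<omega>)\<^sup>2)" 
    unfolding lin_comb_square using int2 int_prod by auto
  have e0: "expectation (\<lambda>\<omega>. (lin_comb u v 0 \<omega>)\<^sup>2) = qform u v"
    unfolding lin_comb_square qform_def using int2 int_prod by simp
  show "integrable M (\<lambda>\<omega>. (lin_comb u v n \<omega>)\<^sup>2)"
    using integrable_ident[OF b2, of n] i0 by (simp add: lin_comb_def)
  show "expectation (\<lambda>\<omega>. (lin_comb u v n \<omega>)\<^sup>2) = qform u v"
    using expectation_ident[OF b2, of n] e0 by (simp add: lin_comb_def)
qed

lemma indep_lin_comb: "indep_vars (\<lambda>_. borel) (\<lambda>n. lin_comb (u n) (v n) n) UNIV"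
  using indep_vars_compose2[OF indep, of "\<lambda>n p. u n * fst p + v n * snd p" "\<lambda>_. borel"]
    lin_comb_borel
  by (simp add: lin_comb_def[abs_def])

lemma qform_nonneg: "0 \<le> qform u v"
  unfolding expectation_lin_comb_square[of u v 0, symmetric] by simp

text \<open>The values of a quadratic form at two orthogonal vectors of equal length add up to the
  squared length times the trace, and here both are nonnegative.\<close>

lemma qform_le: "qform u v \<le> (u\<^sup>2 + v\<^sup>2) * total_variance"
proof -
  have "qform u v + qform v (- u) = (u\<^sup>2 + v\<^sup>2) * total_variance"
    by (simp add: qform_def total_variance_def algebra_simps)
  then show ?thesis using qform_nonneg[of v "- u"] by linarith
qed

text \<open>The real and imaginary parts of \<open>c * (eta + i * theta)\<close> are the linear
  combinations with weights \<open>(Re c, - Im c)\<close> and \<open>(Im c, Re c)\<close>. Their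
  second moments therefore add up to \<open>|c|^2\<close> times the trace, whatever the
  correlation.\<close>

lemma qform_sum: "qform u (- v) + qform v u = (u\<^sup>2 + v\<^sup>2) * total_variance"
  by (simp add: qform_def total_variance_def algebra_simps)

text \<open>The one-series theorem at each of countably many abscissae \<open>1/2 + e\<close>,
  separately for the series in \<open>eta\<close> and in \<open>theta\<close>; the weights are
  square summable by \<open>summable_ln_powr\<close>.\<close>

lemma AE_convergent_event: "AE \<omega> in M. convergent_event \<alpha> eta theta \<omega>"
proof -
  have "AE \<omega> in M. summable (dir_term \<alpha> eta theta \<omega> (of_real (1/2 + 1 / (real j + 1))))"
    for j :: nat
  proof -
    define e where "e = 1 / (real j + 1)"
    define c where "c = (\<lambda>n. if 2 \<le> n then ln (real n) powr \<alpha> * real n powr (- (1/2 + e)) else 0)"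
    have e: "e > 0" by (simp add: e_def)
    have AEs: "AE \<omega> in M. summable (\<lambda>n. lin_comb (c n * a) (c n * b) n \<omega>)" for a b
    proof (rule kolmogorov_one_series[OF indep_lin_comb integrable_lin_comb_square
      expectation_lin_comb])
      have "(c n * a)\<^sup>2 + (c n * b)\<^sup>2 \<le> (a\<^sup>2 + b\<^sup>2) * (ln (real n)
        powr \<alpha> * real n powr (- (1/2 + e)))\<^sup>2" for n
        by (auto simp: c_def power_mult_distrib algebra_simps)
      then have le: "norm (qform (c n * a) (c n * b))
        \<le> ((a\<^sup>2 + b\<^sup>2) * (ln (real n) powr \<alpha> * real n powr (- (1/2 + e)))\<^sup>2) * total_variance" for n
        unfolding real_norm_def abs_of_nonneg[OF qform_nonneg]
        by (rule order_trans[OF qform_le mult_right_mono[OF _ total_variance_nonneg]])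
      have "summable (\<lambda>n. ((a\<^sup>2 + b\<^sup>2) * (ln (real n) powr \<alpha> * real n powr (- (1/2 + e)))\<^sup>2)
        * total_variance)"
        by (rule summable_mult2[OF summable_mult[OF summable_ln_powr[OF e]]])
      then show "summable (\<lambda>n. expectation (\<lambda>\<omega>. (lin_comb (c n * a) (c n * b) n \<omega>)\<^sup>2))"
        unfolding expectation_lin_comb_square by (rule summable_comparison_test') (rule le)
    qed
    from AEs[of 1 0] AEs[of 0 1] show ?thesis
    proof eventually_elim
      case (elim \<omega>)
      have eq: "dir_term \<alpha> eta theta \<omega> (of_real (1/2 + e)) n
        = of_real (lin_comb (c n * 1) (c n * 0) n \<omega>) + \<i> * of_real (lin_comb (c n * 0) (c n * 1)
          n \<omega>)" for n
      proof (cases "2 \<le> n")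
        case True
        have "complex_of_nat n powr - of_real (1/2 + e) = of_real (real n powr (- (1/2 + e)))"
          using powr_of_real[of "real n" "- (1/2 + e)"] by simp
        then show ?thesis using True by (simp add: dir_term_def c_def lin_comb_def algebra_simps)
      qed (simp add: dir_term_def c_def lin_comb_def)
      have "summable (\<lambda>n. complex_of_real (lin_comb (c n * 1) (c n * 0) n \<omega>)
        + \<i> * complex_of_real (lin_comb (c n * 0) (c n * 1) n \<omega>))"
        by (intro summable_add summable_mult summable_of_real elim)
      then show ?case unfolding e_def[symmetric] eq[abs_def, symmetric] .
    qed
  qed
  then show ?thesis unfolding convergent_event_iff by (simp add: AE_all_countable)
qed

section \<open>Lindeberg's argument for weighted sums\<close>

definition pair_norm :: "'a \<Rightarrow> real" where
  "pair_norm \<omega> = sqrt ((eta 0 \<omega>)\<^sup>2 + (theta 0 \<omega>)\<^sup>2)"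

text \<open>A truncated third moment that is finite under second moments alone and tends to 0 with
  \<open>w\<close> by dominated convergence.\<close>

definition lindeberg :: "real \<Rightarrow> real" where
  "lindeberg w = expectation (\<lambda>\<omega>. min ((pair_norm \<omega>)\<^sup>2) (w * (pair_norm \<omega>)^3))"

lemma pair_norm_measurable[measurable]: "pair_norm \<in> borel_measurable M"
  unfolding pair_norm_def by measurable

lemma pair_norm_nonneg: "0 \<le> pair_norm \<omega>" by (simp add: pair_norm_def)

lemma integrable_pair_norm_square: "integrable M (\<lambda>\<omega>. (pair_norm \<omega>)\<^sup>2)"
  unfolding pair_norm_def using int2 by simp

lemma integrable_lindeberg: "0 \<le> w \<Longrightarrow> integrable M (\<lambda>\<omega>. min ((pair_norm \<omega>)\<^sup>2) (w * (pair_norm \<omega>)^3))"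
  by (rule Bochner_Integration.integrable_bound[OF integrable_pair_norm_square])
    (auto simp: pair_norm_nonneg)

lemma lindeberg_tendsto_0:
  assumes "w \<longlonglongrightarrow> 0" "\<And>n. 0 \<le> w n" shows "(\<lambda>n. lindeberg (w n)) \<longlonglongrightarrow> 0"
proof -
  have "(\<lambda>n. expectation (\<lambda>\<omega>. min ((pair_norm \<omega>)\<^sup>2) (w n * (pair_norm \<omega>)^3))) \<longlonglongrightarrow> expectation (\<lambda>\<omega>. 0)"
  proof (rule integral_dominated_convergence[OF _ _ integrable_pair_norm_square])
    show "AE \<omega> in M. (\<lambda>n. min ((pair_norm \<omega>)\<^sup>2) (w n * (pair_norm \<omega>)^3)) \<longlonglongrightarrow> 0"
    proof (rule AE_I2)
      fix \<omega>
      have "(\<lambda>n. min ((pair_norm \<omega>)\<^sup>2) (w n * (pair_norm \<omega>)^3))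
        \<longlonglongrightarrow> min ((pair_norm \<omega>)\<^sup>2) (0 * (pair_norm \<omega>)^3)"
        by (intro tendsto_intros assms)
      then show "(\<lambda>n. min ((pair_norm \<omega>)\<^sup>2) (w n * (pair_norm \<omega>)^3)) \<longlonglongrightarrow> 0" by (simp add: min_absorb2)
    qed
  qed (use assms in \<open>auto simp: pair_norm_nonneg\<close>)
  then show ?thesis by (simp add: lindeberg_def)
qed

text \<open>A second-order expansion of the characteristic function with remainder
  \<open>min (6 * x^2) (|x|^3)\<close>, compared with the Gaussian value. Both errors are
  proportional to \<open>u^2 + v^2\<close>, so they can be summed against a bounded total weight
  while the other factor tends to 0.\<close>

lemma char_lin_comb_approx:
  assumes w: "u\<^sup>2 + v\<^sup>2 \<le> \<delta>\<^sup>2" "0 \<le> \<delta>"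
  shows "cmod (char (distr M borel (lin_comb u v n)) 1 - exp (- of_real (qform u v) / 2))
    \<le> (u\<^sup>2 + v\<^sup>2) * (lindeberg \<delta> + \<delta>\<^sup>2 * total_variance\<^sup>2)"
proof -
  define d where "d = sqrt (u\<^sup>2 + v\<^sup>2)"
  have d: "0 \<le> d" "d\<^sup>2 = u\<^sup>2 + v\<^sup>2" by (auto simp: d_def)
  have dd: "d \<le> \<delta>" using w d by (metis power2_le_imp_le)
  \<comment> \<open>The Cauchy-Schwarz inequality in the plane.\<close>
  have Z: "\<bar>lin_comb u v 0 \<omega>\<bar> \<le> d * pair_norm \<omega>" for \<omega>
  proof -
    have "(u * eta 0 \<omega> + v * theta 0 \<omega>)\<^sup>2 \<le> (u\<^sup>2 + v\<^sup>2) * ((eta 0 \<omega>)\<^sup>2 + (theta 0 \<omega>)\<^sup>2)"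
    proof -
      have "0 \<le> (u * theta 0 \<omega> - v * eta 0 \<omega>)\<^sup>2" by simp
      then show ?thesis by (simp add: power2_eq_square algebra_simps)
    qed
    then have "(lin_comb u v 0 \<omega>)\<^sup>2 \<le> (d * pair_norm \<omega>)\<^sup>2"
      by (simp add: lin_comb_def d power_mult_distrib pair_norm_def)
    then show ?thesis using d pair_norm_nonneg[of \<omega>] abs_le_square_iff[of "lin_comb u v 0 \<omega>"
      "d * pair_norm \<omega>"] by simp
  qed
  have dist: "distr M borel (lin_comb u v n) = distr M borel (lin_comb u v 0)"
  proof -
    have "distr M borel (lin_comb u v k) = distr (distr M borel (\<lambda>\<omega>. (eta k \<omega>, theta k \<omega>)))
      borel (\<lambda>p. u * fst p + v * snd p)" for k
      by (subst distr_distr[OF lin_comb_borel pair_measurable])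
        (simp add: o_def lin_comb_def[abs_def])
    then show ?thesis by (simp add: ident[of n])
  qed
  have "cmod (char (distr M borel (lin_comb u v n)) 1 - (1 - 1\<^sup>2 * qform u v / 2))
    \<le> (1\<^sup>2 / 6) * expectation (\<lambda>\<omega>. min (6 * (lin_comb u v 0 \<omega>)\<^sup>2) (\<bar>1\<bar> * \<bar>lin_comb u v 0 \<omega>\<bar>^3))"
    unfolding dist of_real_mult[symmetric]
    by (rule char_approx3'[OF _ integrable_lin_comb integrable_lin_comb_square
      expectation_lin_comb _ refl])
      (auto simp: expectation_lin_comb expectation_lin_comb_square)
  \<comment> \<open>\<open>d^2\<close> is taken out of both branches of the minimum, which leaves
    one factor \<open>d \<le> \<delta>\<close> beside the cube; the 6 cancels the 1/6.\<close>
  also have "\<dots> \<le> (1\<^sup>2 / 6) * expectation (\<lambda>\<omega>. 6 * (d\<^sup>2 * min ((pair_norm \<omega>)\<^sup>2) (\<delta> * (pair_norm \<omega>)^3)))"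
  proof (intro mult_left_mono integral_mono)
    fix \<omega>
    have a: "(lin_comb u v 0 \<omega>)\<^sup>2 \<le> d\<^sup>2 * (pair_norm \<omega>)\<^sup>2" 
      using Z[of \<omega>] d pair_norm_nonneg[of \<omega>] abs_le_square_iff[of "lin_comb u v 0 \<omega>"
        "d * pair_norm \<omega>"] by (simp add: power_mult_distrib)
    have b: "\<bar>lin_comb u v 0 \<omega>\<bar>^3 \<le> d\<^sup>2 * (\<delta> * (pair_norm \<omega>)^3)"
    proof -
      have "\<bar>lin_comb u v 0 \<omega>\<bar>^3 \<le> (d * pair_norm \<omega>)^3" by (intro power_mono Z) simp
      also have "\<dots> = d\<^sup>2 * (d * (pair_norm \<omega>)^3)"
        by (simp add: power_mult_distrib power3_eq_cube power2_eq_square)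
      also have "\<dots> \<le> d\<^sup>2 * (\<delta> * (pair_norm \<omega>)^3)" using dd d pair_norm_nonneg[of \<omega>]
        by (intro mult_left_mono mult_right_mono) auto
      finally show ?thesis .
    qed
    have "0 \<le> d\<^sup>2 * (\<delta> * (pair_norm \<omega>)^3)" using order_trans[OF _ b] by simp
    then show "min (6 * (lin_comb u v 0 \<omega>)\<^sup>2) (\<bar>1\<bar> * \<bar>lin_comb u v 0 \<omega>\<bar>^3)
      \<le> 6 * (d\<^sup>2 * min ((pair_norm \<omega>)\<^sup>2) (\<delta> * (pair_norm \<omega>)^3))"
      using a b unfolding min_mult_distrib_left by (auto simp: min_def)
  next
    show "integrable M (\<lambda>\<omega>. min (6 * (lin_comb u v 0 \<omega>)\<^sup>2) (\<bar>1\<bar> * \<bar>lin_comb u v 0 \<omega>\<bar>^3))"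
      by (rule Bochner_Integration.integrable_bound[OF integrable_mult_right[OF
        integrable_lin_comb_square[of u v 0], of 6]]) auto
    show "integrable M (\<lambda>\<omega>. 6 * (d\<^sup>2 * min ((pair_norm \<omega>)\<^sup>2) (\<delta> * (pair_norm \<omega>)^3)))"
      by (intro integrable_mult_right integrable_lindeberg w)
  qed auto
  also have "\<dots> = (u\<^sup>2 + v\<^sup>2) * lindeberg \<delta>" using integrable_lindeberg[OF w(2)]
    by (simp add: lindeberg_def d)
  finally have A: "cmod (char (distr M borel (lin_comb u v n)) 1 - (1 - qform u v / 2))
    \<le> (u\<^sup>2 + v\<^sup>2) * lindeberg \<delta>" by simp
  have B: "cmod (complex_of_real (1 - qform u v / 2) - exp (- complex_of_real (qform u v) / 2))
    \<le> (u\<^sup>2 + v\<^sup>2) * (\<delta>\<^sup>2 * total_variance\<^sup>2)"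
  proof -
    \<comment> \<open>For \<open>x \<ge> 0\<close>:
      \<open>1 - x \<le> exp (- x) \<le> 1 / (1 + x) \<le> 1 - x + x^2\<close>.\<close>
    define x where "x = qform u v / 2"
    have x0: "0 \<le> x" using qform_nonneg by (simp add: x_def)
    have l: "1 - x \<le> exp (- x)" using exp_ge_add_one_self[of "- x"] by simp
    have u: "exp (- x) \<le> 1 - x + x\<^sup>2"
    proof -
      have "exp (- x) \<le> 1 / (1 + x)" using exp_ge_add_one_self[of x] x0
        by (simp add: exp_minus field_simps)
      also have "\<dots> \<le> 1 - x + x\<^sup>2" 
      proof -
        have "(1 - x + x\<^sup>2) * (1 + x) = 1 + x * x\<^sup>2" by (simp add: power2_eq_square algebra_simps)
        then have "1 \<le> (1 - x + x\<^sup>2) * (1 + x)" using x0 by simp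
        then show ?thesis using x0 by (simp add: pos_divide_le_eq)
      qed
      finally show ?thesis .
    qed
    have "complex_of_real (1 - qform u v / 2) - exp (- complex_of_real (qform u v) / 2)
      = complex_of_real ((1 - x) - exp (- x))"
      by (simp add: x_def exp_of_real[symmetric])
    then have "cmod (complex_of_real (1 - qform u v / 2) - exp (- complex_of_real (qform u v)
      / 2)) = \<bar>(1 - x) - exp (- x)\<bar>"
      by (simp only: norm_of_real)
    also have "\<dots> \<le> x\<^sup>2" using l u by linarith
    also have "\<dots> \<le> ((u\<^sup>2 + v\<^sup>2) * total_variance)\<^sup>2" using x0 qform_le[of u v]
      by (intro power_mono) (auto simp: x_def)
    also have "\<dots> = (u\<^sup>2 + v\<^sup>2) * ((u\<^sup>2 + v\<^sup>2) * total_variance\<^sup>2)"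
      by (simp add: power2_eq_square algebra_simps)
    also have "\<dots> \<le> (u\<^sup>2 + v\<^sup>2) * (\<delta>\<^sup>2 * total_variance\<^sup>2)" using w
      by (intro mult_left_mono mult_right_mono) auto
    finally show ?thesis .
  qed
  have "cmod (char (distr M borel (lin_comb u v n)) 1 - exp (- of_real (qform u v) / 2))
    \<le> (u\<^sup>2 + v\<^sup>2) * lindeberg \<delta> + (u\<^sup>2 + v\<^sup>2) * (\<delta>\<^sup>2 * total_variance\<^sup>2)"
    by (rule norm_diff_triangle_le[OF A B])
  then show ?thesis by (simp add: algebra_simps)
qed

text \<open>Independence factorises the characteristic function, and two products of numbers of
  modulus at most 1 differ by at most the sum of the differences of their factors. The bound depends
  on \<open>N\<close> only through the total squared weight, so it passes to infinite
  series.\<close>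

lemma weighted_clt_bound:
  assumes w: "\<And>n. (u n)\<^sup>2 + (v n)\<^sup>2 \<le> \<delta>\<^sup>2" "0 \<le> \<delta>"
  shows "cmod ((\<integral>\<omega>. iexp (\<Sum>n<N. lin_comb (u n) (v n) n \<omega>) \<partial>M) - exp (- of_real (\<Sum>n<N. qform (u n)
    (v n)) / 2))
    \<le> (lindeberg \<delta> + \<delta>\<^sup>2 * total_variance\<^sup>2) * (\<Sum>n<N. (u n)\<^sup>2 + (v n)\<^sup>2)"
proof -
  have "(\<integral>\<omega>. iexp (\<Sum>n<N. lin_comb (u n) (v n) n \<omega>) \<partial>M)
    = char (distr M borel (\<lambda>\<omega>. \<Sum>n<N. lin_comb (u n) (v n) n \<omega>)) 1"
    unfolding char_def by (subst integral_distr) auto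
  also have "\<dots> = (\<Prod>n<N. char (distr M borel (lin_comb (u n) (v n) n)) 1)"
    by (intro char_distr_sum indep_vars_subset[OF indep_lin_comb]) auto
  finally have c: "(\<integral>\<omega>. iexp (\<Sum>n<N. lin_comb (u n) (v n) n \<omega>) \<partial>M)
    = (\<Prod>n<N. char (distr M borel (lin_comb (u n) (v n) n)) 1)" .
  have e: "exp (- of_real (\<Sum>n<N. qform (u n) (v n)) / 2)
    = (\<Prod>n<N. exp (- complex_of_real (qform (u n) (v n)) / 2))"
    unfolding exp_sum[OF finite_lessThan, symmetric] by (simp add: sum_negf sum_divide_distrib)
  have "cmod ((\<Prod>n<N. char (distr M borel (lin_comb (u n) (v n) n)) 1)
    - (\<Prod>n<N. exp (- complex_of_real (qform (u n) (v n)) / 2)))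
    \<le> (\<Sum>n<N. cmod (char (distr M borel (lin_comb (u n) (v n) n))
      1 - exp (- complex_of_real (qform (u n) (v n)) / 2)))"
  proof (rule norm_prod_diff)
    fix n
    show "cmod (char (distr M borel (lin_comb (u n) (v n) n)) 1) \<le> 1"
      by (rule real_distribution.cmod_char_le_1[OF real_distribution_distr[OF lin_comb_measurable]])
    show "cmod (exp (- complex_of_real (qform (u n) (v n)) / 2)) \<le> 1" using qform_nonneg by simp
  qed
  also have "\<dots> \<le> (\<Sum>n<N. ((u n)\<^sup>2 + (v n)\<^sup>2) * (lindeberg \<delta> + \<delta>\<^sup>2 * total_variance\<^sup>2))"
    by (intro sum_mono char_lin_comb_approx w)
  also have "\<dots> = (lindeberg \<delta> + \<delta>\<^sup>2 * total_variance\<^sup>2) * (\<Sum>n<N. (u n)\<^sup>2 + (v n)\<^sup>2)"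
    unfolding sum_distrib_right[symmetric] by (rule mult.commute)
  finally show ?thesis unfolding c e .
qed

lemma second_moment_complex_sum:
  fixes c :: "nat \<Rightarrow> complex"
  shows "(\<integral>\<^sup>+\<omega>. ennreal ((cmod (\<Sum>n<N. c n * (of_real (eta n \<omega>) + \<i> * of_real (theta n \<omega>))))\<^sup>2) \<partial>M)
    = ennreal (total_variance * (\<Sum>n<N. (cmod (c n))\<^sup>2))"
proof -
  define A where "A = (\<lambda>\<omega>. \<Sum>n<N. lin_comb (Re (c n)) (- Im (c n)) n \<omega>)"
  define B where "B = (\<lambda>\<omega>. \<Sum>n<N. lin_comb (Im (c n)) (Re (c n)) n \<omega>)"
  have eq: "(cmod (\<Sum>n<N. c n * (of_real (eta n \<omega>) + \<i> * of_real (theta n \<omega>))))\<^sup>2 = (A \<omega>)\<^sup>2 + (B \<omega>)\<^sup>2"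
    for \<omega>
    unfolding cmod_power2 A_def B_def lin_comb_def by (simp add: algebra_simps)
  note sq = expectation_square_indep_sum[OF indep_lin_comb integrable_lin_comb_square
    expectation_lin_comb]
  have iA: "integrable M (\<lambda>\<omega>. (A \<omega>)\<^sup>2)" and iB: "integrable M (\<lambda>\<omega>. (B \<omega>)\<^sup>2)"
    unfolding A_def B_def by (rule sq)+
  have "(\<integral>\<^sup>+\<omega>. ennreal ((A \<omega>)\<^sup>2 + (B \<omega>)\<^sup>2) \<partial>M) = ennreal (expectation (\<lambda>\<omega>. (A \<omega>)\<^sup>2 + (B \<omega>)\<^sup>2))"
    by (rule nn_integral_eq_integral) (use iA iB in auto)
  also have "expectation (\<lambda>\<omega>. (A \<omega>)\<^sup>2 + (B \<omega>)\<^sup>2)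
    = expectation (\<lambda>\<omega>. (A \<omega>)\<^sup>2) + expectation (\<lambda>\<omega>. (B \<omega>)\<^sup>2)"
    using iA iB by simp
  also have "expectation (\<lambda>\<omega>. (A \<omega>)\<^sup>2) = (\<Sum>n<N. qform (Re (c n)) (- Im (c n)))"
    unfolding A_def sq(2) expectation_lin_comb_square ..
  also have "expectation (\<lambda>\<omega>. (B \<omega>)\<^sup>2) = (\<Sum>n<N. qform (Im (c n)) (Re (c n)))"
    unfolding B_def sq(2) expectation_lin_comb_square ..
  also have "(\<Sum>n<N. qform (Re (c n)) (- Im (c n))) + (\<Sum>n<N. qform (Im (c n)) (Re (c n)))
    = total_variance * (\<Sum>n<N. (cmod (c n))\<^sup>2)"
    unfolding sum.distrib[symmetric] qform_sum cmod_power2 sum_distrib_left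
      by (simp add: mult.commute)
  finally show ?thesis unfolding eq .
qed

end

section \<open>Riemann sums on the logarithmic scale\<close>

text \<open>An unnormalised gamma density, integrable for \<open>b > -1\<close>. In the uses with
  \<open>b = 2 * \<alpha>\<close> this is the condition \<open>\<alpha> > -1/2\<close>.\<close>

definition gamma_weight :: "real \<Rightarrow> real \<Rightarrow> real \<Rightarrow> real" where
  "gamma_weight b c y = indicator {0<..} y * (y powr b * exp (- c * y))"

lemma gamma_weight_nonneg: "0 \<le> gamma_weight b c y" by (simp add: gamma_weight_def)

lemma gamma_weight_measurable[measurable]: "gamma_weight b c \<in> borel_measurable borel"
  unfolding gamma_weight_def by measurable

lemma integrable_gamma_weight_1:
  assumes "b > -1" shows "integrable lborel (gamma_weight b 1)"
proof -
  have "(\<lambda>t. t powr (b + 1 - 1) / exp t) integrable_on {0..}"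
    using Gamma_integral_real[of "b + 1"] assms by (auto simp: integrable_on_def)
  then have "(\<lambda>t. t powr (b + 1 - 1) / exp t) absolutely_integrable_on {0..}"
    by (intro nonnegative_absolutely_integrable_1) auto
  then have "integrable lebesgue (\<lambda>t. indicator {0..} t *\<^sub>R (t powr b / exp t))"
    by (simp add: set_integrable_def)
  moreover have "indicator {0..} t *\<^sub>R (t powr b / exp t) = gamma_weight b 1 t" for t :: real
    by (cases "t = 0") (auto simp: gamma_weight_def exp_minus field_simps split: split_indicator)
  ultimately have "integrable lebesgue (gamma_weight b 1)" by (simp add: fun_eq_iff)
  then show ?thesis by (subst (asm) integrable_completion) auto
qed

lemma gamma_weight_scale: "c > 0 \<Longrightarrow> gamma_weight b c y = c powr (- b) * gamma_weight b 1 (0 + c * y)"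
  by (auto simp: gamma_weight_def powr_mult powr_minus field_simps zero_less_mult_iff split:
    split_indicator)

lemma integrable_gamma_weight:
  assumes "b > -1" "c > 0" shows "integrable lborel (gamma_weight b c)"
proof -
  have "gamma_weight b c = (\<lambda>y. c powr (- b) * gamma_weight b 1 (0 + c * y))"
    by (intro ext gamma_weight_scale assms)
  then show ?thesis
    using lborel_integrable_real_affine[OF integrable_gamma_weight_1[OF assms(1)], of c 0]
      assms(2) by simp
qed

text \<open>The substitution \<open>y -> c * y\<close>. For the \<open>k\<close>-th coefficient
  \<open>c\<close> is of order \<open>1 / k\<close>, and the power of \<open>c\<close> becomes the
  polynomial growth of the second moments.\<close>

lemma integral_gamma_weight:
  assumes "b > -1" "c > 0" 
  shows "(\<integral>y. gamma_weight b c y \<partial>lborel) = c powr (- (b + 1)) * (\<integral>y. gamma_weight b 1 y \<partial>lborel)"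
proof -
  have "(\<integral>y. gamma_weight b 1 y \<partial>lborel) = c * (\<integral>y. gamma_weight b 1 (0 + c * y) \<partial>lborel)"
    using lborel_integral_real_affine[of c "gamma_weight b 1" 0] assms by simp
  moreover have "(\<integral>y. gamma_weight b c y \<partial>lborel)
    = c powr (- b) * (\<integral>y. gamma_weight b 1 (0 + c * y) \<partial>lborel)"
    unfolding gamma_weight_scale[OF assms(2)] by (rule integral_mult_right_zero)
  moreover have "c powr (- (b + 1)) * c = c powr (- b)"
    using assms(2) powr_mult_base[of c "- (b+1)"] by (simp add: mult.commute)
  ultimately show ?thesis by (simp add: mult.assoc[symmetric])
qed

section \<open>Cells and step functions on the logarithmic scale\<close>

lemma ln_of_nat_add_one:
  assumes "n \<ge> 1" shows "ln (real n + 1) = ln (real n) + ln (1 + 1 / real n)"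
proof -
  have pos: "0 < real n" "0 < 1 + 1 / real n" using assms by (auto intro!: add_pos_nonneg)
  have "real n + 1 = real n * (1 + 1 / real n)" using assms by (simp add: field_simps)
  then show ?thesis using ln_mult_pos[OF pos] by simp
qed

text \<open>The half-open cells with \<open>n \<ge> 2\<close> tile the half-line right of
  \<open>s * ln 2\<close>.\<close>

definition log_cell :: "real \<Rightarrow> nat \<Rightarrow> real set" where
  "log_cell s n = {s * ln (real n) <.. s * ln (real n + 1)}"

lemma log_cell_unique:
  assumes "s > 0" "n \<ge> 2" "m \<ge> 2" "y \<in> log_cell s n" "y \<in> log_cell s m"
  shows "n = m"
proof (rule ccontr)
  assume "n \<noteq> m"
  moreover have False if "i < j" "i \<ge> 2" "y \<in> log_cell s i" "y \<in> log_cell s j" for i j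
  proof -
    have "ln (real i + 1) \<le> ln (real j)" using that by (subst ln_le_cancel_iff) auto
    then have "s * ln (real i + 1) \<le> s * ln (real j)" using assms(1) by (intro mult_left_mono) auto
    then show False using that by (auto simp: log_cell_def)
  qed
  ultimately show False using assms by (metis linorder_neqE_nat)
qed

text \<open>Two comparisons of \<open>y\<close> with the left endpoint of its cell. The factor 1/2,
  from \<open>n + 1 \<le> n^2\<close> for \<open>n \<ge> 2\<close>, holds for all \<open>s\<close>
  and serves domination; the additive error \<open>s\<close>, from
  \<open>ln (n + 1) \<le> ln n + 1\<close>, serves pointwise convergence.\<close>

lemma log_cell_bounds:
  assumes "s > 0" "n \<ge> 2" "y \<in> log_cell s n"
  shows "y / 2 \<le> s * ln (real n)" "s * ln (real n) \<le> y" "0 < y" "y - s \<le> s * ln (real n)"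
proof -
  have l: "s * ln (real n) < y" "y \<le> s * ln (real n + 1)" using assms by (auto simp: log_cell_def)
  show "s * ln (real n) \<le> y" using l by simp
  have "0 \<le> s * ln (real n)" using assms by simp
  then show "0 < y" using l by linarith
  have "real n + 1 \<le> (real n)\<^sup>2"
  proof -
    have "2 * real n \<le> real n * real n" using assms(2) by (intro mult_right_mono) auto
    moreover have "2 \<le> real n" using assms(2) by simp
    ultimately show ?thesis unfolding power2_eq_square by linarith
  qed
  then have "ln (real n + 1) \<le> ln ((real n)\<^sup>2)" using assms(2) by (subst ln_le_cancel_iff) auto
  also have "\<dots> = 2 * ln (real n)" using assms(2) by (simp add: ln_realpow)
  finally have "s * ln (real n + 1) \<le> s * (2 * ln (real n))" using assms(1)
    by (intro mult_left_mono) auto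
  then show "y / 2 \<le> s * ln (real n)" using l by simp
  have "ln (real n + 1) = ln (real n) + ln (1 + 1 / real n)"
    by (rule ln_of_nat_add_one) (use assms(2) in simp)
  moreover have "ln (1 + 1 / real n) \<le> 1 / real n" by (rule ln_add_one_self_le_self) simp
  moreover have "1 / real n \<le> 1" using assms(2) by simp
  ultimately have "ln (real n + 1) \<le> ln (real n) + 1" by linarith
  then have "s * ln (real n + 1) \<le> s * (ln (real n) + 1)" using assms(1)
    by (intro mult_left_mono) auto
  then show "y - s \<le> s * ln (real n)" using l by (simp add: algebra_simps)
qed

text \<open>The squared weight \<open>s / n \<cdot> (s ln n)\<^sup>2\<^sup>\<alpha>\<close> is the length of
  \<open>log_cell s n\<close> times the value of \<open>y\<^sup>2\<^sup>\<alpha>\<close> at the left endpoint,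
  up to the correction factor \<open>log_ratio n\<close>.\<close>

definition log_ratio :: "nat \<Rightarrow> real" where
  "log_ratio n = 1 / (real n * ln (1 + 1 / real n))"

lemma log_ratio_bounds:
  assumes "n \<ge> 2" shows "0 \<le> log_ratio n" "log_ratio n \<le> 2"
proof -
  define x where "x = 1 / real n"
  have x: "0 < x" "x \<le> 1/2" using assms by (auto simp: x_def field_simps)
  have "x - x\<^sup>2 \<le> ln (1 + x)" using x by (intro ln_one_plus_pos_lower_bound) auto
  moreover have "x\<^sup>2 \<le> x / 2" using x by (simp add: power2_eq_square) 
  ultimately have "x / 2 \<le> ln (1 + x)" by linarith
  then have "1 / 2 \<le> real n * ln (1 + 1 / real n)" using assms by (simp add: x_def field_simps)
  then show "0 \<le> log_ratio n" "log_ratio n \<le> 2" unfolding log_ratio_def by (auto simp: field_simps)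
qed

lemma log_ratio_tendsto: "log_ratio \<longlonglongrightarrow> 1"
  unfolding log_ratio_def by real_asymp

lemma dir_weight_square:
  assumes "s > 0" "n \<ge> 2"
  shows "(dir_weight \<alpha> s n)\<^sup>2 = (s * ln (1 + 1 / real n)) * (log_ratio n * (s * ln (real n))
    powr (2 * \<alpha>))"
proof -
  have ln: "0 < ln (real n)" "0 < ln (1 + 1 / real n)" using assms by (auto intro!: ln_gt_zero)
  have "(dir_weight \<alpha> s n)\<^sup>2 = (s powr (1/2 + \<alpha>))\<^sup>2 * (ln (real n) powr \<alpha>)\<^sup>2 * (real n powr (- 1/2))\<^sup>2"
    using assms by (simp add: dir_weight_def power_mult_distrib)
  also have "(s powr (1/2 + \<alpha>))\<^sup>2 = s * s powr (2 * \<alpha>)"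
    using assms by (simp add: powr_add power_mult_distrib powr_power mult.commute powr_half_sqrt)
  also have "(ln (real n) powr \<alpha>)\<^sup>2 = ln (real n) powr (2 * \<alpha>)" using ln
    by (simp add: powr_power mult.commute)
  also have "(real n powr (- 1/2))\<^sup>2 = 1 / real n" using assms
    by (simp add: powr_minus_divide powr_half_sqrt power_divide)
  also have "s * s powr (2 * \<alpha>) * ln (real n) powr (2 * \<alpha>) * (1 / real n)
    = s / real n * (s * ln (real n)) powr (2 * \<alpha>)"
    using assms ln by (simp add: powr_mult)
  also have "s / real n = s * ln (1 + 1 / real n) * log_ratio n" using ln
    by (simp add: log_ratio_def)
  finally show ?thesis by simp
qed

text \<open>Its integral over \<open>y\<close> is the \<open>n\<close>-th summand of the weighted
  series, so the series becomes the integral of a step function to which dominated convergence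
  applies.\<close>

definition log_step :: "real \<Rightarrow> (real \<Rightarrow> real) \<Rightarrow> real \<Rightarrow> nat \<Rightarrow> real \<Rightarrow> real" where
  "log_step \<alpha> h s n y = (if 2 \<le> n then indicator (log_cell s n)
    y * (log_ratio n * (s * ln (real n)) powr (2 * \<alpha>) * h (s * ln (real n))) else 0)"

text \<open>The price of evaluating \<open>y powr (2 * \<alpha>)\<close> at a point between
  \<open>y / 2\<close> and \<open>y\<close>; for negative \<open>\<alpha>\<close> the worst point is
  \<open>y / 2\<close>.\<close>

definition weight_const :: "real \<Rightarrow> real" where "weight_const \<alpha> = max 1 (2 powr (- (2 * \<alpha>)))"

lemma powr_le_weight_const:
  assumes "0 < y" "y / 2 \<le> t" "t \<le> y" shows "t powr (2 * \<alpha>) \<le> weight_const \<alpha> * y powr (2 * \<alpha>)"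
proof (cases "0 \<le> \<alpha>")
  case True
  have "t powr (2 * \<alpha>) \<le> y powr (2 * \<alpha>)" using assms True by (intro powr_mono2) auto
  also have "\<dots> \<le> weight_const \<alpha> * y powr (2 * \<alpha>)"
    using mult_right_mono[of 1 "weight_const \<alpha>" "y powr (2 * \<alpha>)"] by (simp add: weight_const_def)
  finally show ?thesis .
next
  case False
  have "t powr (2 * \<alpha>) \<le> (y / 2) powr (2 * \<alpha>)" using assms False by (intro powr_mono2') auto
  also have "\<dots> = 2 powr (- (2 * \<alpha>)) * y powr (2 * \<alpha>)" using assms
    by (simp add: powr_divide powr_minus field_simps)
  also have "\<dots> \<le> weight_const \<alpha> * y powr (2 * \<alpha>)"
    by (intro mult_right_mono) (auto simp: weight_const_def)
  finally show ?thesis .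
qed

text \<open>Instantiated with squared moduli and with quadratic forms of coefficients of the
  exponential kernel.\<close>

locale exp_decay =
  fixes \<alpha> :: real and h :: "real \<Rightarrow> real" and C c :: real
  assumes alpha: "\<alpha> > -1/2" and c: "c > 0" and hC: "\<And>y. 0 \<le> y \<Longrightarrow> \<bar>h y\<bar> \<le> C * exp (- c * y)"
begin

lemma C_nonneg: "0 \<le> C" using hC[of 0] by simp

text \<open>The 2 bounds \<open>log_ratio\<close>, and the rate is halved because the left endpoint
  of the cell of \<open>y\<close> is only known to be at least \<open>y / 2\<close>. It does not
  involve \<open>s\<close>.\<close>

definition dominator :: "real \<Rightarrow> real" where "dominator y
  = 2 * weight_const \<alpha> * C * gamma_weight (2 * \<alpha>) (c / 2) y"

lemma dominator_nonneg: "0 \<le> dominator y"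
  unfolding dominator_def using C_nonneg
    by (intro mult_nonneg_nonneg gamma_weight_nonneg) (auto simp: weight_const_def)

lemma integrable_dominator: "integrable lborel dominator"
  unfolding dominator_def using integrable_gamma_weight[of "2 * \<alpha>" "c/2"] alpha c by simp

lemma log_step_le:
  assumes "s > 0" shows "\<bar>log_step \<alpha> h s n y\<bar> \<le> indicator (log_cell s n) y * dominator y"
proof (cases "2 \<le> n \<and> y \<in> log_cell s n")
  case True
  note b = log_cell_bounds[OF assms conjunct1[OF True] conjunct2[OF True]]
  have "\<bar>log_ratio n * (s * ln (real n)) powr (2 * \<alpha>) * h (s * ln (real n))\<bar>
    \<le> 2 * (weight_const \<alpha> * y powr (2 * \<alpha>)) * (C * exp (- (c/2) * y))"
    unfolding abs_mult
  proof (intro mult_mono)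
    show "\<bar>log_ratio n\<bar> \<le> 2" using log_ratio_bounds[of n] True by auto
    show "\<bar>(s * ln (real n)) powr (2 * \<alpha>)\<bar> \<le> weight_const \<alpha> * y powr (2 * \<alpha>)"
      using powr_le_weight_const[OF b(3,1,2)] by simp
    have "\<bar>h (s * ln (real n))\<bar> \<le> C * exp (- c * (s * ln (real n)))" using b by (intro hC) linarith
    also have "\<dots> \<le> C * exp (- (c/2) * y)"
    proof -
      have "c * (y / 2) \<le> c * (s * ln (real n))" using b c by (intro mult_left_mono) auto
      then show ?thesis using C_nonneg by (intro mult_left_mono) auto
    qed
    finally show "\<bar>h (s * ln (real n))\<bar> \<le> C * exp (- (c/2) * y)" .
  qed (auto simp: weight_const_def)
  then show ?thesis using True b by (simp add: log_step_def dominator_def gamma_weight_def mult_ac)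
next
  case False
  then show ?thesis using dominator_nonneg by (auto simp: log_step_def)
qed

lemma log_step_measurable[measurable]: "log_step \<alpha> h s n \<in> borel_measurable borel"
  unfolding log_step_def log_cell_def by measurable

lemma log_step_le_dominator: "s > 0 \<Longrightarrow> \<bar>log_step \<alpha> h s n y\<bar> \<le> dominator y"
  using log_step_le[of s n y] dominator_nonneg[of y] by (simp split: split_indicator_asm)

lemma log_step_integrable:
  assumes "s > 0" shows "integrable lborel (log_step \<alpha> h s n)"
proof (rule Bochner_Integration.integrable_bound[OF integrable_dominator])
  show "AE y in lborel. norm (log_step \<alpha> h s n y) \<le> norm (dominator y)"
    unfolding real_norm_def abs_of_nonneg[OF dominator_nonneg]
      by (intro AE_I2 log_step_le_dominator assms)
qed simp

lemma log_step_integral: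
  assumes "s > 0" shows "(\<integral>y. log_step \<alpha> h s n y \<partial>lborel)
    = (dir_weight \<alpha> s n)\<^sup>2 * h (s * ln (real n))"
proof (cases "2 \<le> n")
  case True
  have "ln (real n + 1) = ln (real n) + ln (1 + 1 / real n)"
    by (rule ln_of_nat_add_one) (use True in simp)
  then have "s * ln (real n + 1) - s * ln (real n) = s * ln (1 + 1 / real n)"
    by (simp add: algebra_simps)
  moreover have "s * ln (real n) \<le> s * ln (real n + 1)" using True assms by simp
  ultimately have "measure lborel (log_cell s n) = s * ln (1 + 1 / real n)"
    unfolding log_cell_def by simp
  then show ?thesis using True dir_weight_square[OF assms True, of \<alpha>]
    by (simp add: log_step_def)
qed (simp add: log_step_def dir_weight_def)

lemma log_step_cases:
  assumes "s > 0"
  obtains "\<And>n. log_step \<alpha> h s n y = 0" | m where "2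
    \<le> m" "y \<in> log_cell s m" "\<And>n. n \<noteq> m \<Longrightarrow> log_step \<alpha> h s n y = 0"
proof (cases "\<exists>m\<ge>2. y \<in> log_cell s m")
  case True
  then obtain m where m: "2 \<le> m" "y \<in> log_cell s m" by blast
  show ?thesis
  proof (rule that(2)[OF m])
    fix n assume "n \<noteq> m"
    then show "log_step \<alpha> h s n y = 0" using log_cell_unique[OF assms _ m(1) _ m(2), of n]
      by (cases "y \<in> log_cell s n") (auto simp: log_step_def)
  qed
next
  case False
  then show ?thesis by (intro that(1)) (simp add: log_step_def)
qed

lemma log_step_sum_le:
  assumes "s > 0" "finite A" shows "(\<Sum>n\<in>A. \<bar>log_step \<alpha> h s n y\<bar>) \<le> dominator y"
proof (cases rule: log_step_cases[OF assms(1), of y])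
  case 1 then show ?thesis using dominator_nonneg by simp
next
  case (2 m)
  have "(\<Sum>n\<in>A. \<bar>log_step \<alpha> h s n y\<bar>) = (\<Sum>n\<in>A \<inter> {m}. \<bar>log_step \<alpha> h s n y\<bar>)"
    using assms 2(3) by (intro sum.mono_neutral_right) auto
  also have "\<dots> \<le> dominator y"
  proof (cases "m \<in> A")
    case True
    then have "A \<inter> {m} = {m}" by auto
    then show ?thesis using log_step_le[OF assms(1), of m y] 2 by simp
  qed (use dominator_nonneg in auto)
  finally show ?thesis .
qed

lemma log_step_summable_abs:
  assumes "s > 0" shows "summable (\<lambda>n. \<bar>log_step \<alpha> h s n y\<bar>)"
proof (cases rule: log_step_cases[OF assms, of y])
  case (2 m)
  then show ?thesis by (intro summable_finite[of "{m}"]) auto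
qed simp

text \<open>Since the bound is free of \<open>s\<close> and \<open>N\<close>, it controls the second
  moments uniformly as well as the total squared weight in the central limit bound.\<close>

lemma weight_sum_abs_le:
  assumes "s > 0"
  shows "(\<Sum>n<N. (dir_weight \<alpha> s n)\<^sup>2 * \<bar>h (s * ln (real n))\<bar>) \<le> (\<integral>y. dominator y \<partial>lborel)"
proof -
  \<comment> \<open>The same constants fit the absolute value of \<open>h\<close>, so the dominator
    is unchanged.\<close>
  interpret a: exp_decay \<alpha> "\<lambda>y. \<bar>h y\<bar>" C c by unfold_locales (use alpha c hC in auto)
  have "(\<Sum>n<N. (dir_weight \<alpha> s n)\<^sup>2 * \<bar>h (s * ln (real n))\<bar>)
    = (\<integral>y. (\<Sum>n<N. log_step \<alpha> (\<lambda>y. \<bar>h y\<bar>) s n y) \<partial>lborel)"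
    using a.log_step_integrable[OF assms] a.log_step_integral[OF assms] by simp
  also have "\<dots> \<le> (\<integral>y. a.dominator y \<partial>lborel)"
  proof (intro integral_mono a.integrable_dominator Bochner_Integration.integrable_sum
    a.log_step_integrable assms)
    fix y
    have "(\<Sum>n<N. log_step \<alpha> (\<lambda>y. \<bar>h y\<bar>) s n y) \<le> (\<Sum>n<N. \<bar>log_step \<alpha> (\<lambda>y. \<bar>h y\<bar>) s n y\<bar>)"
      by (intro sum_mono) auto
    also have "\<dots> \<le> a.dominator y" by (rule a.log_step_sum_le[OF assms]) simp
    finally show "(\<Sum>n<N. log_step \<alpha> (\<lambda>y. \<bar>h y\<bar>) s n y) \<le> a.dominator y" .
  qed
  finally show ?thesis by (simp add: a.dominator_def dominator_def)
qed

lemma weight_summable_abs: "s > 0 \<Longrightarrow> summable (\<lambda>n. (dir_weight \<alpha> s n)\<^sup>2 * \<bar>h (s * ln (real n))\<bar>)"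
  by (rule summableI_nonneg_bounded[OF _ weight_sum_abs_le]) auto

lemma weight_sum_eq_integral:
  assumes "s > 0"
  shows "(\<Sum>n. (dir_weight \<alpha> s n)\<^sup>2 * h (s * ln (real n))) = (\<integral>y. (\<Sum>n. log_step \<alpha> h s n y) \<partial>lborel)"
proof -
  have abs: "\<bar>log_step \<alpha> h s n y\<bar> = log_step \<alpha> (\<lambda>y. \<bar>h y\<bar>) s n y" for n y
    using log_ratio_bounds[of n] by (auto simp: log_step_def abs_mult)
  interpret a: exp_decay \<alpha> "\<lambda>y. \<bar>h y\<bar>" C c by unfold_locales (use alpha c hC in auto)
  have "(\<integral>y. (\<Sum>n. log_step \<alpha> h s n y) \<partial>lborel) = (\<Sum>n. \<integral>y. log_step \<alpha> h s n y \<partial>lborel)"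
  proof (rule integral_suminf)
    show "AE y in lborel. summable (\<lambda>n. norm (log_step \<alpha> h s n y))"
      using log_step_summable_abs[OF assms] by simp
    show "summable (\<lambda>n. \<integral>y. norm (log_step \<alpha> h s n y) \<partial>lborel)"
      unfolding real_norm_def abs a.log_step_integral[OF assms]
        by (rule weight_summable_abs[OF assms])
  qed (rule log_step_integrable[OF assms])
  then show ?thesis unfolding log_step_integral[OF assms] by simp
qed

text \<open>Dominated convergence for the step functions. At \<open>y > 0\<close> only the cell
  containing \<open>y\<close> contributes; as \<open>s\<close> tends to 0 its index tends to
  infinity, its left endpoint tends to \<open>y\<close> and the correction \<open>log_ratio\<close>
  tends to 1.\<close>

lemma log_riemann_sum:
  assumes cont: "continuous_on {0<..} h" and s: "\<And>m. s m > 0" "s \<longlonglongrightarrow> 0"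
  shows "(\<lambda>m. \<Sum>n. (dir_weight \<alpha> (s m) n)\<^sup>2 * h (s m * ln (real n)))
    \<longlonglongrightarrow> (\<integral>y. indicator {0<..} y * (y powr (2 * \<alpha>) * h y) \<partial>lborel)"
  unfolding weight_sum_eq_integral[OF s(1)]
proof (rule integral_dominated_convergence[OF _ _ integrable_dominator])
  have "h \<in> borel_measurable (restrict_space borel {0<..})"
    by (rule borel_measurable_continuous_on_restrict[OF cont])
  then have "(\<lambda>y. indicator {0<..} y *\<^sub>R h y) \<in> borel_measurable borel"
    by (subst (asm) borel_measurable_restrict_space_iff) auto
  then have "(\<lambda>y. y powr (2 * \<alpha>) * (indicator {0<..} y *\<^sub>R h y)) \<in> borel_measurable borel"
    by measurable
  then show "(\<lambda>y. indicator {0<..} y * (y powr (2 * \<alpha>) * h y)) \<in> borel_measurable lborel"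
    by (simp add: mult_ac)
  show "(\<lambda>y. \<Sum>n. log_step \<alpha> h (s m) n y) \<in> borel_measurable lborel" for m by measurable
  show "AE y in lborel. norm (\<Sum>n. log_step \<alpha> h (s m) n y) \<le> dominator y" for m
  proof (rule AE_I2)
    fix y
    have "norm (\<Sum>n. log_step \<alpha> h (s m) n y) \<le> (\<Sum>n. norm (log_step \<alpha> h (s m) n y))"
      using log_step_summable_abs[OF s(1)] by (intro summable_norm) auto
    also have "\<dots> \<le> dominator y" using log_step_summable_abs[OF s(1)] log_step_sum_le[OF s(1)]
      by (intro suminf_le_const) auto
    finally show "norm (\<Sum>n. log_step \<alpha> h (s m) n y) \<le> dominator y" .
  qed
  show "AE y in lborel. (\<lambda>m. \<Sum>n. log_step \<alpha> h (s m) n y)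
    \<longlonglongrightarrow> indicator {0<..} y * (y powr (2 * \<alpha>) * h y)"
  proof (rule AE_I2)
    fix y
    show "(\<lambda>m. \<Sum>n. log_step \<alpha> h (s m) n y) \<longlonglongrightarrow> indicator {0<..} y * (y powr (2 * \<alpha>) * h y)"
    proof (cases "0 < y")
      case False
      have "log_step \<alpha> h (s m) n y = 0" for m n
        using log_cell_bounds(3)[OF s(1), of n y m] False
        by (cases "y \<in> log_cell (s m) n") (auto simp: log_step_def)
      then show ?thesis using False by simp
    next
      case True
      \<comment> \<open>The cell of \<open>y\<close> has the index \<open>N\<close> with
        \<open>N < exp (y / s) \<le> N + 1\<close>, that is, the ceiling minus one.\<close>
      define N where "N = (\<lambda>m. nat (\<lceil>exp (y / s m)\<rceil> - 1))"
      have sr: "filterlim s (at_right 0) sequentially"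
        using s(2) less_imp_neq[OF s(1), THEN not_sym] s(1) by (auto simp: filterlim_at)
      have lim: "filterlim (\<lambda>m. exp (y / s m)) at_top sequentially"
      proof (rule filterlim_compose[OF _ sr])
        show "filterlim (\<lambda>t. exp (y / t)) at_top (at_right 0)" using True by real_asymp
      qed
      have Nb: "exp (y / s m) \<le> real (N m) + 1 \<and> real (N m) < exp (y / s m)" for m
      proof -
        have "0 < exp (y / s m)" by simp
        then have "1 \<le> \<lceil>exp (y / s m)\<rceil>" by (simp add: one_le_ceiling)
        then have "real (N m) = of_int \<lceil>exp (y / s m)\<rceil> - 1" unfolding N_def
          by (subst of_nat_nat) auto
        then show ?thesis using ceiling_correct[of "exp (y / s m)"] by linarith
      qed
      have "filterlim (\<lambda>m. - 1 + exp (y / s m)) at_top sequentially"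
        by (rule filterlim_tendsto_add_at_top[OF tendsto_const lim])
      then have Nr: "filterlim (\<lambda>m. real (N m)) at_top sequentially"
        by (rule filterlim_at_top_mono) (use Nb in \<open>auto simp: algebra_simps\<close>)
      then have Nn: "filterlim N sequentially sequentially"
        by (simp add: filterlim_sequentially_iff_filterlim_real)
      have N2: "\<forall>\<^sub>F m in sequentially. 2 \<le> N m" using Nn by (simp add: filterlim_at_top)
      have cell: "y \<in> log_cell (s m) (N m)" if "2 \<le> N m" for m
      proof -
        have "ln (real (N m)) < y / s m"
          using Nb[of m] that ln_less_cancel_iff[of "real (N m)" "exp (y / s m)"] by simp
        moreover have "y / s m \<le> ln (real (N m) + 1)"
          using Nb[of m] ln_le_cancel_iff[of "exp (y / s m)" "real (N m) + 1"] by simp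
        ultimately show ?thesis using s(1)[of m] by (simp add: log_cell_def field_simps)
      qed
      have tl: "(\<lambda>m. s m * ln (real (N m))) \<longlonglongrightarrow> y"
      proof (rule tendsto_sandwich)
        show "\<forall>\<^sub>F m in sequentially. y - s m \<le> s m * ln (real (N m))"
          using N2 by eventually_elim (rule log_cell_bounds(4)[OF s(1) _ cell])
        show "\<forall>\<^sub>F m in sequentially. s m * ln (real (N m)) \<le> y"
          using N2 by eventually_elim (rule log_cell_bounds(2)[OF s(1) _ cell])
        show "(\<lambda>m. y - s m) \<longlonglongrightarrow> y" using tendsto_diff[OF tendsto_const s(2), of y] by simp
      qed simp
      have hl: "(\<lambda>m. h (s m * ln (real (N m)))) \<longlonglongrightarrow> h y"
        using isCont_tendsto_compose[OF _ tl, of h] cont True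
          by (simp add: continuous_on_eq_continuous_at)
      have rl: "(\<lambda>m. log_ratio (N m)) \<longlonglongrightarrow> 1" by (rule filterlim_compose[OF log_ratio_tendsto Nn])
      have "(\<lambda>m. log_ratio (N m) * (s m * ln (real (N m))) powr (2 * \<alpha>)
        * h (s m * ln (real (N m)))) \<longlonglongrightarrow> 1 * y powr (2 * \<alpha>) * h y"
        using True by (intro tendsto_intros hl rl tl) auto
      moreover have "\<forall>\<^sub>F m in sequentially. log_ratio (N m) * (s m * ln (real (N m))) powr (2 * \<alpha>)
        * h (s m * ln (real (N m))) = (\<Sum>n. log_step \<alpha> h (s m) n y)"
        using N2
      proof eventually_elim
        case (elim m)
        have "(\<Sum>n. log_step \<alpha> h (s m) n y) = (\<Sum>n\<in>{N m}. log_step \<alpha> h (s m) n y)"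
        proof (rule suminf_finite)
          fix n assume "n \<notin> {N m}"
          then show "log_step \<alpha> h (s m) n y = 0" 
            using log_cell_unique[OF s(1) _ elim _ cell[OF elim], of n]
            by (cases "y \<in> log_cell (s m) n") (auto simp: log_step_def)
        qed simp
        then show ?case using cell[OF elim] elim by (simp add: log_step_def)
      qed
      ultimately show ?thesis using True by (auto elim: Lim_transform_eventually)
    qed
  qed
qed

end

section \<open>Wiener integrals of the kernels\<close>

definition grid_point :: "nat \<Rightarrow> nat \<Rightarrow> real" where "grid_point n k = real k / real (Suc n)"

text \<open>Mesh \<open>1 / (n + 1)\<close> with \<open>(n + 1)^2\<close> cells: the grid refines
  while the covered interval grows to \<open>n + 1\<close>. Right endpoints keep the evaluations
  away from 0, where the kernel is singular for negative \<open>\<alpha>\<close>.\<close>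

definition grid_list :: "nat \<Rightarrow> (real \<Rightarrow> complex) \<Rightarrow> (complex \<times> real \<times> real) list" where
  "grid_list n g = map (\<lambda>k. (g (grid_point n (Suc k)), grid_point n k, grid_point n (Suc k)))
    [0..<(Suc n)\<^sup>2]"

lemma step_fun_grid: "step_fun (grid_list n g) y
  = (\<Sum>k<(Suc n)\<^sup>2. g (grid_point n (Suc k)) * indicator {grid_point n k<..grid_point n (Suc k)} y)"
  unfolding step_fun_def grid_list_def
    by (simp add: o_def interv_sum_list_conv_sum_set_nat atLeast0LessThan)

lemma step_int_grid: "step_int B (grid_list n g) \<omega>
  = (\<Sum>k<(Suc n)\<^sup>2. g (grid_point n (Suc k)) * of_real (B (grid_point n (Suc k))
  \<omega> - B (grid_point n k) \<omega>))"
  unfolding step_int_def grid_list_def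
    by (simp add: o_def interv_sum_list_conv_sum_set_nat atLeast0LessThan)

definition cell_index :: "nat \<Rightarrow> real \<Rightarrow> nat" where
  "cell_index n y = nat (\<lceil>y * real (Suc n)\<rceil> - 1)"

lemma cell_iff:
  assumes "0 < y" shows "y \<in> {grid_point n k<..grid_point n (Suc k)} \<longleftrightarrow> k = cell_index n y"
proof -
  have p: "0 < y * real (Suc n)" using assms by simp
  have "y \<in> {grid_point n k<..grid_point n (Suc k)} \<longleftrightarrow> real k < y * real (Suc n) \<and> y * real (Suc n)
    \<le> real k + 1"
    by (simp add: grid_point_def field_simps)
  also have "\<dots> \<longleftrightarrow> \<lceil>y * real (Suc n)\<rceil> = int k + 1"
    unfolding ceiling_eq_iff by simp
  also have "\<dots> \<longleftrightarrow> k = cell_index n y"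
    unfolding cell_index_def using p by auto
  finally show ?thesis .
qed

lemma step_fun_grid_pos:
  assumes "0 < y" 
  shows "step_fun (grid_list n g) y = (if cell_index n y < (Suc n)\<^sup>2 then g (grid_point n (Suc
    (cell_index n y))) else 0)"
proof -
  have "step_fun (grid_list n g) y = (\<Sum>k<(Suc n)\<^sup>2. if k
    = cell_index n y then g (grid_point n (Suc k)) else 0)"
    unfolding step_fun_grid using cell_iff[OF assms, of n]
      by (intro sum.cong refl) (auto simp: indicator_def)
  then show ?thesis by simp
qed

lemma grid_point_cell_bounds:
  assumes "0 < y" shows "y \<le> grid_point n (Suc (cell_index n y))"
    "grid_point n (Suc (cell_index n y)) \<le> y + 1 / real (Suc n)"
proof -
  have c: "grid_point n (cell_index n y) < y" "y \<le> grid_point n (Suc (cell_index n y))" 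
    using cell_iff[OF assms, of n "cell_index n y"] by auto
  then show "y \<le> grid_point n (Suc (cell_index n y))" by simp
  have "grid_point n (Suc k) = grid_point n k + 1 / real (Suc n)" for k
    by (simp add: grid_point_def add_divide_distrib)
  then show "grid_point n (Suc (cell_index n y)) \<le> y + 1 / real (Suc n)" using c
    by (metis add_right_mono less_imp_le)
qed

lemma step_fun_grid_nonpos:
  assumes "y \<le> 0" shows "step_fun (grid_list n g) y = 0"
proof -
  have "0 \<le> grid_point n k" for k by (simp add: grid_point_def)
  then have "y \<notin> {grid_point n k<..grid_point n (Suc k)}" for k using assms
    by (auto simp: not_less intro: order_trans)
  then show ?thesis unfolding step_fun_grid by (intro sum.neutral) auto
qed

lemma step_fun_grid_tendsto:
  assumes y: "0 < y" and g: "isCont g y"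
  shows "(\<lambda>n. step_fun (grid_list n g) y) \<longlonglongrightarrow> g y"
proof -
  have "(\<lambda>n. grid_point n (Suc (cell_index n y))) \<longlonglongrightarrow> y"
  proof (rule tendsto_sandwich[of "\<lambda>_. y" _ _ "\<lambda>n. y + 1 / real (Suc n)"])
    show "(\<lambda>n. y + 1 / real (Suc n)) \<longlonglongrightarrow> y"
      using tendsto_add[OF tendsto_const LIMSEQ_inverse_real_of_nat, of y]
        by (simp add: inverse_eq_divide)
  qed (use grid_point_cell_bounds[OF y] in auto)
  then have "(\<lambda>n. g (grid_point n (Suc (cell_index n y)))) \<longlonglongrightarrow> g y"
    by (rule isCont_tendsto_compose[OF g])
  moreover have "\<forall>\<^sub>F n in sequentially. y \<le> real n"
    by (rule eventually_at_top_linorderI[of "nat \<lceil>y\<rceil>"]) linarith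
  then have "\<forall>\<^sub>F n in sequentially. g (grid_point n (Suc (cell_index n y)))
    = step_fun (grid_list n g) y"
  proof eventually_elim
    case (elim n)
    have "grid_point n (cell_index n y) < y" using cell_iff[OF y, of n "cell_index n y"] by auto
    then have "real (cell_index n y) < y * real (Suc n)" by (simp add: grid_point_def field_simps)
    also have "\<dots> \<le> real (Suc n) * real (Suc n)" using elim by (intro mult_right_mono) auto
    also have "\<dots> = real ((Suc n)\<^sup>2)" by (simp add: power2_eq_square algebra_simps)
    finally have "cell_index n y < (Suc n)\<^sup>2" by (simp only: of_nat_less_iff)
    then show ?case using step_fun_grid_pos[OF y] by simp
  qed
  ultimately show ?thesis by (rule Lim_transform_eventually)
qed

text \<open>The step function at \<open>y\<close> takes the value of \<open>g\<close> at a point at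
  most one mesh width to the right; hence \<open>D y\<close> has to dominate \<open>g\<close> on
  \<open>[y, y + 1]\<close>.\<close>

lemma step_fun_grid_bound:
  assumes "\<And>y y'. 0 < y \<Longrightarrow> y \<le> y' \<Longrightarrow> y' \<le> y + 1 \<Longrightarrow> (cmod (g y'))\<^sup>2 \<le> D y" "0 < y"
  shows "(cmod (step_fun (grid_list n g) y))\<^sup>2 \<le> D y"
proof -
  have "1 / real (Suc n) \<le> 1" by simp
  then have "(cmod (g (grid_point n (Suc (cell_index n y)))))\<^sup>2 \<le> D y"
    using grid_point_cell_bounds[OF assms(2), of n] by (intro assms(1)[OF assms(2)]) linarith+
  moreover have "0 \<le> D y" using calculation by (rule order_trans[rotated]) simp
  ultimately show ?thesis unfolding step_fun_grid_pos[OF assms(2)] by simp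
qed

lemma step_fun_grid_measurable[measurable]: "step_fun (grid_list n g) \<in> borel_measurable borel"
  unfolding step_fun_grid[abs_def] by measurable

lemma continuous_indicator_measurable:
  fixes g :: "real \<Rightarrow> 'b :: {real_normed_vector, second_countable_topology}"
  assumes "continuous_on {0<..} g" shows "(\<lambda>y. indicator {0<..} y *\<^sub>R g y) \<in> borel_measurable borel"
  using borel_measurable_continuous_on_restrict[OF assms]
    by (subst (asm) borel_measurable_restrict_space_iff) auto

text \<open>This is the premise under which \<open>wiener_integral\<close> yields the convergence of
  the step integrals. The constant 4 in the domination comes from
  \<open>(a + b)^2 \<le> 2 * a^2 + 2 * b^2\<close>.\<close>

lemma grid_L2_approximation:
  assumes g: "continuous_on {0<..} g"
    and D: "\<And>y y'. 0 < y \<Longrightarrow> y \<le> y' \<Longrightarrow> y' \<le> y + 1 \<Longrightarrow> (cmod (g y'))\<^sup>2 \<le> D y"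
    and intD: "integrable lborel D"
  shows "(\<lambda>n. \<integral>\<^sup>+ y. ennreal ((cmod (g y - step_fun (grid_list n g) y))\<^sup>2)
    * indicator {0..} y \<partial>lborel) \<longlonglongrightarrow> 0"
proof -
  define G where "G = (\<lambda>y. indicator {0<..} y *\<^sub>R g y)"
  have mG[measurable]: "G \<in> borel_measurable borel" unfolding G_def
    by (rule continuous_indicator_measurable[OF g])
  define u where "u = (\<lambda>n y. ennreal ((cmod (G y - step_fun (grid_list n g) y))\<^sup>2))"
  \<comment> \<open>At \<open>y = 0\<close> the step function is 0 and \<open>g\<close> is
    arbitrary, but a single point has measure 0.\<close>
  have AE0: "AE y in lborel. y \<noteq> (0::real)" by (rule AE_lborel_singleton)
  have eq: "(\<integral>\<^sup>+ y. ennreal ((cmod (g y - step_fun (grid_list n g) y))\<^sup>2)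
    * indicator {0..} y \<partial>lborel) = (\<integral>\<^sup>+ y. u n y \<partial>lborel)" for n
  proof (rule nn_integral_cong_AE)
    show "AE y in lborel. ennreal ((cmod (g y - step_fun (grid_list n g) y))\<^sup>2) * indicator {0..} y
      = u n y"
      using AE0
    proof eventually_elim
      case (elim y)
      then show ?case using step_fun_grid_nonpos[of y n g]
        by (cases "0 < y") (auto simp: u_def G_def)
    qed
  qed
  have "(\<lambda>n. \<integral>\<^sup>+ y. u n y \<partial>lborel) \<longlonglongrightarrow> (\<integral>\<^sup>+ y. 0 \<partial>(lborel :: real measure))"
  proof (rule nn_integral_dominated_convergence[where w = "\<lambda>y. ennreal (4 * \<bar>D y\<bar>)"])
    show "u n \<in> borel_measurable lborel" for n unfolding u_def by measurable
    show "(\<lambda>y. ennreal (4 * \<bar>D y\<bar>)) \<in> borel_measurable lborel" using intD by measurable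
    show "(\<integral>\<^sup>+ y. ennreal (4 * \<bar>D y\<bar>) \<partial>lborel) < \<infinity>"
      using intD by (subst nn_integral_eq_integral) auto
    show "AE y in lborel. u n y \<le> ennreal (4 * \<bar>D y\<bar>)" for n
    proof (rule AE_I2)
      fix y :: real
      show "u n y \<le> ennreal (4 * \<bar>D y\<bar>)"
      proof (cases "0 < y")
        case True
        have a: "(cmod (g y))\<^sup>2 \<le> D y" using D[OF True, of y] by simp
        have b: "(cmod (step_fun (grid_list n g) y))\<^sup>2 \<le> D y"
          by (rule step_fun_grid_bound[OF D True])
        have "cmod (g y - step_fun (grid_list n g) y)
          \<le> cmod (g y) + cmod (step_fun (grid_list n g) y)" by (rule norm_triangle_ineq4)
        then have "(cmod (g y - step_fun (grid_list n g) y))\<^sup>2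
          \<le> (cmod (g y) + cmod (step_fun (grid_list n g) y))\<^sup>2"
          by (intro power_mono) auto
        also have "\<dots> \<le> 2 * (cmod (g y))\<^sup>2 + 2 * (cmod (step_fun (grid_list n g) y))\<^sup>2"
          using sum_squares_bound[of "cmod (g y)" "cmod (step_fun (grid_list n g) y)"]
            by (simp add: power2_sum)
        also have "\<dots> \<le> 4 * \<bar>D y\<bar>" using a b by linarith
        finally show ?thesis using True unfolding u_def G_def by (intro ennreal_leI) simp
      next
        case False
        then show ?thesis using step_fun_grid_nonpos[of y n g] by (simp add: u_def G_def)
      qed
    qed
    show "AE y in lborel. (\<lambda>n. u n y) \<longlonglongrightarrow> 0"
    proof (rule AE_I2)
      fix y :: real
      show "(\<lambda>n. u n y) \<longlonglongrightarrow> 0"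
      proof (cases "0 < y")
        case True
        then have "isCont g y" using g by (simp add: continuous_on_eq_continuous_at)
        from step_fun_grid_tendsto[OF True this]
        have "(\<lambda>n. (cmod (g y - step_fun (grid_list n g) y))\<^sup>2) \<longlonglongrightarrow> (cmod (g y - g y))\<^sup>2"
          by (intro tendsto_intros)
        then have "(\<lambda>n. ennreal ((cmod (g y - step_fun (grid_list n g) y))\<^sup>2)) \<longlonglongrightarrow> ennreal 0"
          by (intro tendsto_ennrealI) simp
        then show ?thesis using True by (simp add: u_def G_def)
      next
        case False
        then show ?thesis using step_fun_grid_nonpos[of y _ g] by (simp add: u_def G_def)
      qed
    qed
  qed auto
  then show ?thesis unfolding eq by simp
qed

text \<open>For the quadratic form \<open>q\<close> of the limit process the left side is the
  variance of a step integral.\<close>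

lemma grid_quadratic_sum:
  assumes h: "continuous_on {0<..} h"
    and D: "\<And>y y'. 0 < y \<Longrightarrow> y \<le> y' \<Longrightarrow> y' \<le> y + 1 \<Longrightarrow> (cmod (h y'))\<^sup>2 \<le> D y"
    and intD: "integrable lborel D"
    and q: "continuous_on UNIV q" "q 0 = (0::real)" "\<And>w. \<bar>q w\<bar> \<le> E * (cmod w)\<^sup>2"
  shows "(\<lambda>n. (\<Sum>k<(Suc n)\<^sup>2. q (h (grid_point n (Suc k)))) / real (Suc n))
    \<longlonglongrightarrow> (\<integral>y. indicator {0<..} y * q (h y) \<partial>lborel)"
proof -
  have E: "0 \<le> E" using q(3)[of 1] by simp
  have qm[measurable]: "q \<in> borel_measurable borel" using q(1)
    by (rule borel_measurable_continuous_onI)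
  \<comment> \<open>\<open>q\<close> can be applied cell by cell because the cells are disjoint and
    \<open>q 0 = 0\<close>.\<close>
  have cellq: "q (step_fun (grid_list n h) y)
    = (\<Sum>k<(Suc n)\<^sup>2. q (h (grid_point n (Suc k))) * indicator {grid_point n k<..grid_point n (Suc
    k)} y)" for n y
  proof (cases "0 < y")
    case True
    have "(\<Sum>k<(Suc n)\<^sup>2. q (h (grid_point n (Suc k)))
      * indicator {grid_point n k<..grid_point n (Suc k)} y)
      = (\<Sum>k<(Suc n)\<^sup>2. if k = cell_index n y then q (h (grid_point n (Suc k))) else 0)"
      using cell_iff[OF True, of n] by (intro sum.cong refl) (auto simp: indicator_def)
    then show ?thesis unfolding step_fun_grid_pos[OF True] using q(2) by simp
  next
    case False
    have "0 \<le> grid_point n k" for k by (simp add: grid_point_def)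
    then have "y \<notin> {grid_point n k<..grid_point n (Suc k)}" for k using False
      by (auto simp: not_less intro: order_trans)
    then have "(\<Sum>k<(Suc n)\<^sup>2. q (h (grid_point n (Suc k)))
      * indicator {grid_point n k<..grid_point n (Suc k)} y) = 0"
      by (intro sum.neutral) auto
    then show ?thesis using step_fun_grid_nonpos[of y n h] False q(2) by simp
  qed
  have int: "(\<Sum>k<(Suc n)\<^sup>2. q (h (grid_point n (Suc k)))) / real (Suc n)
    = (\<integral>y. q (step_fun (grid_list n h) y) \<partial>lborel)" for n
  proof -
    have len: "measure lborel {grid_point n k<..grid_point n (Suc k)} = 1 / real (Suc n)" for k
      by (subst measure_lborel_Ioc) (auto simp: grid_point_def divide_right_mono add_divide_distrib)
    have "grid_point n k \<le> grid_point n (Suc k)" for k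
      by (simp add: grid_point_def divide_right_mono)
    then have ind: "integrable lborel (indicator {grid_point n k<..grid_point n (Suc k)} :: real \<Rightarrow>
      real)" for k
      by (intro integrable_real_indicator) (auto simp: emeasure_lborel_Ioc)
    have "(\<integral>y. q (step_fun (grid_list n h) y) \<partial>lborel)
      = (\<Sum>k<(Suc n)\<^sup>2. q (h (grid_point n (Suc k))) * measure lborel {grid_point n k<..grid_point n
      (Suc k)})"
      unfolding cellq by (subst Bochner_Integration.integral_sum) (auto intro!: ind)
    then show ?thesis unfolding len by (simp add: sum_divide_distrib)
  qed
  have "(\<lambda>n. \<integral>y. q (step_fun (grid_list n h) y) \<partial>lborel)
    \<longlonglongrightarrow> (\<integral>y. indicator {0<..} y * q (h y) \<partial>lborel)"
  proof (rule integral_dominated_convergence[where w = "\<lambda>y. E * \<bar>D y\<bar>"])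
    have "(\<lambda>y. indicator {0<..} y *\<^sub>R h y) \<in> borel_measurable borel"
      by (rule continuous_indicator_measurable[OF h])
    then have "(\<lambda>y. q (indicator {0<..} y *\<^sub>R h y)) \<in> borel_measurable borel" by measurable
    moreover have "q (indicator {0<..} y *\<^sub>R h y) = indicator {0<..} y * q (h y)" for y
      using q(2) by (auto split: split_indicator)
    ultimately show "(\<lambda>y. indicator {0<..} y * q (h y)) \<in> borel_measurable lborel" by simp
    show "integrable lborel (\<lambda>y. E * \<bar>D y\<bar>)" using intD by auto
    show "AE y in lborel. norm (q (step_fun (grid_list n h) y)) \<le> E * \<bar>D y\<bar>" for n
    proof (rule AE_I2)
      fix y
      show "norm (q (step_fun (grid_list n h) y)) \<le> E * \<bar>D y\<bar>"
      proof (cases "0 < y")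
        case True
        have "norm (q (step_fun (grid_list n h) y)) \<le> E * (cmod (step_fun (grid_list n h) y))\<^sup>2"
          using q(3) by simp
        also have "\<dots> \<le> E * \<bar>D y\<bar>" 
        proof (intro mult_left_mono E)
          have "(cmod (step_fun (grid_list n h) y))\<^sup>2 \<le> D y" by (rule step_fun_grid_bound[OF D True])
          then show "(cmod (step_fun (grid_list n h) y))\<^sup>2 \<le> \<bar>D y\<bar>" by linarith
        qed
        finally show ?thesis .
      next
        case False
        then show ?thesis using step_fun_grid_nonpos[of y n h] q(2) E by simp
      qed
    qed
    show "AE y in lborel. (\<lambda>n. q (step_fun (grid_list n h) y)) \<longlonglongrightarrow> indicator {0<..} y * q (h y)"
    proof (rule AE_I2)
      fix y :: real
      show "(\<lambda>n. q (step_fun (grid_list n h) y)) \<longlonglongrightarrow> indicator {0<..} y * q (h y)"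
      proof (cases "0 < y")
        case True
        then have "isCont h y" using h by (simp add: continuous_on_eq_continuous_at)
        from isCont_tendsto_compose[OF _ step_fun_grid_tendsto[OF True this], of q] q(1) True
        show ?thesis by (simp add: continuous_on_eq_continuous_at)
      next
        case False
        then show ?thesis using step_fun_grid_nonpos[of y _ h] q(2) by simp
      qed
    qed
  qed measurable
  then show ?thesis unfolding int .
qed

text \<open>The kernel is squared, whence \<open>2 * \<alpha>\<close> and \<open>2 * c\<close>. The
  weight with exponent 0 covers small \<open>y\<close> when \<open>\<alpha>\<close> is positive:
  there \<open>y'\<close> may be near 1 although \<open>y powr (2 * \<alpha>)\<close> is near
  0.\<close>

definition kernel_dominator :: "real \<Rightarrow> real \<Rightarrow> real \<Rightarrow> real" where
  "kernel_dominator \<alpha> c y = max 1 (2 powr (2 * \<alpha>)) * (gamma_weight (2 * \<alpha>) (2 * c)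
    y + gamma_weight 0 (2 * c) y)"

lemma integrable_kernel_dominator: "\<alpha> > -1/2 \<Longrightarrow> c > 0 \<Longrightarrow> integrable lborel (kernel_dominator \<alpha> c)"
  unfolding kernel_dominator_def
    using integrable_gamma_weight[of "2 * \<alpha>" "2 * c"] integrable_gamma_weight[of 0 "2 * c"] by simp

lemma kernel_bound_le_dominator:
  assumes g: "\<And>y. 0 < y \<Longrightarrow> cmod (g y) \<le> L * (y powr \<alpha> * exp (- c * y))" and c: "0 < c"
    and y: "0 < y" "y \<le> y'" "y' \<le> y + 1"
  shows "(cmod (g y'))\<^sup>2 \<le> L\<^sup>2 * kernel_dominator \<alpha> c y"
proof -
  have "(cmod (g y'))\<^sup>2 \<le> (L * (y' powr \<alpha> * exp (- c * y')))\<^sup>2" using y by (intro power_mono g) auto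
  also have "\<dots> = L\<^sup>2 * (y' powr (2 * \<alpha>) * exp (- (2 * c) * y'))"
    using y by (simp add: power_mult_distrib powr_power exp_double[symmetric] mult_ac)
  also have "\<dots> \<le> L\<^sup>2 * ((max 1 (2 powr (2 * \<alpha>)) * (y powr (2 * \<alpha>) + 1)) * exp (- (2 * c) * y))"
  proof (intro mult_left_mono mult_mono)
    show "y' powr (2 * \<alpha>) \<le> max 1 (2 powr (2 * \<alpha>)) * (y powr (2 * \<alpha>) + 1)"
    proof (cases "0 \<le> \<alpha>")
      case True
      \<comment> \<open>\<open>y' \<le> y + 1 \<le> 2 * max y 1\<close>.\<close>
      have "y' powr (2 * \<alpha>) \<le> (2 * max y 1) powr (2 * \<alpha>)" using True y by (intro powr_mono2) auto
      also have "\<dots> = 2 powr (2 * \<alpha>) * max y 1 powr (2 * \<alpha>)" using y by (simp add: powr_mult)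
      also have "\<dots> \<le> max 1 (2 powr (2 * \<alpha>)) * (y powr (2 * \<alpha>) + 1)"
        by (intro mult_mono) (auto simp: max_def)
      finally show ?thesis .
    next
      case False
      have "y' powr (2 * \<alpha>) \<le> y powr (2 * \<alpha>)" using False y by (intro powr_mono2') auto
      also have "\<dots> \<le> 1 * (y powr (2 * \<alpha>) + 1)" by simp
      also have "\<dots> \<le> max 1 (2 powr (2 * \<alpha>)) * (y powr (2 * \<alpha>) + 1)" by (intro mult_right_mono) auto
      finally show ?thesis .
    qed
  qed (use y c in auto)
  also have "\<dots> = L\<^sup>2 * kernel_dominator \<alpha> c y" using y
    by (simp add: kernel_dominator_def gamma_weight_def algebra_simps)
  finally show ?thesis .
qed

lemma continuous_I_kernel: "continuous_on {0<..} (I_kernel \<alpha> z)"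
  unfolding I_kernel_def by (intro continuous_intros) auto

lemma norm_I_kernel: "0 < y \<Longrightarrow> c \<le> Re z \<Longrightarrow> cmod (I_kernel \<alpha> z y) \<le> y powr \<alpha> * exp (- c * y)"
  unfolding I_kernel_def by (auto simp: norm_mult intro!: mult_left_mono mult_right_mono)

text \<open>Existence and uniqueness for the definite description. By Cayley-Hamilton the root of a
  matrix \<open>A\<close> is \<open>(A + t) / \<tau>\<close>, where \<open>t\<close> is the root of
  the determinant and \<open>\<tau>\<close> the root of the trace plus \<open>2 * t\<close>; a
  positive trace makes \<open>\<tau>\<close> nonzero.\<close>

lemma psd_sqrt2_spec:
  assumes a: "0 \<le> a" "0 \<le> d" "b\<^sup>2 \<le> a * d" "0 < a + d" and pqr: "psd_sqrt2 a b d = (p, q, r)"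
  shows "p\<^sup>2 + q\<^sup>2 = a" "p * q + q * r = b" "q\<^sup>2 + r\<^sup>2 = d"
proof -
  define t where "t = sqrt (a * d - b\<^sup>2)"
  define \<tau> where "\<tau> = sqrt (a + d + 2 * t)"
  have t: "0 \<le> t" "t\<^sup>2 = a * d - b\<^sup>2" using a by (auto simp: t_def)
  have tau: "0 < \<tau>" "\<tau>\<^sup>2 = a + d + 2 * t" using a t by (auto simp: \<tau>_def)
  define Pr where "Pr = (\<lambda>(p, q, r). 0 \<le> p \<and> 0 \<le> r \<and> q\<^sup>2 \<le> p * r \<and> p\<^sup>2 + q\<^sup>2 = a \<and> p * q + q * r
    = b \<and> q\<^sup>2 + r\<^sup>2 = d)"
  have ex: "Pr ((a + t) / \<tau>, b / \<tau>, (d + t) / \<tau>)"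
  proof -
    have "b\<^sup>2 \<le> (a + t) * (d + t)"
    proof -
      have "0 \<le> a * t + t * d + t * t" using a t
        by (intro add_nonneg_nonneg mult_nonneg_nonneg) auto
      then show ?thesis using a(3) by (simp add: algebra_simps)
    qed
    then have "(b / \<tau>)\<^sup>2 \<le> (a + t) / \<tau> * ((d + t) / \<tau>)"
      using tau(1) by (simp add: power_divide power2_eq_square divide_right_mono)
    moreover have "((a + t) / \<tau>)\<^sup>2 + (b / \<tau>)\<^sup>2 = a"
    proof -
      have "(a + t)\<^sup>2 + b\<^sup>2 = a * \<tau>\<^sup>2" using t tau by (simp add: power2_eq_square algebra_simps)
      then show ?thesis using tau(1) by (simp add: power_divide add_divide_distrib[symmetric])
    qed
    moreover have "(b / \<tau>)\<^sup>2 + ((d + t) / \<tau>)\<^sup>2 = d"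
    proof -
      have "b\<^sup>2 + (d + t)\<^sup>2 = d * \<tau>\<^sup>2" using t tau by (simp add: power2_eq_square algebra_simps)
      then show ?thesis using tau(1) by (simp add: power_divide add_divide_distrib[symmetric])
    qed
    moreover have "(a + t) / \<tau> * (b / \<tau>) + b / \<tau> * ((d + t) / \<tau>) = b"
    proof -
      have "(a + t) * b + b * (d + t) = b * \<tau>\<^sup>2" using tau by (simp add: algebra_simps)
      then show ?thesis using tau(1) by (simp add: power2_eq_square add_divide_distrib[symmetric])
    qed
    ultimately show ?thesis using a t tau(1) unfolding Pr_def by simp
  qed
  have uniq: "x = ((a + t) / \<tau>, b / \<tau>, (d + t) / \<tau>)" if "Pr x" for x
  proof -
    obtain p q r where x: "x = (p, q, r)" by (cases x)
    have P: "0 \<le> p" "0 \<le> r" "q\<^sup>2 \<le> p * r" "p\<^sup>2 + q\<^sup>2 = a" "p * q + q * r = b" "q\<^sup>2 + r\<^sup>2 = d"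
      using that by (auto simp: Pr_def x)
    \<comment> \<open>Any root has determinant \<open>t\<close> and, from the trace of its square,
      trace \<open>\<tau>\<close>. Its entries are then determined linearly.\<close>
    have "(p * r - q\<^sup>2)\<^sup>2 = t\<^sup>2" unfolding t P(4-6)[symmetric]
      by (simp add: power2_eq_square algebra_simps)
    then have pr: "p * r - q\<^sup>2 = t" using P(3) t(1) by (simp add: power2_eq_iff_nonneg)
    have "(p + r)\<^sup>2 = \<tau>\<^sup>2" unfolding tau pr[symmetric] P(4,6)[symmetric]
      by (simp add: power2_eq_square algebra_simps)
    then have s: "p + r = \<tau>" using P(1,2) tau(1) by (simp add: power2_eq_iff_nonneg)
    have "q * \<tau> = b" "p * \<tau> = a + t" "r * \<tau> = d + t"
      unfolding s[symmetric] pr[symmetric] P(4-6)[symmetric]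
        by (auto simp: power2_eq_square algebra_simps)
    then show ?thesis using tau(1) x by (auto simp: field_simps)
  qed
  have "psd_sqrt2 a b d = The Pr" unfolding psd_sqrt2_def Pr_def ..
  then have "Pr (psd_sqrt2 a b d)" using theI[of Pr, OF ex uniq] by simp
  then show "p\<^sup>2 + q\<^sup>2 = a" "p * q + q * r = b" "q\<^sup>2 + r\<^sup>2 = d" unfolding pqr by (auto simp: Pr_def)
qed

text \<open>Fatou's lemma for \<open>2 n\<^sup>2 (1 - cos (X / n))\<close>, which tends to
  \<open>X\<^sup>2\<close>; this also covers the degenerate case \<open>V = 0\<close>, where
  there is no normal density.\<close>

lemma (in prob_space) second_moment_le_of_gaussian_char:
  assumes X[measurable]: "X \<in> borel_measurable M" 
    and ch: "\<And>t. (\<integral>\<omega>. iexp (t * X \<omega>) \<partial>M) = exp (- of_real (t\<^sup>2 * V) / 2)"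
  shows "(\<integral>\<^sup>+\<omega>. ennreal ((X \<omega>)\<^sup>2) \<partial>M) \<le> ennreal V"
proof -
  define f where "f = (\<lambda>n \<omega>. 2 * (real (Suc n))\<^sup>2 * (1 - cos (X \<omega> / real (Suc n))))"
  have lim: "(\<lambda>n. 2 * (real (Suc n))\<^sup>2 * (1 - cos (x / real (Suc n)))) \<longlonglongrightarrow> x\<^sup>2" for x :: real
  proof -
    consider "x = 0" | "x > 0" | "x < 0" by linarith
    then show ?thesis
    proof cases
      case 2 then show ?thesis unfolding power2_eq_square by real_asymp
    next
      case 3 then show ?thesis unfolding power2_eq_square by real_asymp
    qed simp
  qed
  have bound: "(\<integral>\<^sup>+\<omega>. ennreal (f n \<omega>) \<partial>M) \<le> ennreal V" for n
  proof -
    define t where "t = 1 / real (Suc n)"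
    have t: "t \<noteq> 0" by (simp add: t_def)
    have ie: "integrable M (\<lambda>\<omega>. iexp (t * X \<omega>))"
      by (rule integrable_const_bound[of _ 1]) auto
    have "expectation (\<lambda>\<omega>. cos (t * X \<omega>)) = expectation (\<lambda>\<omega>. Re (iexp (t * X \<omega>)))"
      by (simp add: Re_exp)
    also have "\<dots> = Re (\<integral>\<omega>. iexp (t * X \<omega>) \<partial>M)" using ie by simp
    also have "\<dots> = exp (- (t\<^sup>2 * V) / 2)" unfolding ch by (simp add: Re_exp)
    finally have Ecos: "expectation (\<lambda>\<omega>. cos (t * X \<omega>)) = exp (- (t\<^sup>2 * V) / 2)" .
    have icos: "integrable M (\<lambda>\<omega>. cos (t * X \<omega>))"
      by (rule integrable_const_bound[of _ 1]) auto
    have feq: "f n = (\<lambda>\<omega>. 2 / t\<^sup>2 * (1 - cos (t * X \<omega>)))"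
      by (simp add: f_def t_def power_divide fun_eq_iff)
    have "(\<integral>\<^sup>+\<omega>. ennreal (f n \<omega>) \<partial>M) = ennreal (expectation (f n))"
      unfolding feq using icos by (intro nn_integral_eq_integral) (auto intro!: mult_nonneg_nonneg)
    also have "expectation (f n) = 2 / t\<^sup>2 * (1 - exp (- (t\<^sup>2 * V) / 2))"
      unfolding feq using icos by (simp add: Ecos prob_space)
    also have "\<dots> \<le> 2 / t\<^sup>2 * (t\<^sup>2 * V / 2)"
      using exp_ge_add_one_self[of "- (t\<^sup>2 * V) / 2"] by (intro mult_left_mono) auto
    also have "\<dots> = V" using t by simp
    finally show ?thesis by (simp add: ennreal_leI)
  qed
  have "(\<integral>\<^sup>+\<omega>. ennreal ((X \<omega>)\<^sup>2) \<partial>M) = (\<integral>\<^sup>+\<omega>. liminf (\<lambda>n. ennreal (f n \<omega>)) \<partial>M)"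
    unfolding f_def by (intro nn_integral_cong lim_imp_Liminf[symmetric] tendsto_ennrealI lim) simp
  also have "\<dots> \<le> liminf (\<lambda>n. \<integral>\<^sup>+\<omega>. ennreal (f n \<omega>) \<partial>M)"
    by (intro nn_integral_liminf) (auto simp: f_def)
  also have "\<dots> \<le> ennreal V"
    by (intro Liminf_le) (auto simp: bound)
  finally show ?thesis .
qed

section \<open>L2 limits of step integrals and their characteristic functions\<close>

definition L2_tendsto :: "'b measure \<Rightarrow> (nat \<Rightarrow> 'b \<Rightarrow> complex) \<Rightarrow> ('b \<Rightarrow> complex) \<Rightarrow> bool" where
  "L2_tendsto P U V \<longleftrightarrow> (\<forall>n. U n \<in> borel_measurable P) \<and> V \<in> borel_measurable P \<and>
     (\<lambda>n. \<integral>\<^sup>+\<omega>. ennreal ((cmod (V \<omega> - U n \<omega>))\<^sup>2) \<partial>P) \<longlonglongrightarrow> 0"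

lemma L2_tendsto_scale:
  assumes "L2_tendsto P U V" shows "L2_tendsto P (\<lambda>n \<omega>. c * U n \<omega>) (\<lambda>\<omega>. c * V \<omega>)"
proof -
  have [measurable]: "U n \<in> borel_measurable P" "V \<in> borel_measurable P" for n using assms
    by (auto simp: L2_tendsto_def)
  have "(\<integral>\<^sup>+\<omega>. ennreal ((cmod (c * V \<omega> - c * U n \<omega>))\<^sup>2) \<partial>P)
    = ennreal ((cmod c)\<^sup>2) * (\<integral>\<^sup>+\<omega>. ennreal ((cmod (V \<omega> - U n \<omega>))\<^sup>2) \<partial>P)" for n
    by (subst nn_integral_cmult[symmetric])
      (auto simp: ennreal_mult[symmetric] right_diff_distrib[symmetric]
        norm_mult power_mult_distrib)
  moreover have "(\<lambda>n. ennreal ((cmod c)\<^sup>2) * (\<integral>\<^sup>+\<omega>. ennreal ((cmod (V \<omega> - U n \<omega>))\<^sup>2) \<partial>P))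
    \<longlonglongrightarrow> ennreal ((cmod c)\<^sup>2) * 0"
    using assms by (intro ennreal_tendsto_cmult) (auto simp: L2_tendsto_def)
  ultimately show ?thesis unfolding L2_tendsto_def by simp
qed

lemma L2_tendsto_add:
  assumes "L2_tendsto P U V" "L2_tendsto P U' V'" shows "L2_tendsto P (\<lambda>n \<omega>. U n \<omega> + U' n \<omega>)
    (\<lambda>\<omega>. V \<omega> + V' \<omega>)"
proof -
  have [measurable]: "U n \<in> borel_measurable P" "V \<in> borel_measurable P"
    "U' n \<in> borel_measurable P" "V' \<in> borel_measurable P" for n
    using assms by (auto simp: L2_tendsto_def)
  define I where "I = (\<lambda>n. \<integral>\<^sup>+\<omega>. ennreal ((cmod (V \<omega> - U n \<omega>))\<^sup>2) \<partial>P)"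
  define I' where "I' = (\<lambda>n. \<integral>\<^sup>+\<omega>. ennreal ((cmod (V' \<omega> - U' n \<omega>))\<^sup>2) \<partial>P)"
  have le: "(\<integral>\<^sup>+\<omega>. ennreal ((cmod ((V \<omega> + V' \<omega>) - (U n \<omega> + U' n \<omega>)))\<^sup>2) \<partial>P) \<le> 2 * I n + 2 * I' n"
    for n
  proof -
    have "(\<integral>\<^sup>+\<omega>. ennreal ((cmod ((V \<omega> + V' \<omega>) - (U n \<omega> + U' n \<omega>)))\<^sup>2) \<partial>P)
      \<le> (\<integral>\<^sup>+\<omega>. 2 * ennreal ((cmod (V \<omega> - U n \<omega>))\<^sup>2) + 2 * ennreal ((cmod (V' \<omega> - U' n \<omega>))\<^sup>2) \<partial>P)"
    proof (intro nn_integral_mono)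
      fix \<omega>
      let ?a = "cmod (V \<omega> - U n \<omega>)" and ?b = "cmod (V' \<omega> - U' n \<omega>)"
      have "cmod ((V \<omega> + V' \<omega>) - (U n \<omega> + U' n \<omega>)) \<le> ?a + ?b"
        using norm_triangle_ineq[of "V \<omega> - U n \<omega>" "V' \<omega> - U' n \<omega>"] by (simp add: algebra_simps)
      then have "(cmod ((V \<omega> + V' \<omega>) - (U n \<omega> + U' n \<omega>)))\<^sup>2 \<le> (?a + ?b)\<^sup>2" by (intro power_mono) auto
      also have "\<dots> \<le> 2 * ?a\<^sup>2 + 2 * ?b\<^sup>2" using sum_squares_bound[of ?a ?b] by (simp add: power2_sum)
      finally have "ennreal ((cmod ((V \<omega> + V' \<omega>) - (U n \<omega> + U' n \<omega>)))\<^sup>2)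
        \<le> ennreal (2 * ?a\<^sup>2 + 2 * ?b\<^sup>2)" by (rule ennreal_leI)
      then show "ennreal ((cmod ((V \<omega> + V' \<omega>) - (U n \<omega> + U' n \<omega>)))\<^sup>2)
        \<le> 2 * ennreal (?a\<^sup>2) + 2 * ennreal (?b\<^sup>2)"
        by (simp add: ennreal_mult)
    qed
    also have "\<dots> = 2 * I n + 2 * I' n"
      unfolding I_def I'_def by (subst nn_integral_add) (auto simp: nn_integral_cmult)
    finally show ?thesis .
  qed
  have "(\<lambda>n. 2 * I n + 2 * I' n) \<longlonglongrightarrow> 2 * 0 + 2 * 0"
    using assms unfolding L2_tendsto_def I_def I'_def
      by (intro tendsto_add ennreal_tendsto_cmult) auto
  then have "(\<lambda>n. 2 * I n + 2 * I' n) \<longlonglongrightarrow> 0" by simp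
  then have "(\<lambda>n. \<integral>\<^sup>+\<omega>. ennreal ((cmod ((V \<omega> + V' \<omega>) - (U n \<omega> + U' n \<omega>)))\<^sup>2) \<partial>P) \<longlonglongrightarrow> 0"
    by (rule tendsto_sandwich[OF _ _ tendsto_const, rotated 2]) (use le in auto)
  then show ?thesis unfolding L2_tendsto_def by simp
qed

lemma L2_tendsto_sum:
  fixes m :: nat
  assumes "\<And>j. j < m \<Longrightarrow> L2_tendsto P (U j) (V j)"
  shows "L2_tendsto P (\<lambda>n \<omega>. \<Sum>j<m. U j n \<omega>) (\<lambda>\<omega>. \<Sum>j<m. V j \<omega>)"
  using assms
proof (induction m)
  case 0 then show ?case by (simp add: L2_tendsto_def)
next
  case (Suc m)
  then show ?case using L2_tendsto_add[of P "\<lambda>n \<omega>. \<Sum>j<m. U j n \<omega>" "\<lambda>\<omega>. \<Sum>j<m. V j \<omega>" "U m" "V m"]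
    by simp
qed

lemma cmod_exp_i_diff_le: "cmod (iexp a - iexp b) \<le> \<bar>a - b\<bar>"
proof -
  have "iexp a - iexp b = iexp b * (iexp (a - b) - 1)"
    by (simp add: algebra_simps exp_add[symmetric])
  then have "cmod (iexp a - iexp b) = cmod (iexp (a - b) - 1)"
    by (simp add: norm_mult)
  also have "\<dots> \<le> \<bar>a - b\<bar>" using iexp_approx1[of "a - b" 0] by simp
  finally show ?thesis .
qed

text \<open>\<open>iexp\<close> is 1-Lipschitz, and \<open>x \<le> e + x^2 / e\<close> replaces the
  Cauchy-Schwarz inequality, so the estimate stays within nonnegative integrals.\<close>

lemma (in prob_space) L2_tendsto_char:
  assumes L2: "L2_tendsto M U V"
  shows "(\<lambda>n. \<integral>\<omega>. iexp (Re (U n \<omega>)) \<partial>M) \<longlonglongrightarrow> (\<integral>\<omega>. iexp (Re (V \<omega>)) \<partial>M)"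
proof (rule LIMSEQ_I)
  have [measurable]: "U n \<in> borel_measurable M" "V \<in> borel_measurable M" for n using L2
    by (auto simp: L2_tendsto_def)
  have iU: "integrable M (\<lambda>\<omega>. iexp (Re (U n \<omega>)))" for n
    by (rule integrable_const_bound[of _ 1]) auto
  have iV: "integrable M (\<lambda>\<omega>. iexp (Re (V \<omega>)))"
    by (rule integrable_const_bound[of _ 1]) auto
  fix r :: real assume r: "0 < r"
  define e where "e = r / 3"
  have e: "0 < e" using r by (simp add: e_def)
  define J where "J = (\<lambda>n. \<integral>\<^sup>+\<omega>. ennreal ((cmod (V \<omega> - U n \<omega>))\<^sup>2) \<partial>M)"
  have "J \<longlonglongrightarrow> 0" using L2 by (simp add: L2_tendsto_def J_def)
  then have "\<forall>\<^sub>F n in sequentially. J n < ennreal (e\<^sup>2)" using e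
    by (intro order_tendstoD(2)) (auto simp: zero_less_power)
  then obtain n0 where n0: "\<And>n. n \<ge> n0 \<Longrightarrow> J n < ennreal (e\<^sup>2)" by (auto simp: eventually_sequentially)
  have "norm ((\<integral>\<omega>. iexp (Re (U n \<omega>)) \<partial>M) - (\<integral>\<omega>. iexp (Re (V \<omega>)) \<partial>M)) < r" if "n \<ge> n0" for n
  proof -
    have "(\<integral>\<omega>. iexp (Re (U n \<omega>)) \<partial>M) - (\<integral>\<omega>. iexp (Re (V \<omega>)) \<partial>M)
      = (\<integral>\<omega>. iexp (Re (U n \<omega>)) - iexp (Re (V \<omega>)) \<partial>M)" (is "?A = _")
      using iU iV by simp
    then have "ennreal (norm ?A) \<le> (\<integral>\<^sup>+\<omega>. ennreal (norm (iexp (Re (U n \<omega>)) - iexp (Re (V \<omega>)))) \<partial>M)"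
      using integral_norm_bound_ennreal[OF Bochner_Integration.integrable_diff[OF iU[of n] iV]]
        by simp
    also have "\<dots> \<le> (\<integral>\<^sup>+\<omega>. ennreal e + ennreal (1 / e) * ennreal ((cmod (V \<omega> - U n \<omega>))\<^sup>2) \<partial>M)"
    proof (intro nn_integral_mono)
      fix \<omega>
      let ?x = "cmod (V \<omega> - U n \<omega>)"
      have "norm (iexp (Re (U n \<omega>)) - iexp (Re (V \<omega>))) \<le> \<bar>Re (U n \<omega>) - Re (V \<omega>)\<bar>"
        by (rule cmod_exp_i_diff_le)
      also have "\<dots> \<le> ?x" using abs_Re_le_cmod[of "V \<omega> - U n \<omega>"] by simp
      also have "?x \<le> e + 1 / e * ?x\<^sup>2"
      proof -
        have "0 \<le> (?x - e)\<^sup>2" "0 \<le> e * ?x" using e by auto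
        then have "e * ?x \<le> e * e + ?x\<^sup>2" unfolding power2_diff power2_eq_square
          by (simp add: algebra_simps)
        then show ?thesis using e by (simp add: field_simps)
      qed
      finally have "ennreal (norm (iexp (Re (U n \<omega>)) - iexp (Re (V \<omega>))))
        \<le> ennreal (e + 1 / e * ?x\<^sup>2)"
        by (rule ennreal_leI)
      then show "ennreal (norm (iexp (Re (U n \<omega>)) - iexp (Re (V \<omega>))))
        \<le> ennreal e + ennreal (1 / e) * ennreal (?x\<^sup>2)"
        using e by (simp add: ennreal_mult[symmetric] ennreal_plus[symmetric] del: ennreal_plus)
    qed
    also have "\<dots> = ennreal e + ennreal (1 / e) * J n"
      unfolding J_def by (subst nn_integral_add) (auto simp: nn_integral_cmult emeasure_space_1)
    also have "\<dots> \<le> ennreal e + ennreal (1 / e) * ennreal (e\<^sup>2)"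
      using n0[OF that] by (intro add_left_mono mult_left_mono) auto
    also have "\<dots> = ennreal (2 * e)"
      using e by (simp add: ennreal_mult[symmetric] ennreal_plus[symmetric]
        power2_eq_square del: ennreal_plus)
    finally have "norm ?A \<le> 2 * e" using e by (simp add: ennreal_le_iff)
    then show ?thesis using r by (simp add: e_def)
  qed
  then show "\<exists>n0. \<forall>n\<ge>n0. norm ((\<integral>\<omega>. iexp (Re (U n \<omega>)) \<partial>M) - (\<integral>\<omega>. iexp (Re (V \<omega>)) \<partial>M)) < r" by blast
qed

text \<open>Computed as the value at \<open>c * \<sigma>\<close> of the standard normal
  characteristic function, so that \<open>c = 0\<close> is included, where the scaled variable has
  no density.\<close>

lemma (in prob_space) char_normal_scaled:
  assumes X: "distributed M lborel X (normal_density 0 \<sigma>)" and s: "\<sigma> > 0"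
  shows "char (distr M borel (\<lambda>\<omega>. c * X \<omega>)) 1 = exp (- of_real (c\<^sup>2 * \<sigma>\<^sup>2) / 2)"
proof -
  have Xm[measurable]: "X \<in> borel_measurable M" using distributed_measurable[OF X] by simp
  have "distributed M lborel (\<lambda>x. (X x - 0) / \<sigma>) std_normal_density"
    using X normal_standard_normal_convert[OF s, of X 0] by simp
  then have d: "distr M lborel (\<lambda>x. X x / \<sigma>) = std_normal_distribution"
    by (simp add: distributed_def)
  have "char (distr M borel (\<lambda>\<omega>. c * X \<omega>)) 1 = (\<integral>\<omega>. iexp (c * X \<omega>) \<partial>M)"
    unfolding char_def by (subst integral_distr) auto
  also have "\<dots> = (\<integral>\<omega>. iexp ((c * \<sigma>) * (X \<omega> / \<sigma>)) \<partial>M)" using s by simp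
  also have "\<dots> = (\<integral>x. iexp ((c * \<sigma>) * x) \<partial>distr M lborel (\<lambda>x. X x / \<sigma>))"
    by (subst integral_distr) auto
  also have "\<dots> = char std_normal_distribution (c * \<sigma>)" unfolding d char_def ..
  also have "\<dots> = exp (- of_real (c\<^sup>2 * \<sigma>\<^sup>2) / 2)"
    unfolding char_std_normal_distribution by (simp add: power_mult_distrib exp_of_real[symmetric])
  finally show ?thesis .
qed

text \<open>Both Brownian motions share the index set \<open>bool \<times> nat\<close>, so the
  independence of the components and of the increments is used in one product.\<close>

lemma brownian_increment_char:
  fixes c :: "bool \<times> nat \<Rightarrow> real" and n :: nat
  assumes BM: "std_BM2 P B1 B2"
  defines "\<Delta> \<equiv> (\<lambda>(j, k) \<omega>. (if j then B1 else B2) (grid_point n (Suc k))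
    \<omega> - (if j then B1 else B2) (grid_point n k) \<omega>)"
  shows "(\<integral>\<omega>. iexp (\<Sum>x\<in>UNIV \<times> {..<K}. c x * \<Delta> x \<omega>) \<partial>P)
    = exp (- of_real ((\<Sum>x\<in>UNIV \<times> {..<K}. (c x)\<^sup>2) / real (Suc n)) / 2)"
proof -
  interpret prob_space P using BM by (simp add: std_BM2_def)
  \<comment> \<open>The independence clause of \<open>std_BM2\<close> speaks of infinite increasing
    time sequences; the grid points form one.\<close>
  have sm: "strict_mono (grid_point n)" unfolding grid_point_def strict_mono_def
    by (auto simp: divide_strict_right_mono)
  have "indep_vars (\<lambda>_. borel) \<Delta> UNIV"
    using BM sm unfolding std_BM2_def \<Delta>_def by (auto simp: grid_point_def)
  then have "indep_vars (\<lambda>_. borel) \<Delta> (UNIV \<times> {..<K})"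
    by (rule indep_vars_subset) simp
  then have ind: "indep_vars (\<lambda>_. borel) (\<lambda>x \<omega>. c x * \<Delta> x \<omega>) (UNIV \<times> {..<K})"
    by (rule indep_vars_compose2[where Y = "\<lambda>x y. c x * y"]) simp
  have mB: "B1 t \<in> borel_measurable P" "B2 t \<in> borel_measurable P" for t using BM
    by (auto simp: std_BM2_def)
  have D: "distributed P lborel (\<lambda>\<omega>. B1 t \<omega> - B1 s \<omega>) (normal_density 0 (sqrt (t - s)))"
    "distributed P lborel (\<lambda>\<omega>. B2 t \<omega> - B2 s \<omega>) (normal_density 0 (sqrt (t - s)))"
      if "0 \<le> s" "s < t" for s t
    using BM that unfolding std_BM2_def by blast+
  have m\<Delta>[measurable]: "\<Delta> x \<in> borel_measurable P" for x
    by (cases x) (auto simp: \<Delta>_def intro!: borel_measurable_diff mB)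
  have nd: "distributed P lborel (\<Delta> x) (normal_density 0 (sqrt (1 / real (Suc n))))" for x
  proof -
    obtain j k where x: "x = (j, k)" by (cases x)
    have "0 \<le> grid_point n k" by (simp add: grid_point_def)
    moreover have "grid_point n k < grid_point n (Suc k)" by (rule strict_monoD[OF sm]) simp
    moreover have "grid_point n (Suc k) - grid_point n k = 1 / real (Suc n)"
      by (simp add: grid_point_def diff_divide_distrib[symmetric])
    ultimately show ?thesis using D[of "grid_point n k" "grid_point n (Suc k)"] unfolding x \<Delta>_def
      by (cases j) auto
  qed
  have "(\<integral>\<omega>. iexp (\<Sum>x\<in>UNIV \<times> {..<K}. c x * \<Delta> x \<omega>) \<partial>P)
    = char (distr P borel (\<lambda>\<omega>. \<Sum>x\<in>UNIV \<times> {..<K}. c x * \<Delta> x \<omega>)) 1"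
    unfolding char_def by (subst integral_distr) auto
  also have "\<dots> = (\<Prod>x\<in>UNIV \<times> {..<K}. char (distr P borel (\<lambda>\<omega>. c x * \<Delta> x \<omega>)) 1)"
    by (rule char_distr_sum[OF ind])
  also have "\<dots> = (\<Prod>x\<in>UNIV \<times> {..<K}. exp (- complex_of_real ((c x)\<^sup>2 * (sqrt (1 / real (Suc n)))\<^sup>2)
    / 2))"
    by (intro prod.cong refl char_normal_scaled[OF nd]) simp
  also have "\<dots> = exp (\<Sum>x\<in>UNIV \<times> {..<K}. - complex_of_real ((c x)\<^sup>2 * (sqrt (1 / real (Suc n)))\<^sup>2)
    / 2)"
    by (rule exp_sum[symmetric]) simp
  also have "(\<Sum>x\<in>UNIV \<times> {..<K}. - complex_of_real ((c x)\<^sup>2 * (sqrt (1 / real (Suc n)))\<^sup>2) / 2)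
    = - of_real ((\<Sum>x\<in>UNIV \<times> {..<K}. (c x)\<^sup>2) / real (Suc n)) / 2"
    by (simp add: sum_negf sum_divide_distrib)
  finally show ?thesis .
qed

lemma wiener_integral_L2_tendsto:
  assumes W: "wiener_integral P B (I_kernel \<alpha> z) W" and B: "\<And>t. B t \<in> borel_measurable P"
    and a: "\<alpha> > -1/2" and z: "c \<le> Re z" "0 < c"
  shows "L2_tendsto P (\<lambda>n. step_int B (grid_list n (I_kernel \<alpha> z))) W"
proof -
  have [measurable]: "W \<in> borel_measurable P" using W by (simp add: wiener_integral_def)
  have m: "step_int B (grid_list n (I_kernel \<alpha> z)) \<in> borel_measurable P" for n
    unfolding step_int_grid[abs_def] using B by measurable
  have g0: "\<forall>n. \<forall>(c, a, b) \<in> set (grid_list n (I_kernel \<alpha> z)). 0 \<le> a \<and> a \<le> b"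
    by (auto simp: grid_list_def grid_point_def divide_right_mono)
  have "(\<lambda>n. \<integral>\<^sup>+ y. ennreal ((cmod (I_kernel \<alpha> z y - step_fun (grid_list n (I_kernel \<alpha> z)) y))\<^sup>2)
    * indicator {0..} y \<partial>lborel) \<longlonglongrightarrow> 0"
  proof (rule grid_L2_approximation[OF continuous_I_kernel _ integrable_kernel_dominator[OF a
    z(2)]])
    fix y y' :: real assume y: "0 < y" "y \<le> y'" "y' \<le> y + 1"
    show "(cmod (I_kernel \<alpha> z y'))\<^sup>2 \<le> kernel_dominator \<alpha> c y"
      using kernel_bound_le_dominator[of "I_kernel \<alpha> z" 1 \<alpha> c y y', OF _ z(2) y]
        norm_I_kernel[OF _ z(1)] by simp
  qed
  with g0 have "(\<lambda>n. \<integral>\<^sup>+ \<omega>. ennreal ((cmod (W \<omega> - step_int B (grid_list n (I_kernel \<alpha> z)) \<omega>))\<^sup>2) \<partial>P)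
    \<longlonglongrightarrow> 0"
    by (intro W[unfolded wiener_integral_def, THEN conjunct2, THEN conjunct2, THEN spec, THEN mp]
      conjI)
  then show ?thesis using m unfolding L2_tendsto_def by simp
qed

text \<open>All the Wiener integrals are approximated on the same grid, so a combination of them is
  approximated by a single step integral of \<open>h\<close>. Its Gaussian characteristic function
  is explicit, and its variance is a Riemann sum; joint laws need no separate treatment.\<close>

lemma wiener_combination_char:
  fixes m :: nat and l z :: "nat \<Rightarrow> complex"
  assumes BM: "std_BM2 P B1 B2" and a: "\<alpha> > -1/2" and c: "0 < c"
    and z: "\<And>j. j < m \<Longrightarrow> c \<le> Re (z j)"
    and W1: "\<And>j. j < m \<Longrightarrow> wiener_integral P B1 (I_kernel \<alpha> (z j)) (W1 j)"
    and W2: "\<And>j. j < m \<Longrightarrow> wiener_integral P B2 (I_kernel \<alpha> (z j)) (W2 j)"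
  defines "h \<equiv> (\<lambda>y. \<Sum>j<m. l j * I_kernel \<alpha> (z j) y)"
  shows "(\<integral>\<omega>. iexp (Re (\<Sum>j<m. l j * (a1 * W1 j \<omega> + a2 * W2 j \<omega>))) \<partial>P)
    = exp (- of_real (\<integral>y. indicator {0<..} y * ((Re (a1 * h y))\<^sup>2 + (Re (a2 * h y))\<^sup>2) \<partial>lborel) / 2)"
proof -
  interpret prob_space P using BM by (simp add: std_BM2_def)
  have mB: "B1 t \<in> borel_measurable P" "B2 t \<in> borel_measurable P" for t using BM
    by (auto simp: std_BM2_def)
  define U where "U = (\<lambda>n \<omega>. \<Sum>j<m. l j * (a1 * step_int B1 (grid_list n (I_kernel \<alpha> (z j)))
    \<omega> + a2 * step_int B2 (grid_list n (I_kernel \<alpha> (z j))) \<omega>))"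
  define q where "q = (\<lambda>w. (Re (a1 * w))\<^sup>2 + (Re (a2 * w))\<^sup>2)"
  have L2: "L2_tendsto P U (\<lambda>\<omega>. \<Sum>j<m. l j * (a1 * W1 j \<omega> + a2 * W2 j \<omega>))"
    unfolding U_def
    by (intro L2_tendsto_sum L2_tendsto_scale L2_tendsto_add wiener_integral_L2_tendsto[OF _ _ a z
      c] W1 W2 mB)
  have U: "U n \<omega> = (\<Sum>k<(Suc n)\<^sup>2. a1 * h (grid_point n (Suc k))
    * of_real (B1 (grid_point n (Suc k)) \<omega> - B1 (grid_point n k) \<omega>)
      + a2 * h (grid_point n (Suc k)) * of_real (B2 (grid_point n (Suc k)) \<omega> - B2 (grid_point n k)
        \<omega>))" for n \<omega>
  proof -
    have "U n \<omega> = (\<Sum>j<m. \<Sum>k<(Suc n)\<^sup>2. l j * (a1 * (I_kernel \<alpha> (z j) (grid_point n (Suc k))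
      * of_real (B1 (grid_point n (Suc k)) \<omega> - B1 (grid_point n k) \<omega>))
      + a2 * (I_kernel \<alpha> (z j) (grid_point n (Suc k)) * of_real (B2 (grid_point n (Suc k))
        \<omega> - B2 (grid_point n k) \<omega>))))"
      unfolding U_def step_int_grid by (simp only: sum_distrib_left sum.distrib[symmetric])
    also have "\<dots> = (\<Sum>k<(Suc n)\<^sup>2. \<Sum>j<m. l j * (a1 * (I_kernel \<alpha> (z j) (grid_point n (Suc k))
      * of_real (B1 (grid_point n (Suc k)) \<omega> - B1 (grid_point n k) \<omega>))
      + a2 * (I_kernel \<alpha> (z j) (grid_point n (Suc k)) * of_real (B2 (grid_point n (Suc k))
        \<omega> - B2 (grid_point n k) \<omega>))))"
      by (rule sum.swap)
    also have "\<dots> = (\<Sum>k<(Suc n)\<^sup>2. a1 * h (grid_point n (Suc k))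
      * of_real (B1 (grid_point n (Suc k)) \<omega> - B1 (grid_point n k) \<omega>)
      + a2 * h (grid_point n (Suc k)) * of_real (B2 (grid_point n (Suc k)) \<omega> - B2 (grid_point n k)
        \<omega>))"
      unfolding h_def sum_distrib_left sum_distrib_right sum.distrib[symmetric]
      by (intro sum.cong refl) (simp add: algebra_simps)
    finally show ?thesis .
  qed
  have charU: "(\<integral>\<omega>. iexp (Re (U n \<omega>)) \<partial>P)
    = exp (- of_real ((\<Sum>k<(Suc n)\<^sup>2. q (h (grid_point n (Suc k)))) / real (Suc n)) / 2)" for n
  proof -
    \<comment> \<open>The increments are real, so only the real parts of \<open>a1 * h\<close> and
      \<open>a2 * h\<close> enter.\<close>
    define cc where "cc = (\<lambda>(j, k). Re ((if j then a1 else a2) * h (grid_point n (Suc k))))"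
    have split: "(\<Sum>x\<in>UNIV \<times> {..<K}. f x) = (\<Sum>k<K. f (True, k) + f (False, k))"
      for f :: "bool \<times> nat \<Rightarrow> real" and K
    proof -
      have "(\<Sum>x\<in>UNIV \<times> {..<K}. f x) = (\<Sum>j\<in>UNIV. \<Sum>k<K. f (j, k))"
        by (simp add: sum.cartesian_product)
      then show ?thesis by (simp add: UNIV_bool sum.distrib)
    qed
    have "Re (U n \<omega>) = (\<Sum>x\<in>UNIV \<times> {..<(Suc n)\<^sup>2}. cc x * 
        (case x of (j, k) \<Rightarrow> (\<lambda>\<omega>. (if j then B1 else B2) (grid_point n (Suc k))
          \<omega> - (if j then B1 else B2) (grid_point n k) \<omega>)) \<omega>)" for \<omega>
      unfolding U split Re_sum by (intro sum.cong refl) (simp add: cc_def algebra_simps)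
    then have "(\<integral>\<omega>. iexp (Re (U n \<omega>)) \<partial>P)
      = exp (- of_real ((\<Sum>x\<in>UNIV \<times> {..<(Suc n)\<^sup>2}. (cc x)\<^sup>2) / real (Suc n)) / 2)"
      using brownian_increment_char[OF BM, of cc n "(Suc n)\<^sup>2"] by simp
    moreover have "(\<Sum>x\<in>UNIV \<times> {..<(Suc n)\<^sup>2}. (cc x)\<^sup>2) = (\<Sum>k<(Suc n)\<^sup>2. q (h (grid_point n (Suc k))))"
      unfolding split by (simp add: cc_def q_def)
    ultimately show ?thesis by simp
  qed
  define L where "L = (\<Sum>j<m. cmod (l j))"
  have hb: "cmod (h y) \<le> L * (y powr \<alpha> * exp (- c * y))" if "0 < y" for y
    unfolding h_def L_def sum_distrib_right
  proof (rule sum_norm_le)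
    fix j assume "j \<in> {..<m}"
    then show "cmod (l j * I_kernel \<alpha> (z j) y) \<le> cmod (l j) * (y powr \<alpha> * exp (- c * y))"
      unfolding norm_mult by (intro mult_left_mono norm_I_kernel that z) auto
  qed
  have "(\<lambda>n. (\<Sum>k<(Suc n)\<^sup>2. q (h (grid_point n (Suc k)))) / real (Suc n))
    \<longlonglongrightarrow> (\<integral>y. indicator {0<..} y * q (h y) \<partial>lborel)"
  proof (rule grid_quadratic_sum[where D = "\<lambda>y. L\<^sup>2 * kernel_dominator \<alpha> c y"
    and E = "(cmod a1)\<^sup>2 + (cmod a2)\<^sup>2"])
    show "continuous_on {0<..} h" unfolding h_def by (intro continuous_intros continuous_I_kernel)
    show "(cmod (h y'))\<^sup>2 \<le> L\<^sup>2 * kernel_dominator \<alpha> c y" if "0 < y" "y \<le> y'" "y' \<le> y + 1" for y y'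
      by (rule kernel_bound_le_dominator[OF hb c that])
    show "integrable lborel (\<lambda>y. L\<^sup>2 * kernel_dominator \<alpha> c y)"
      using integrable_kernel_dominator[OF a c] by simp
    show "continuous_on UNIV q" unfolding q_def by (intro continuous_intros)
    show "\<bar>q w\<bar> \<le> ((cmod a1)\<^sup>2 + (cmod a2)\<^sup>2) * (cmod w)\<^sup>2" for w
    proof -
      have "(Re (b * w))\<^sup>2 \<le> (cmod b)\<^sup>2 * (cmod w)\<^sup>2" for b
        using abs_Re_le_cmod[of "b * w"]
          by (simp add: norm_mult abs_le_square_iff[symmetric] power_mult_distrib[symmetric])
      from this[of a1] this[of a2] show ?thesis by (simp add: q_def distrib_right)
    qed
  qed (simp add: q_def)
  then have "(\<lambda>n. \<integral>\<omega>. iexp (Re (U n \<omega>)) \<partial>P)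
    \<longlonglongrightarrow> exp (- of_real (\<integral>y. indicator {0<..} y * q (h y) \<partial>lborel) / 2)"
    unfolding charU by (intro tendsto_intros) auto
  from LIMSEQ_unique[OF L2_tendsto_char[OF L2] this] show ?thesis unfolding q_def .
qed

section \<open>Convergence of the coefficients\<close>

abbreviation exp_kernel :: "real \<Rightarrow> complex \<Rightarrow> complex" where
  "exp_kernel y \<equiv> (\<lambda>z. exp (- z * of_real y))"

lemma exp_kernel_holomorphic: "exp_kernel y holomorphic_on H0"
  by (intro holomorphic_intros)

lemma norm_exp_diff_le:
  assumes "Re a \<le> 0" "Re b \<le> 0" shows "cmod (exp a - exp b) \<le> cmod (a - b)"
proof -
  have "cmod (exp a - exp b) \<le> 1 * cmod (a - b)"
  proof (rule field_differentiable_bound[where S = "{z. Re z \<le> 0}" and f' = exp])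
    show "convex {z. Re z \<le> 0}" by (rule convex_halfspace_Re_le)
    show "(exp has_field_derivative exp z) (at z within {z. Re z \<le> 0})" for z
      by (rule has_field_derivative_at_within[OF DERIV_exp])
  qed (use assms in auto)
  then show ?thesis by simp
qed

text \<open>Lipschitz by Cauchy's estimate on the circle of radius 1/2, where \<open>cayley\<close>
  has modulus at most 3 and \<open>exp\<close> is 1-Lipschitz on the left half-plane.\<close>

lemma coef_exp_kernel_continuous: "continuous_on {0..} (\<lambda>y. coef (exp_kernel y) k)"
proof (rule lipschitz_on_continuous_on[where L = "3 / (1/2)^k"], rule lipschitz_onI)
  fix y y' :: real assume y: "y \<in> {0..}" "y' \<in> {0..}"
  have "cmod (coef (\<lambda>z. exp_kernel y z - exp_kernel y' z) k) \<le> (3 * \<bar>y - y'\<bar>) / (1/2)^k"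
  proof (rule norm_coef_le)
    show "(\<lambda>z. exp_kernel y z - exp_kernel y' z) holomorphic_on H0" by (intro holomorphic_intros)
    fix w :: complex assume w: "cmod w = 1/2"
    have H: "0 < Re (cayley w)" using cayley_in_H0[of w] w by (simp add: H0_def)
    have "cmod (1 + w) \<le> 3/2" using norm_triangle_ineq[of 1 w] w by simp
    moreover have "1/2 \<le> cmod (1 - w)" using norm_triangle_ineq2[of 1 w] w by simp
    ultimately have "cmod (cayley w) \<le> (3/2) / (1/2)" unfolding cayley_def norm_divide
      by (intro frac_le) auto
    then have c3: "cmod (cayley w) \<le> 3" by simp
    have "cmod (exp_kernel y (cayley w) - exp_kernel y' (cayley w))
      \<le> cmod (- cayley w * of_real y - (- cayley w * of_real y'))"
      using H y by (intro norm_exp_diff_le) auto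
    also have "\<dots> = cmod (cayley w) * \<bar>y - y'\<bar>"
    proof -
      have "- cayley w * of_real y - (- cayley w * of_real y') = cayley w * of_real (y' - y)"
        by (simp add: algebra_simps)
      then show ?thesis by (simp only: norm_mult norm_of_real abs_minus_commute)
    qed
    also have "\<dots> \<le> 3 * \<bar>y - y'\<bar>" using c3 by (intro mult_right_mono) auto
    finally show "cmod (exp_kernel y (cayley w) - exp_kernel y' (cayley w)) \<le> 3 * \<bar>y - y'\<bar>" .
  qed auto
  then show "dist (coef (exp_kernel y) k) (coef (exp_kernel y') k) \<le> 3 / (1/2)^k * dist y y'"
    unfolding coef_diff[OF exp_kernel_holomorphic exp_kernel_holomorphic] dist_norm
      by (simp add: mult.commute)
qed simp

text \<open>Expanding a combination of coefficients of the Dirichlet series, this function at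
  \<open>s * ln n\<close> multiplies the \<open>n\<close>-th random pair; it is also the integrand
  of the limiting variance.\<close>

definition coef_comb :: "nat \<Rightarrow> (nat \<Rightarrow> complex) \<Rightarrow> real \<Rightarrow> complex" where
  "coef_comb K t y = (\<Sum>k<K. t k * coef (exp_kernel y) k)"

lemma coef_comb_continuous: "continuous_on {0..} (coef_comb K t)"
  unfolding coef_comb_def by (intro continuous_intros coef_exp_kernel_continuous)

abbreviation limit_variance :: "real \<Rightarrow> (complex \<Rightarrow> real) \<Rightarrow> nat \<Rightarrow>
    (nat \<Rightarrow> complex) \<Rightarrow> real" where
  "limit_variance \<alpha> q K t \<equiv>
    \<integral>y. indicator {0<..} y * (y powr (2 * \<alpha>) * q (coef_comb K t y)) \<partial>lborel"

lemma norm_coef_comb: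
  assumes "0 \<le> y"
  shows "cmod (coef_comb K t y) \<le> (\<Sum>k<K. cmod (t k)) * exp 1 * exp (- y / (2 * real K + 3))"
  unfolding coef_comb_def sum_distrib_right
proof (rule sum_norm_le)
  fix k assume k: "k \<in> {..<K}"
  have "cmod (coef (exp_kernel y) k) \<le> exp 1 * exp (- y / (2 * real k + 3))"
    by (rule norm_coef_exp[OF assms])
  also have "\<dots> \<le> exp 1 * exp (- y / (2 * real K + 3))"
    using k assms by (intro mult_left_mono) (auto intro!: divide_left_mono)
  finally show "cmod (t k * coef (exp_kernel y) k)
    \<le> cmod (t k) * exp 1 * exp (- y / (2 * real K + 3))"
    unfolding norm_mult mult.assoc by (rule mult_left_mono) simp
qed

lemma norm_coef_comb_square:
  assumes "0 \<le> y"
  shows "(cmod (coef_comb K t y))\<^sup>2 \<le> ((\<Sum>k<K. cmod (t k)) * exp 1)\<^sup>2 * exp (- (2 / (2 * real K + 3))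
    * y)"
proof -
  have "(cmod (coef_comb K t y))\<^sup>2 \<le> ((\<Sum>k<K. cmod (t k)) * exp 1 * exp (- y / (2 * real K + 3)))\<^sup>2"
    by (intro power_mono norm_coef_comb assms) simp
  also have "\<dots> = ((\<Sum>k<K. cmod (t k)) * exp 1)\<^sup>2 * exp (- (2 / (2 * real K + 3)) * y)"
    by (simp add: power_mult_distrib exp_double[symmetric])
  finally show ?thesis .
qed

text \<open>For each \<open>m\<close> the discrete averages involve finitely many evaluations, so
  \<open>wiener_combination_char\<close> applies to them. Then \<open>m\<close> tends to infinity on
  both sides: bounded convergence in \<open>\<omega>\<close>, and dominated convergence in
  \<open>y\<close> for the variance.\<close>

lemma gaussian_coef_char:
  fixes Y :: "'b \<Rightarrow> complex \<Rightarrow> complex"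
  assumes BM: "std_BM2 P B1 B2" and a: "\<alpha> > -1/2"
    and Y: "\<And>\<omega>. \<omega> \<in> space P \<Longrightarrow> Y \<omega> holomorphic_on H0"
      and Ym: "\<And>z. z \<in> H0 \<Longrightarrow> (\<lambda>\<omega>. Y \<omega> z) \<in> borel_measurable P"
    and YW: "\<And>z. z \<in> H0 \<Longrightarrow> \<exists>W1 W2. wiener_integral P B1 (I_kernel \<alpha> z)
      W1 \<and> wiener_integral P B2 (I_kernel \<alpha> z) W2 \<and>
       (AE \<omega> in P. Y \<omega> z = a1 * W1 \<omega> + a2 * W2 \<omega>)"
  shows "(\<integral>\<omega>. iexp (Re (\<Sum>k<K. t k * coef (Y \<omega>) k)) \<partial>P)
    = exp (- of_real (\<integral>y. indicator {0<..} y * (y powr (2 * \<alpha>)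
      * ((Re (a1 * coef_comb K t y))\<^sup>2 + (Re (a2 * coef_comb K t y))\<^sup>2)) \<partial>lborel) / 2)"
proof -
  interpret prob_space P using BM by (simp add: std_BM2_def)
  define q where "q = (\<lambda>w. (Re (a1 * w))\<^sup>2 + (Re (a2 * w))\<^sup>2)"
  define V where "V = (\<lambda>m f. \<Sum>k<K. t k * circle_avg (1/2) m k f)"
  define z where "z = (\<lambda>m j. cayley (of_real (1/2) * cis (2 * pi * real j / real m)))"
  define l where "l = (\<lambda>m j. \<Sum>k<K. t k * (cis (- 2 * pi * real j * real k / real m)
    / (of_nat m * of_real ((1/2) ^ k))))"
  \<comment> \<open>\<open>1/3 = (1 - 1/2) / (1 + 1/2)\<close>: all evaluation points, for every
    \<open>m\<close>, have real part at least 1/3, which gives one decay rate for all of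
    them.\<close>
  have zc: "1/3 \<le> Re (z m j)" for m j :: nat
    using Re_cayley[of "of_real (1/2) * cis (2 * pi * real j / real m)"]
      by (simp add: z_def norm_mult)
  have zH: "z m j \<in> H0" for m j :: nat using zc[of m j] unfolding H0_def by simp
  have Vf: "V m f = (\<Sum>j<m. l m j * f (z m j))" for m f
    unfolding V_def circle_avg_def sum_distrib_left l_def sum_distrib_right z_def
    by (subst sum.swap) (simp add: mult_ac)
  have charm: "(\<integral>\<omega>. iexp (Re (V m (Y \<omega>))) \<partial>P)
    = exp (- of_real (\<integral>y. indicator {0<..} y * (y powr (2 * \<alpha>) * q (V m (exp_kernel y))) \<partial>lborel)
    / 2)" for m
  proof -
    have "\<forall>j. \<exists>W1 W2. wiener_integral P B1 (I_kernel \<alpha> (z m j))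
      W1 \<and> wiener_integral P B2 (I_kernel \<alpha> (z m j)) W2 \<and>
       (AE \<omega> in P. Y \<omega> (z m j) = a1 * W1 \<omega> + a2 * W2 \<omega>)" using YW[OF zH] by blast
    then obtain W1 W2 where W: "\<And>j. wiener_integral P B1 (I_kernel \<alpha> (z m j)) (W1 j)"
      "\<And>j. wiener_integral P B2 (I_kernel \<alpha> (z m j)) (W2 j)" "\<And>j. AE \<omega> in P. Y \<omega> (z m j)
        = a1 * W1 j \<omega> + a2 * W2 j \<omega>"
      by metis
    have Wm[measurable]: "W1 j \<in> borel_measurable P" "W2 j \<in> borel_measurable P"
      "(\<lambda>\<omega>. Y \<omega> (z m j)) \<in> borel_measurable P" for j
      using W(1,2)[of j] Ym[OF zH] by (auto simp: wiener_integral_def)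
    have AEj: "AE \<omega> in P. \<forall>j. Y \<omega> (z m j) = a1 * W1 j \<omega> + a2 * W2 j \<omega>" using W(3)
      by (simp add: AE_all_countable)
    have "(\<integral>\<omega>. iexp (Re (V m (Y \<omega>))) \<partial>P) = (\<integral>\<omega>. iexp (Re (\<Sum>j<m. l m j * (a1 * W1 j \<omega> + a2 * W2 j
      \<omega>))) \<partial>P)"
    proof (rule integral_cong_AE)
      show "AE \<omega> in P. iexp (Re (V m (Y \<omega>)))
        = iexp (Re (\<Sum>j<m. l m j * (a1 * W1 j \<omega> + a2 * W2 j \<omega>)))"
        using AEj by eventually_elim (simp add: Vf)
      show "(\<lambda>\<omega>. iexp (Re (V m (Y \<omega>)))) \<in> borel_measurable P" unfolding Vf by measurable
    qed measurable
    also have "\<dots> = exp (- of_real (\<integral>y. indicator {0<..} y * ((Re (a1 * (\<Sum>j<m. l m j * I_kernel \<alpha>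
      (z m j) y)))\<^sup>2 
       + (Re (a2 * (\<Sum>j<m. l m j * I_kernel \<alpha> (z m j) y)))\<^sup>2) \<partial>lborel) / 2)"
      by (rule wiener_combination_char[OF BM a _ zc W(1,2)]) simp
    also have "(\<lambda>y. indicator {0<..} y * ((Re (a1 * (\<Sum>j<m. l m j * I_kernel \<alpha> (z m j)
      y)))\<^sup>2 + (Re (a2 * (\<Sum>j<m. l m j * I_kernel \<alpha> (z m j) y)))\<^sup>2))
      = (\<lambda>y. indicator {0<..} y * (y powr (2 * \<alpha>) * q (V m (exp_kernel y))))"
    proof
      fix y :: real
      have I: "(\<Sum>j<m. l m j * I_kernel \<alpha> (z m j) y) = of_real (y powr \<alpha>) * V m (exp_kernel y)"
        unfolding Vf I_kernel_def sum_distrib_left by (intro sum.cong refl) (simp add: mult_ac)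
      have R: "Re (b * (of_real (y powr \<alpha>) * V m (exp_kernel y)))
        = y powr \<alpha> * Re (b * V m (exp_kernel y))" for b
        by (simp add: algebra_simps)
      have "(y powr \<alpha>)\<^sup>2 = y powr (2 * \<alpha>)" if "0 < y" using that
        by (simp add: powr_power mult.commute)
      then show "indicator {0<..} y * ((Re (a1 * (\<Sum>j<m. l m j * I_kernel \<alpha> (z m j)
        y)))\<^sup>2 + (Re (a2 * (\<Sum>j<m. l m j * I_kernel \<alpha> (z m j) y)))\<^sup>2)
        = indicator {0<..} y * (y powr (2 * \<alpha>) * q (V m (exp_kernel y)))"
        unfolding I R q_def power_mult_distrib by (simp add: distrib_left split: split_indicator)
    qed
    finally show ?thesis .
  qed
  have lim1: "(\<lambda>m. \<integral>\<omega>. iexp (Re (V m (Y \<omega>))) \<partial>P) \<longlonglongrightarrow> (\<integral>\<omega>. iexp (Re (\<Sum>k<K. t k * coef (Y \<omega>) k)) \<partial>P)"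
  proof (rule integral_dominated_convergence[where w = "\<lambda>_. 1"])
    have [measurable]: "(\<lambda>\<omega>. coef (Y \<omega>) k) \<in> borel_measurable P" for k
      by (rule measurable_coef[OF Y Ym])
    show "(\<lambda>\<omega>. iexp (Re (\<Sum>k<K. t k * coef (Y \<omega>) k))) \<in> borel_measurable P" by measurable
    have [measurable]: "(\<lambda>\<omega>. Y \<omega> (z m j)) \<in> borel_measurable P" for m j by (rule Ym[OF zH])
    show "(\<lambda>\<omega>. iexp (Re (V m (Y \<omega>)))) \<in> borel_measurable P" for m unfolding Vf by measurable
    show "AE \<omega> in P. (\<lambda>m. iexp (Re (V m (Y \<omega>)))) \<longlonglongrightarrow> iexp (Re (\<Sum>k<K. t k * coef (Y \<omega>) k))"
    proof (rule AE_I2)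
      fix \<omega> assume "\<omega> \<in> space P"
      then show "(\<lambda>m. iexp (Re (V m (Y \<omega>)))) \<longlonglongrightarrow> iexp (Re (\<Sum>k<K. t k * coef (Y \<omega>) k))"
        unfolding V_def by (intro tendsto_intros circle_avg_tendsto Y) auto
    qed
  qed auto
  \<comment> \<open>\<open>2 ^ k\<close> is the loss in Cauchy's estimate at radius 1/2.\<close>
  define T where "T = (\<Sum>k<K. cmod (t k) * 2 ^ k)"
  have T0: "0 \<le> T" unfolding T_def by (intro sum_nonneg) auto
  have Vb: "cmod (V m (exp_kernel y)) \<le> T * exp (- (1/3) * y)" if "0 < y" for m y
    unfolding V_def T_def sum_distrib_right
  proof (rule sum_norm_le)
    fix k assume "k \<in> {..<K}"
    have "cmod (circle_avg (1/2) m k (exp_kernel y)) \<le> exp (- (1/3) * y) / (1/2) ^ k"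
    proof (rule norm_circle_avg_le)
      fix w :: complex assume w: "cmod w = 1/2"
      have "1/3 \<le> Re (cayley w)" using Re_cayley[of w] unfolding w by simp
      then have "1/3 * y \<le> Re (cayley w) * y" using that by (intro mult_right_mono) auto
      then show "cmod (exp_kernel y (cayley w)) \<le> exp (- (1/3) * y)" by simp
    qed auto
    then show "cmod (t k * circle_avg (1/2) m k (exp_kernel y))
      \<le> cmod (t k) * 2 ^ k * exp (- (1/3) * y)"
      unfolding norm_mult mult.assoc
        by (intro mult_left_mono) (auto simp: power_one_over field_simps)
  qed
  define E where "E = (cmod a1)\<^sup>2 + (cmod a2)\<^sup>2"
  have E0: "0 \<le> E" by (simp add: E_def)
  have qE: "\<bar>q w\<bar> \<le> E * (cmod w)\<^sup>2" for w
  proof -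
    have "(Re (b * w))\<^sup>2 \<le> (cmod b)\<^sup>2 * (cmod w)\<^sup>2" for b
      using abs_Re_le_cmod[of "b * w"]
        by (simp add: norm_mult abs_le_square_iff[symmetric] power_mult_distrib[symmetric])
    from this[of a1] this[of a2] show ?thesis by (simp add: q_def E_def distrib_right)
  qed
  have q_cont: "continuous_on UNIV q" unfolding q_def by (intro continuous_intros)
  have iq: "isCont q w" for w using q_cont by (simp add: continuous_on_eq_continuous_at)
  from q_cont have qm[measurable]: "q \<in> borel_measurable borel"
    by (rule borel_measurable_continuous_onI)
  have cc: "continuous_on {0<..} (coef_comb K t)"
    by (rule continuous_on_subset[OF coef_comb_continuous]) auto
  have "(\<lambda>m. \<integral>y. indicator {0<..} y * (y powr (2 * \<alpha>) * q (V m (exp_kernel y))) \<partial>lborel) \<longlonglongrightarrow>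
    (limit_variance \<alpha> q K t)"
  proof (rule integral_dominated_convergence[where w = "\<lambda>y. E * T\<^sup>2 * gamma_weight (2 * \<alpha>) (2/3) y"])
    have "(\<lambda>y. indicator {0<..} y *\<^sub>R (q (coef_comb K t y))) \<in> borel_measurable borel"
      by (intro continuous_indicator_measurable continuous_on_compose2[OF q_cont cc]) auto
    then have "(\<lambda>y. y powr (2 * \<alpha>) * (indicator {0<..} y *\<^sub>R (q (coef_comb K t y))))
      \<in> borel_measurable borel" by measurable
    then show "(\<lambda>y. indicator {0<..} y * (y powr (2 * \<alpha>) * q (coef_comb K t y)))
      \<in> borel_measurable lborel" by (simp add: mult_ac)
    show "(\<lambda>y. indicator {0<..} y * (y powr (2 * \<alpha>) * q (V m (exp_kernel y))))
      \<in> borel_measurable lborel" for m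
      unfolding Vf by measurable
    show "integrable lborel (\<lambda>y. E * T\<^sup>2 * gamma_weight (2 * \<alpha>) (2/3) y)"
      using integrable_gamma_weight[of "2 * \<alpha>" "2/3"] a by simp
    show "AE y in lborel. norm (indicator {0<..} y * (y powr (2 * \<alpha>) * q (V m (exp_kernel y))))
      \<le> E * T\<^sup>2 * gamma_weight (2 * \<alpha>) (2/3) y" for m
    proof (rule AE_I2)
      fix y :: real
      show "norm (indicator {0<..} y * (y powr (2 * \<alpha>) * q (V m (exp_kernel y))))
        \<le> E * T\<^sup>2 * gamma_weight (2 * \<alpha>) (2/3) y"
      proof (cases "0 < y")
        case True
        have "\<bar>q (V m (exp_kernel y))\<bar> \<le> E * (T * exp (- (1/3) * y))\<^sup>2"
          by (rule order_trans[OF qE]) (intro mult_left_mono power_mono Vb[OF True] E0, simp)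
        also have "\<dots> = E * T\<^sup>2 * exp (- (2/3) * y)"
          by (simp add: power_mult_distrib exp_double[symmetric])
        finally have "y powr (2 * \<alpha>) * \<bar>q (V m (exp_kernel y))\<bar>
          \<le> y powr (2 * \<alpha>) * (E * T\<^sup>2 * exp (- (2/3) * y))"
          by (intro mult_left_mono) auto
        then show ?thesis using True by (simp add: gamma_weight_def abs_mult mult_ac)
      qed (simp add: gamma_weight_def)
    qed
    show "AE y in lborel. (\<lambda>m. indicator {0<..} y * (y powr (2 * \<alpha>) * q (V m (exp_kernel y))))
      \<longlonglongrightarrow> indicator {0<..} y * (y powr (2 * \<alpha>) * q (coef_comb K t y))"
    proof (rule AE_I2)
      fix y :: real
      have "(\<lambda>m. V m (exp_kernel y)) \<longlonglongrightarrow> coef_comb K t y"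
        unfolding V_def coef_comb_def
          by (intro tendsto_intros circle_avg_tendsto exp_kernel_holomorphic) auto
      then have "(\<lambda>m. q (V m (exp_kernel y))) \<longlonglongrightarrow> q (coef_comb K t y)"
        by (rule isCont_tendsto_compose[OF iq])
      then show "(\<lambda>m. indicator {0<..} y * (y powr (2 * \<alpha>) * q (V m (exp_kernel y))))
        \<longlonglongrightarrow> indicator {0<..} y * (y powr (2 * \<alpha>) * q (coef_comb K t y))"
        by (rule tendsto_mult_left[OF tendsto_mult_left])
    qed
  qed
  then have "(\<lambda>m. \<integral>\<omega>. iexp (Re (V m (Y \<omega>))) \<partial>P) \<longlonglongrightarrow>
    exp (- of_real (limit_variance \<alpha> q K t) / 2)"
    unfolding charm by (intro tendsto_intros) auto
  from LIMSEQ_unique[OF lim1 this] show ?thesis unfolding q_def .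
qed

section \<open>Characteristic functions and moments for the Dirichlet series\<close>

lemma bounded_ln_powr: "\<exists>B. \<forall>n. \<bar>ln (real n) powr \<alpha> * real n powr (- 1/2)\<bar> \<le> B"
proof -
  have "(\<lambda>n. ln (real n) powr \<alpha> * real n powr (- 1/2)) \<longlonglongrightarrow> 0" by real_asymp
  then have "Bseq (\<lambda>n. ln (real n) powr \<alpha> * real n powr (- 1/2))"
    by (intro convergent_imp_Bseq convergentI)
  then show ?thesis
  proof (rule BseqE)
    fix B assume "\<forall>n. norm (ln (real n) powr \<alpha> * real n powr (- 1/2)) \<le> B"
    then show ?thesis unfolding real_norm_def by (rule exI)
  qed
qed

context iid_pairs
begin

text \<open>The second moment of the real part of \<open>w * (eta + i * theta)\<close>.\<close>

definition complex_qform :: "complex \<Rightarrow> real" where "complex_qform w = qform (Re w) (- Im w)"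

lemma complex_qform_abs_le: "\<bar>complex_qform w\<bar> \<le> total_variance * (cmod w)\<^sup>2"
  using qform_nonneg[of "Re w" "- Im w"] qform_le[of "Re w" "- Im w"]
    by (simp add: complex_qform_def cmod_power2 mult.commute)

lemma complex_qform_continuous: "continuous_on UNIV complex_qform"
  unfolding complex_qform_def qform_def by (intro continuous_intros)

lemma complex_qform_scale: "qform (Re (of_real c * w)) (- Im (of_real c * w))
  = c\<^sup>2 * complex_qform w"
  by (simp add: complex_qform_def qform_def power2_eq_square algebra_simps)

text \<open>The central limit bound for partial sums is uniform in \<open>N\<close> and passes to
  the full series. As \<open>s\<close> tends to 0 the largest weight vanishes while the total
  squared weight stays bounded, and the variance \<open>G m\<close> is a Riemann sum on the
  logarithmic scale.\<close>

lemma rescaled_D_coef_char: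
  assumes a: "\<alpha> > -1/2" and s: "\<And>m. s m > 0" "s \<longlonglongrightarrow> 0"
  shows "(\<lambda>m. \<integral>\<omega>. iexp (Re (\<Sum>k<K. t k * coef (rescaled_D \<alpha> eta theta (s m) \<omega>) k)) \<partial>M)
    \<longlonglongrightarrow> exp (- of_real (limit_variance \<alpha> complex_qform K t) / 2)"
proof -
  define T where "T = (\<Sum>k<K. cmod (t k)) * exp 1"
  have T0: "0 \<le> T" unfolding T_def by (intro mult_nonneg_nonneg sum_nonneg) auto
  define c where "c = 2 / (2 * real K + 3)"
  have c: "c > 0" unfolding c_def by (intro divide_pos_pos) auto
  have Tb: "(cmod (coef_comb K t y))\<^sup>2 \<le> T\<^sup>2 * exp (- c * y)" if "0 \<le> y" for y
    using norm_coef_comb_square[OF that, of K t] by (simp add: T_def c_def)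
  interpret N: exp_decay \<alpha> "\<lambda>y. (cmod (coef_comb K t y))\<^sup>2" "T\<^sup>2" c
    by unfold_locales (use a c Tb in auto)
  interpret Q: exp_decay \<alpha> "\<lambda>y. complex_qform (coef_comb K t y)" "total_variance * T\<^sup>2" c
  proof
    show "\<bar>complex_qform (coef_comb K t y)\<bar> \<le> total_variance * T\<^sup>2 * exp (- c * y)" if "0 \<le> y" for y
      unfolding mult.assoc by (rule order_trans[OF complex_qform_abs_le mult_left_mono[OF Tb[OF
        that] total_variance_nonneg]])
  qed (use a c in auto)
  obtain B where B: "\<And>n. \<bar>ln (real n) powr \<alpha> * real n powr (- 1/2)\<bar> \<le> B"
    using bounded_ln_powr[of \<alpha>] by blast
  have B0: "0 \<le> B" using B[of 0] by linarith
  \<comment> \<open>A bound for all weights at once: the supremum of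
    \<open>(ln n) powr \<alpha> / sqrt n\<close>, times a bound for the kernel, times
    \<open>s powr (1/2 + \<alpha>)\<close>, which vanishes because
    \<open>\<alpha> > -1/2\<close>.\<close>
  define \<delta> where "\<delta> = (\<lambda>m. s m powr (1/2 + \<alpha>) * B * T)"
  have d0: "0 \<le> \<delta> m" for m unfolding \<delta>_def using B0 T0 by (intro mult_nonneg_nonneg) auto
  have dlim: "\<delta> \<longlonglongrightarrow> 0"
  proof -
    have "(\<lambda>m. s m powr (1/2 + \<alpha>)) \<longlonglongrightarrow> 0"
      using a by (intro tendsto_zero_powrI[OF s(2) tendsto_const]
        always_eventually allI less_imp_le[OF s(1)]) auto
    then have "\<delta> \<longlonglongrightarrow> 0 * B * T" unfolding \<delta>_def by (intro tendsto_intros)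
    then show ?thesis by simp
  qed
  define cf where "cf = (\<lambda>m n. of_real (dir_weight \<alpha> (s m) n) * coef_comb K t (s m * ln (real n)))"
  have cf2: "(Re (cf m n))\<^sup>2 + (- Im (cf m n))\<^sup>2
    = (dir_weight \<alpha> (s m) n)\<^sup>2 * (cmod (coef_comb K t (s m * ln (real n))))\<^sup>2" for m n
  proof -
    have "(Re (cf m n))\<^sup>2 + (- Im (cf m n))\<^sup>2 = (cmod (cf m n))\<^sup>2" by (simp add: cmod_power2)
    then show ?thesis by (simp add: cf_def norm_mult power_mult_distrib)
  qed
  have lnn: "0 \<le> s m * ln (real n)" for m n
    using s(1)[of m] by (cases "n = 0") auto
  have small: "(Re (cf m n))\<^sup>2 + (- Im (cf m n))\<^sup>2 \<le> (\<delta> m)\<^sup>2" for m n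
  proof -
    have "\<bar>dir_weight \<alpha> (s m) n\<bar> \<le> s m powr (1/2 + \<alpha>) * B"
      using B[of n] B0 by (auto simp: dir_weight_def abs_mult mult.assoc intro!: mult_left_mono)
    then have w: "(dir_weight \<alpha> (s m) n)\<^sup>2 \<le> (s m powr (1/2 + \<alpha>) * B)\<^sup>2"
      by (intro power2_le_iff_abs_le[THEN iffD2]) (use B0 in auto)
    have "exp (- c * (s m * ln (real n))) \<le> 1" using c lnn[of m n] by simp
    then have "T\<^sup>2 * exp (- c * (s m * ln (real n))) \<le> T\<^sup>2 * 1" by (intro mult_left_mono) auto
    then have "(cmod (coef_comb K t (s m * ln (real n))))\<^sup>2 \<le> T\<^sup>2" using Tb[OF lnn[of m n]]
      by linarith
    with w have "(dir_weight \<alpha> (s m) n)\<^sup>2 * (cmod (coef_comb K t (s m * ln (real n))))\<^sup>2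
      \<le> (s m powr (1/2 + \<alpha>) * B)\<^sup>2 * T\<^sup>2"
      by (intro mult_mono) auto
    then show ?thesis unfolding cf2 by (simp add: \<delta>_def power_mult_distrib)
  qed
  define Z where "Z = (\<lambda>m \<omega>. Re (\<Sum>k<K. t k * coef (rescaled_D \<alpha> eta theta (s m) \<omega>) k))"
  define S where "S = (\<lambda>m N \<omega>. \<Sum>n<N. lin_comb (Re (cf m n)) (- Im (cf m n)) n \<omega>)"
  define \<Phi> where "\<Phi> = (\<lambda>m. \<integral>\<omega>. iexp (Z m \<omega>) \<partial>M)"
  define G where "G = (\<lambda>m. \<Sum>n. (dir_weight \<alpha> (s m) n)\<^sup>2 * complex_qform (coef_comb K t (s m * ln
    (real n))))"
  have conv: "(\<lambda>N. S m N \<omega>) \<longlonglongrightarrow> Z m \<omega>" if ev: "convergent_event \<alpha> eta theta \<omega>" for m \<omega>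
  proof -
    have "(\<lambda>n. \<Sum>k<K. t k * (of_real (dir_weight \<alpha> (s m) n) * (of_real (eta n \<omega>)
      + \<i> * of_real (theta n \<omega>))
      * coef (exp_kernel (s m * ln (real n))) k)) sums (\<Sum>k<K. t k * coef (rescaled_D \<alpha> eta theta
        (s m) \<omega>) k)"
      by (intro sums_sum sums_mult coef_rescaled_D[OF ev s(1)])
    also have "(\<lambda>n. \<Sum>k<K. t k * (of_real (dir_weight \<alpha> (s m) n) * (of_real (eta n \<omega>)
      + \<i> * of_real (theta n \<omega>))
      * coef (exp_kernel (s m * ln (real n))) k)) = (\<lambda>n. cf m n * (of_real (eta n \<omega>)
        + \<i> * of_real (theta n \<omega>)))"
      unfolding cf_def coef_comb_def sum_distrib_left sum_distrib_right
        by (intro ext sum.cong refl) (simp add: mult_ac)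
    finally have "(\<lambda>n. Re (cf m n * (of_real (eta n \<omega>) + \<i> * of_real (theta n \<omega>)))) sums Z m \<omega>"
      unfolding Z_def by (rule sums_Re)
    moreover have "Re (cf m n * (of_real (eta n \<omega>) + \<i> * of_real (theta n \<omega>)))
      = lin_comb (Re (cf m n)) (- Im (cf m n)) n \<omega>" for n
      by (simp add: lin_comb_def algebra_simps)
    ultimately show ?thesis by (simp add: S_def sums_def)
  qed
  have Dm[measurable]: "(\<lambda>\<omega>. coef (rescaled_D \<alpha> eta theta (s m) \<omega>) k) \<in> borel_measurable M" for m k
    by (rule measurable_coef[OF rescaled_D_holomorphic[OF s(1)]
      measurable_rescaled_D[OF meas s(1)]])
  \<comment> \<open>The partial sums converge almost surely, and bounded convergence applies to
    \<open>iexp\<close>.\<close>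
  have limN: "(\<lambda>N. \<integral>\<omega>. iexp (S m N \<omega>) \<partial>M) \<longlonglongrightarrow> \<Phi> m" for m
    unfolding \<Phi>_def
  proof (rule integral_dominated_convergence[where w = "\<lambda>_. 1"])
    show "(\<lambda>\<omega>. iexp (Z m \<omega>)) \<in> borel_measurable M" unfolding Z_def by measurable
    show "(\<lambda>\<omega>. iexp (S m N \<omega>)) \<in> borel_measurable M" for N unfolding S_def by measurable
    show "AE \<omega> in M. (\<lambda>N. iexp (S m N \<omega>)) \<longlonglongrightarrow> iexp (Z m \<omega>)"
      using AE_convergent_event[of \<alpha>] by eventually_elim (intro tendsto_intros conv)
  qed auto
  have qsum: "(\<lambda>N. \<Sum>n<N. qform (Re (cf m n)) (- Im (cf m n))) \<longlonglongrightarrow> G m" for m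
    using summable_LIMSEQ[OF summable_rabs_cancel, of "\<lambda>n. (dir_weight \<alpha> (s m)
      n)\<^sup>2 * complex_qform (coef_comb K t (s m * ln (real n)))"] Q.weight_summable_abs[OF s(1), of m]
    unfolding cf_def complex_qform_scale G_def by (simp add: abs_mult)
  define I where "I = (\<integral>y. N.dominator y \<partial>lborel)"
  \<comment> \<open>Limit in \<open>N\<close> of \<open>weighted_clt_bound\<close>; \<open>I\<close>
    bounds the total squared weight for every \<open>m\<close>.\<close>
  have bound: "cmod (\<Phi> m - exp (- of_real (G m) / 2))
    \<le> (lindeberg (\<delta> m) + (\<delta> m)\<^sup>2 * total_variance\<^sup>2) * I" for m
  proof (rule LIMSEQ_le_const2)
    show "(\<lambda>N. cmod ((\<integral>\<omega>. iexp (S m N \<omega>) \<partial>M) - exp (- of_real (\<Sum>n<N. qform (Re (cf m n))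
      (- Im (cf m n))) / 2)))
       \<longlonglongrightarrow> cmod (\<Phi> m - exp (- of_real (G m) / 2))"
      by (intro tendsto_intros limN qsum) auto
    have L0: "0 \<le> lindeberg (\<delta> m)"
      unfolding lindeberg_def by (intro Bochner_Integration.integral_nonneg)
        (auto simp: pair_norm_nonneg d0)
    have "cmod ((\<integral>\<omega>. iexp (S m N \<omega>) \<partial>M) - exp (- of_real (\<Sum>n<N. qform (Re (cf m n))
      (- Im (cf m n))) / 2))
      \<le> (lindeberg (\<delta> m) + (\<delta> m)\<^sup>2 * total_variance\<^sup>2) * I" for N
    proof -
      have "(\<Sum>n<N. (Re (cf m n))\<^sup>2 + (- Im (cf m n))\<^sup>2) \<le> I"
        unfolding cf2 I_def using N.weight_sum_abs_le[OF s(1), of m N] by simp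
      then have "(lindeberg (\<delta> m) + (\<delta> m)\<^sup>2 * total_variance\<^sup>2)
        * (\<Sum>n<N. (Re (cf m n))\<^sup>2 + (- Im (cf m n))\<^sup>2) \<le> (lindeberg (\<delta> m) + (\<delta> m)\<^sup>2 * total_variance\<^sup>2)
        * I"
        using L0 by (intro mult_left_mono) auto
      then show ?thesis using weighted_clt_bound[of "\<lambda>n. Re (cf m n)" "\<lambda>n. - Im (cf m n)",
        OF small d0, of N] unfolding S_def by linarith
    qed
    then show "\<exists>N0. \<forall>N\<ge>N0. cmod ((\<integral>\<omega>. iexp (S m N \<omega>) \<partial>M)
      - exp (- of_real (\<Sum>n<N. qform (Re (cf m n)) (- Im (cf m n))) / 2))
      \<le> (lindeberg (\<delta> m) + (\<delta> m)\<^sup>2 * total_variance\<^sup>2) * I" by blast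
  qed
  have "(\<lambda>m. (lindeberg (\<delta> m) + (\<delta> m)\<^sup>2 * total_variance\<^sup>2) * I) \<longlonglongrightarrow> (0 + 0\<^sup>2 * total_variance\<^sup>2) * I"
    by (intro tendsto_intros lindeberg_tendsto_0 dlim d0)
  then have nul: "(\<lambda>m. (lindeberg (\<delta> m) + (\<delta> m)\<^sup>2 * total_variance\<^sup>2) * I) \<longlonglongrightarrow> 0" by simp
  have "(\<lambda>m. \<Phi> m - exp (- of_real (G m) / 2)) \<longlonglongrightarrow> 0"
    by (rule Lim_null_comparison[OF always_eventually nul]) (intro allI bound)
  moreover have "G \<longlonglongrightarrow> limit_variance \<alpha> complex_qform K t"
    unfolding G_def
  proof (rule Q.log_riemann_sum[OF _ s])
    show "continuous_on {0<..} (\<lambda>y. complex_qform (coef_comb K t y))"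
      by (intro continuous_on_compose2[OF complex_qform_continuous continuous_on_subset[OF
        coef_comb_continuous]]) auto
  qed
  then have "(\<lambda>m. exp (- complex_of_real (G m) / 2))
    \<longlonglongrightarrow> exp (- of_real (limit_variance \<alpha> complex_qform K t) / 2)"
    by (intro tendsto_intros) auto
  ultimately have "(\<lambda>m. (\<Phi> m - exp (- of_real (G m) / 2)) + exp (- complex_of_real (G m) / 2))
    \<longlonglongrightarrow> 0 + exp (- of_real (limit_variance \<alpha> complex_qform K t) / 2)"
    by (rule tendsto_add)
  then show ?thesis by (simp add: \<Phi>_def Z_def)
qed

text \<open>Fatou's lemma along the partial sums, whose second moments are explicit. The bound is
  free of \<open>s\<close> and polynomial in \<open>k\<close>.\<close>

lemma rescaled_D_coef_moment:
  assumes a: "\<alpha> > -1/2" and s: "s > 0"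
  shows "(\<integral>\<^sup>+\<omega>. ennreal ((cmod (coef (rescaled_D \<alpha> eta theta s \<omega>) k))\<^sup>2) \<partial>M)
    \<le> ennreal (total_variance * (2 * weight_const \<alpha> * (exp 1)\<^sup>2 * (2 * real k + 3) powr (2 * \<alpha> + 1)
      * (\<integral>y. gamma_weight (2 * \<alpha>) 1 y \<partial>lborel)))"
proof -
  define c where "c = 2 / (2 * real k + 3)"
  have c: "c > 0" unfolding c_def by (intro divide_pos_pos) auto
  have kb: "(cmod (coef (exp_kernel y) k))\<^sup>2 \<le> (exp 1)\<^sup>2 * exp (- c * y)" if "0 \<le> y" for y
  proof -
    have "(cmod (coef (exp_kernel y) k))\<^sup>2 \<le> (exp 1 * exp (- y / (2 * real k + 3)))\<^sup>2"
      by (intro power_mono norm_coef_exp that) simp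
    also have "\<dots> = (exp 1)\<^sup>2 * exp (- c * y)"
      by (simp add: c_def power_mult_distrib exp_double[symmetric])
    finally show ?thesis .
  qed
  interpret N: exp_decay \<alpha> "\<lambda>y. (cmod (coef (exp_kernel y) k))\<^sup>2" "(exp 1)\<^sup>2" c
    by unfold_locales (use a c kb in auto)
  have I: "(\<integral>y. N.dominator y \<partial>lborel) = 2 * weight_const \<alpha> * (exp 1)\<^sup>2 * (2 * real k + 3)
    powr (2 * \<alpha> + 1) * (\<integral>y. gamma_weight (2 * \<alpha>) 1 y \<partial>lborel)"
  proof -
    have "(c / 2) powr (- (2 * \<alpha> + 1)) = (2 * real k + 3) powr (2 * \<alpha> + 1)"
    proof -
      have "(2 / x) / 2 = 1 / x" for x :: real by simp
      then have c2: "c / 2 = 1 / (2 * real k + 3)" unfolding c_def .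
      have inv: "(1 / x) powr (- b) = x powr b" if "0 < x" for x b :: real
        using that by (simp add: powr_divide powr_minus)
      show ?thesis unfolding c2 by (rule inv) simp
    qed
    then show ?thesis using integral_gamma_weight[of "2 * \<alpha>" "c/2"] a c
      by (simp add: N.dominator_def)
  qed
  define cf where "cf = (\<lambda>n. of_real (dir_weight \<alpha> s n) * coef (exp_kernel (s * ln (real n))) k)"
  define S where "S = (\<lambda>N \<omega>. \<Sum>n<N. cf n * (of_real (eta n \<omega>) + \<i> * of_real (theta n \<omega>)))"
  have "AE \<omega> in M. ennreal ((cmod (coef (rescaled_D \<alpha> eta theta s \<omega>) k))\<^sup>2)
    = liminf (\<lambda>N. ennreal ((cmod (S N \<omega>))\<^sup>2))"
    using AE_convergent_event[of \<alpha>]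
  proof eventually_elim
    case (elim \<omega>)
    have "(\<lambda>N. S N \<omega>) \<longlonglongrightarrow> coef (rescaled_D \<alpha> eta theta s \<omega>) k"
      using coef_rescaled_D[OF elim s, of k] unfolding S_def cf_def sums_def by (simp add: mult_ac)
    then have "(\<lambda>N. ennreal ((cmod (S N \<omega>))\<^sup>2))
      \<longlonglongrightarrow> ennreal ((cmod (coef (rescaled_D \<alpha> eta theta s \<omega>) k))\<^sup>2)"
      by (intro tendsto_intros)
    then show ?case by (intro lim_imp_Liminf[symmetric]) auto
  qed
  then have "(\<integral>\<^sup>+\<omega>. ennreal ((cmod (coef (rescaled_D \<alpha> eta theta s \<omega>) k))\<^sup>2) \<partial>M)
    = (\<integral>\<^sup>+\<omega>. liminf (\<lambda>N. ennreal ((cmod (S N \<omega>))\<^sup>2)) \<partial>M)"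
    by (rule nn_integral_cong_AE)
  also have "\<dots> \<le> liminf (\<lambda>N. \<integral>\<^sup>+\<omega>. ennreal ((cmod (S N \<omega>))\<^sup>2) \<partial>M)"
    unfolding S_def by (intro nn_integral_liminf) measurable
  also have "\<dots> \<le> ennreal (total_variance * (\<integral>y. N.dominator y \<partial>lborel))"
  proof (intro Liminf_le always_eventually allI)
    fix N
    have "(\<Sum>n<N. (cmod (cf n))\<^sup>2) \<le> (\<integral>y. N.dominator y \<partial>lborel)"
      using N.weight_sum_abs_le[OF s, of N] by (simp add: cf_def norm_mult power_mult_distrib)
    then show "(\<integral>\<^sup>+\<omega>. ennreal ((cmod (S N \<omega>))\<^sup>2) \<partial>M)
      \<le> ennreal (total_variance * (\<integral>y. N.dominator y \<partial>lborel))"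
      unfolding S_def second_moment_complex_sum
        by (intro ennreal_leI mult_left_mono total_variance_nonneg)
  qed simp
  finally show ?thesis unfolding I .
qed

end

section \<open>Moments of the limit coefficients and conclusion\<close>

lemma subexp_growth:
  assumes "\<beta> \<ge> 0" shows "subexp (\<lambda>k. (real k + 1) * (2 * real k + 3) powr \<beta>)"
  unfolding subexp_def
proof (intro allI impI)
  fix r :: real assume r: "0 \<le> r \<and> r < 1"
  show "summable (\<lambda>k. (real k + 1) * (2 * real k + 3) powr \<beta> * r ^ k)"
  proof (cases "r = 0")
    case True then show ?thesis by (intro summable_finite[of "{0}"]) auto
  next
    case False
    then have r': "0 < r" "r < 1" using r by auto
    show ?thesis
    proof (rule summable_comparison_test_bigo)
      show "summable (\<lambda>k. norm (real k powr (- 2)))" by (simp add: summable_real_powr_iff)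
      show "(\<lambda>k. (real k + 1) * (2 * real k + 3) powr \<beta> * r ^ k) \<in> O(\<lambda>k. real k powr (- 2))"
        using r' by real_asymp
    qed
  qed
qed

text \<open>The characteristic function alone bounds the second moment. The rotations
  \<open>u = 1\<close> and \<open>u = - i\<close> give the real and the imaginary part, whence the
  factor 2.\<close>

lemma gaussian_coef_moment:
  fixes Y :: "'b \<Rightarrow> complex \<Rightarrow> complex"
  assumes P: "prob_space P" and a: "\<alpha> > -1/2" and D: "0 \<le> D"
    and Ym: "(\<lambda>\<omega>. coef (Y \<omega>) k) \<in> borel_measurable P"
    and q: "\<And>w. 0 \<le> q w" "\<And>w. q w \<le> D * (cmod w)\<^sup>2" "\<And>r w. q (of_real r * w)
      = r\<^sup>2 * q w" "continuous_on UNIV q"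
    and ch: "\<And>K t. (\<integral>\<omega>. iexp (Re (\<Sum>k<K. t k * coef (Y \<omega>) k)) \<partial>P)
      = exp (- of_real (limit_variance \<alpha> q K t) / 2)"
  shows "(\<integral>\<^sup>+\<omega>. ennreal ((cmod (coef (Y \<omega>) k))\<^sup>2) \<partial>P)
    \<le> ennreal (D * (2 * (exp 1)\<^sup>2 * (2 * real k + 3) powr (2 * \<alpha> + 1) * (\<integral>y. gamma_weight (2 * \<alpha>)
      1 y \<partial>lborel)))"
proof -
  interpret prob_space P by fact
  define J where "J = (\<integral>y. gamma_weight (2 * \<alpha>) 1 y \<partial>lborel)"
  have J0: "0 \<le> J" unfolding J_def
    by (intro Bochner_Integration.integral_nonneg gamma_weight_nonneg)
  define c where "c = 2 / (2 * real k + 3)"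
  have c: "c > 0" unfolding c_def by (intro divide_pos_pos) auto
  have cb: "c powr (- (2 * \<alpha> + 1)) \<le> (2 * real k + 3) powr (2 * \<alpha> + 1)"
  proof -
    have "c powr (- (2 * \<alpha> + 1)) = inverse (c powr (2 * \<alpha> + 1))" by (rule powr_minus)
    also have "\<dots> = (1 / c) powr (2 * \<alpha> + 1)" using c by (simp add: powr_divide inverse_eq_divide)
    also have "\<dots> \<le> (2 * real k + 3) powr (2 * \<alpha> + 1)"
      using a by (intro powr_mono2) (auto simp: c_def)
    finally show ?thesis .
  qed
  have part: "(\<integral>\<^sup>+\<omega>. ennreal ((Re (u * coef (Y \<omega>) k))\<^sup>2) \<partial>P)
    \<le> ennreal (D * ((exp 1)\<^sup>2 * (2 * real k + 3) powr (2 * \<alpha> + 1) * J))"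
    if u: "cmod u = 1" for u
  proof -
    define V where "V = (\<integral>y. indicator {0<..} y * (y powr (2 * \<alpha>) * q (u * coef (exp_kernel y) k))
      \<partial>lborel)"
    have "(\<integral>\<^sup>+\<omega>. ennreal ((Re (u * coef (Y \<omega>) k))\<^sup>2) \<partial>P) \<le> ennreal V"
    proof (rule second_moment_le_of_gaussian_char)
      show "(\<lambda>\<omega>. Re (u * coef (Y \<omega>) k)) \<in> borel_measurable P" using Ym by measurable
      fix r :: real
      \<comment> \<open>A single frequency at index \<open>k\<close>; the homogeneity of
        \<open>q\<close> then produces the variance \<open>r^2 * V\<close>.\<close>
      define t where "t = (\<lambda>j. if j = k then of_real r * u else 0)"
      have s: "(\<Sum>j<Suc k. t j * x j) = of_real r * u * x k" for x
        unfolding t_def by (subst sum.mono_neutral_right[of _ "{k}"]) auto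
      have "(\<integral>\<omega>. iexp (r * Re (u * coef (Y \<omega>) k)) \<partial>P)
        = (\<integral>\<omega>. iexp (Re (\<Sum>j<Suc k. t j * coef (Y \<omega>) j)) \<partial>P)"
        unfolding s by (simp add: mult.assoc)
      also have "\<dots> = exp (- of_real (\<integral>y. indicator {0<..} y * (y powr (2 * \<alpha>)
        * q (coef_comb (Suc k) t y)) \<partial>lborel) / 2)" by (rule ch)
      also have "(\<integral>y. indicator {0<..} y * (y powr (2 * \<alpha>) * q (coef_comb (Suc k) t y)) \<partial>lborel)
        = r\<^sup>2 * V"
        unfolding coef_comb_def s mult.assoc[of "of_real r"] q(3)
          V_def integral_mult_right_zero[symmetric]
        by (intro Bochner_Integration.integral_cong refl) (simp add: mult_ac)
      finally show "(\<integral>\<omega>. iexp (r * Re (u * coef (Y \<omega>) k)) \<partial>P) = exp (- of_real (r\<^sup>2 * V) / 2)" .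
    qed
    also have "V \<le> D * ((exp 1)\<^sup>2 * (2 * real k + 3) powr (2 * \<alpha> + 1) * J)"
    proof -
      have "V \<le> (\<integral>y. D * (exp 1)\<^sup>2 * gamma_weight (2 * \<alpha>) c y \<partial>lborel)" unfolding V_def
      proof (rule integral_mono_AE')
        show "integrable lborel (\<lambda>y. D * (exp 1)\<^sup>2 * gamma_weight (2 * \<alpha>) c y)"
          using integrable_gamma_weight[of "2 * \<alpha>" c] a c by simp
        show "AE y in lborel. indicator {0<..} y * (y powr (2 * \<alpha>) * q (u * coef (exp_kernel y)
          k)) \<le> D * (exp 1)\<^sup>2 * gamma_weight (2 * \<alpha>) c y"
        proof (rule AE_I2)
          fix y :: real
          show "indicator {0<..} y * (y powr (2 * \<alpha>) * q (u * coef (exp_kernel y) k))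
            \<le> D * (exp 1)\<^sup>2 * gamma_weight (2 * \<alpha>) c y"
          proof (cases "0 < y")
            case True
            have "q (u * coef (exp_kernel y) k) \<le> D * (cmod (coef (exp_kernel y) k))\<^sup>2"
              using q(2)[of "u * coef (exp_kernel y) k"] u by (simp add: norm_mult)
            also have "\<dots> \<le> D * (exp 1 * exp (- y / (2 * real k + 3)))\<^sup>2"
              using True by (intro mult_left_mono power_mono norm_coef_exp D) auto
            also have "\<dots> = D * (exp 1)\<^sup>2 * exp (- c * y)"
              by (simp add: c_def power_mult_distrib exp_double[symmetric])
            finally have "y powr (2 * \<alpha>) * q (u * coef (exp_kernel y) k)
              \<le> y powr (2 * \<alpha>) * (D * (exp 1)\<^sup>2 * exp (- c * y))"
              by (intro mult_left_mono) auto
            then show ?thesis using True by (simp add: gamma_weight_def mult_ac)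
          qed (simp add: gamma_weight_def)
        qed
        show "AE y in lborel. 0 \<le> D * (exp 1)\<^sup>2 * gamma_weight (2 * \<alpha>) c y"
          using D by (intro AE_I2 mult_nonneg_nonneg gamma_weight_nonneg) auto
      qed
      also have "\<dots> = D * (exp 1)\<^sup>2 * (c powr (- (2 * \<alpha> + 1)) * J)"
        using integral_gamma_weight[of "2 * \<alpha>" c] a c by (simp add: J_def)
      also have "\<dots> \<le> D * (exp 1)\<^sup>2 * ((2 * real k + 3) powr (2 * \<alpha> + 1) * J)"
        using D J0 by (intro mult_left_mono mult_right_mono cb) auto
      finally show ?thesis by (simp add: mult.assoc)
    qed
    finally show ?thesis by (simp add: ennreal_leI)
  qed
  have mc[measurable]: "(\<lambda>\<omega>. coef (Y \<omega>) k) \<in> borel_measurable P" by (rule Ym)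
  have "(\<integral>\<^sup>+\<omega>. ennreal ((cmod (coef (Y \<omega>) k))\<^sup>2) \<partial>P)
    = (\<integral>\<^sup>+\<omega>. ennreal ((Re (1 * coef (Y \<omega>) k))\<^sup>2) + ennreal ((Re ((- \<i>) * coef (Y \<omega>) k))\<^sup>2) \<partial>P)"
    by (intro nn_integral_cong) (simp add: cmod_power2 ennreal_plus[symmetric] del: ennreal_plus)
  also have "\<dots> = (\<integral>\<^sup>+\<omega>. ennreal ((Re (1 * coef (Y \<omega>) k))\<^sup>2) \<partial>P) + (\<integral>\<^sup>+\<omega>. ennreal ((Re ((- \<i>)
    * coef (Y \<omega>) k))\<^sup>2) \<partial>P)"
    by (intro nn_integral_add) measurable
  also have "\<dots> \<le> ennreal (D * ((exp 1)\<^sup>2 * (2 * real k + 3) powr (2 * \<alpha> + 1) * J))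
    + ennreal (D * ((exp 1)\<^sup>2 * (2 * real k + 3) powr (2 * \<alpha> + 1) * J))"
    by (intro add_mono part) auto
  also have "\<dots> = ennreal (D * (2 * (exp 1)\<^sup>2 * (2 * real k + 3) powr (2 * \<alpha> + 1) * J))"
    using D J0 by (subst ennreal_plus[symmetric]) (auto simp: algebra_simps intro!:
      mult_nonneg_nonneg)
  finally show ?thesis unfolding J_def .
qed

text \<open>The limit enters as any holomorphic version of the Gaussian process: at each
  \<open>z\<close> it agrees with the Wiener integrals off a null set that may depend on
  \<open>z\<close>.\<close>

theorem theorem2p2:
  fixes M :: "'a measure" and eta theta :: "nat \<Rightarrow> 'a \<Rightarrow> real" and \<alpha> :: real
    and P :: "'b measure" and B1 B2 :: "real \<Rightarrow> 'b \<Rightarrow> real"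
    and Y :: "'b \<Rightarrow> complex \<Rightarrow> complex"
  assumes M: "prob_space M"
    and meas: "\<And>n. eta n \<in> borel_measurable M" "\<And>n. theta n \<in> borel_measurable M"
    and indep: "prob_space.indep_vars M (\<lambda>_. borel) (\<lambda>n \<omega>. (eta n \<omega>, theta n \<omega>)) UNIV"
    and ident: "\<And>n. distr M borel (\<lambda>\<omega>. (eta n \<omega>, theta n \<omega>)) = distr M borel (\<lambda>\<omega>. (eta 0 \<omega>, theta 0 \<omega>))"
    and int1: "integrable M (eta 0)" "integrable M (theta 0)"
    and mean0: "(\<integral>\<omega>. eta 0 \<omega> \<partial>M) = 0" "(\<integral>\<omega>. theta 0 \<omega> \<partial>M) = 0"
    and int2: "integrable M (\<lambda>\<omega>. (eta 0 \<omega>)\<^sup>2)" "integrable M (\<lambda>\<omega>. (theta 0 \<omega>)\<^sup>2)"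
    and pos: "0 < (\<integral>\<omega>. (eta 0 \<omega>)\<^sup>2 \<partial>M) + (\<integral>\<omega>. (theta 0 \<omega>)\<^sup>2 \<partial>M)"
    and alpha: "\<alpha> > - 1/2"
    and BM: "std_BM2 P B1 B2"
    and Y_hol: "\<forall>\<omega>\<in>space P. Y \<omega> holomorphic_on H0"
    and Y_meas: "\<forall>z. (\<lambda>\<omega>. Y \<omega> z) \<in> borel_measurable P"
    and Y_def: "\<forall>z\<in>H0. \<exists>W1 W2.
        wiener_integral P B1 (I_kernel \<alpha> z) W1 \<and> wiener_integral P B2 (I_kernel \<alpha> z) W2 \<and>
        (AE \<omega> in P. Y \<omega> z =
           (case psd_sqrt2 (\<integral>\<omega>. (eta 0 \<omega>)\<^sup>2 \<partial>M) (\<integral>\<omega>. eta 0 \<omega> * theta 0 \<omega> \<partial>M) (\<integral>\<omega>. (theta 0 \<omega>)\<^sup>2 \<partial>M) of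
              (p, q, r) \<Rightarrow> (complex_of_real p * W1 \<omega> + complex_of_real q * W2 \<omega>)
                           + \<i> * (complex_of_real q * W1 \<omega> + complex_of_real r * W2 \<omega>)))"
  shows "\<forall>F. hol_test_fun F \<longrightarrow>
           ((\<lambda>s. \<integral>\<omega>. F (rescaled_D \<alpha> eta theta s \<omega>) \<partial>M) \<longlongrightarrow> (\<integral>\<omega>. F (Y \<omega>) \<partial>P)) (at_right 0)"
proof (intro allI impI)
  fix F :: "(complex \<Rightarrow> complex) \<Rightarrow> real" assume F: "hol_test_fun F"
  interpret iid_pairs M eta theta
    by (intro iid_pairs.intro M iid_pairs_axioms.intro meas indep ident mean0 int2)
  interpret P: prob_space P using BM by (simp add: std_BM2_def)
  define s1 r12 s2 where "s1 = (\<integral>\<omega>. (eta 0 \<omega>)\<^sup>2 \<partial>M)" and "r12 = (\<integral>\<omega>. eta 0 \<omega> * theta 0 \<omega> \<partial>M)"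
    and "s2 = (\<integral>\<omega>. (theta 0 \<omega>)\<^sup>2 \<partial>M)"
  have nn: "0 \<le> s1" "0 \<le> s2" unfolding s1_def s2_def by simp_all
  have qf: "qform u v = u\<^sup>2 * s1 + 2 * u * v * r12 + v\<^sup>2 * s2" for u v
    by (simp add: qform_def s1_def s2_def r12_def)
  \<comment> \<open>Nonnegativity of the form gives the determinant inequality: evaluate it at
    \<open>(r12, - s1)\<close>, or, if \<open>s1 = 0\<close>, use that a nonconstant affine function
    is not bounded below.\<close>
  have disc: "r12\<^sup>2 \<le> s1 * s2"
  proof (cases "s1 = 0")
    case True
    have lin_nonneg: "0 \<le> 2 * x * r12 + s2" for x using qform_nonneg[of x 1] unfolding qf True
      by simp
    have "r12 = 0"
    proof (rule ccontr)
      assume "r12 \<noteq> 0"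
      then have "2 * (- (s2 + 1) / (2 * r12)) * r12 = - (s2 + 1)" by simp
      with lin_nonneg[of "- (s2 + 1) / (2 * r12)"] show False by linarith
    qed
    then show ?thesis using True by simp
  next
    case False
    then have s1: "0 < s1" using nn by simp
    have "0 \<le> s1 * (s1 * s2 - r12\<^sup>2)"
      using qform_nonneg[of r12 "- s1"] unfolding qf by (simp add: power2_eq_square algebra_simps)
    then show ?thesis using s1 by (simp add: zero_le_mult_iff)
  qed
  obtain p q r where pqr: "psd_sqrt2 s1 r12 s2 = (p, q, r)" by (metis prod_cases3)
  note root = psd_sqrt2_spec[OF nn disc _ pqr]
  have root: "p\<^sup>2 + q\<^sup>2 = s1" "p * q + q * r = r12" "q\<^sup>2 + r\<^sup>2 = s2"
    using root pos unfolding s1_def s2_def by auto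
  \<comment> \<open>The entries of the row \<open>(1, i)\<close> times the square root
    matrix.\<close>
  define a1 a2 where "a1 = Complex p q" and "a2 = Complex q r"
  \<comment> \<open>The squared root is the covariance matrix, so the variance density of the limit
    is the quadratic form of the Dirichlet side.\<close>
  have quad: "(Re (a1 * w))\<^sup>2 + (Re (a2 * w))\<^sup>2 = complex_qform w" for w
    unfolding complex_qform_def qf root[symmetric] a1_def a2_def
      by (simp add: power2_eq_square algebra_simps)
  have Y: "\<And>\<omega>. \<omega> \<in> space P \<Longrightarrow> Y \<omega> holomorphic_on H0" using Y_hol by blast
  have Ym: "\<And>z. z \<in> H0 \<Longrightarrow> (\<lambda>\<omega>. Y \<omega> z) \<in> borel_measurable P" using Y_meas by blast
  have YW: "\<exists>W1 W2. wiener_integral P B1 (I_kernel \<alpha> z) W1 \<and> wiener_integral P B2 (I_kernel \<alpha> z)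
    W2 \<and>
       (AE \<omega> in P. Y \<omega> z = a1 * W1 \<omega> + a2 * W2 \<omega>)" if z: "z \<in> H0" for z
  proof -
    obtain W1 W2 where W: "wiener_integral P B1 (I_kernel \<alpha> z) W1"
      "wiener_integral P B2 (I_kernel \<alpha> z) W2"
      "AE \<omega> in P. Y \<omega> z = (complex_of_real p * W1 \<omega> + complex_of_real q * W2 \<omega>)
        + \<i> * (complex_of_real q * W1 \<omega> + complex_of_real r * W2 \<omega>)"
      using Y_def z unfolding s1_def[symmetric] s2_def[symmetric] r12_def[symmetric]
        pqr case_prod_conv by blast
    have "(complex_of_real p * w1 + complex_of_real q * w2)
      + \<i> * (complex_of_real q * w1 + complex_of_real r * w2) = a1 * w1 + a2 * w2" for w1 w2
      by (simp add: a1_def a2_def complex_eq_iff)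
    with W show ?thesis by auto
  qed
  have alpha': "\<alpha> > -1/2" using alpha by simp
  have chY: "(\<integral>\<omega>. iexp (Re (\<Sum>k<K. t k * coef (Y \<omega>) k)) \<partial>P)
      = exp (- of_real (limit_variance \<alpha> complex_qform K t) / 2)" for K t
    using gaussian_coef_char[where K = K and t = t, OF BM alpha' Y Ym YW] unfolding quad .
  define J where "J = (\<integral>y. gamma_weight (2 * \<alpha>) 1 y \<partial>lborel)"
  have J0: "0 \<le> J" unfolding J_def
    by (intro Bochner_Integration.integral_nonneg gamma_weight_nonneg)
  have k1: "1 \<le> weight_const \<alpha>" by (simp add: weight_const_def)
  \<comment> \<open>The summand 1 keeps the radii positive even if the moment constant were
    0.\<close>
  define A where "A = total_variance * (2 * weight_const \<alpha> * (exp 1)\<^sup>2 * J) + 1"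
  have A0: "0 \<le> total_variance * (2 * weight_const \<alpha> * (exp 1)\<^sup>2 * J)"
    using total_variance_nonneg k1 J0 by (intro mult_nonneg_nonneg) auto
  have A: "0 < A" using A0 unfolding A_def by linarith
  \<comment> \<open>The root of the common moment bound, times the \<open>k + 1\<close> that the
    union bound consumes.\<close>
  define L where "L = (\<lambda>k. sqrt A * ((real k + 1) * (2 * real k + 3) powr (\<alpha> + 1/2)))"
  have Lpos: "0 < L k" for k unfolding L_def using A by (intro mult_pos_pos) auto
  have Lsub: "subexp L" unfolding L_def using alpha by (intro subexp_scale subexp_growth) auto
  have L2: "(L k / (real k + 1))\<^sup>2 = A * (2 * real k + 3) powr (2 * \<alpha> + 1)" for k
  proof -
    have "L k / (real k + 1) = sqrt A * (2 * real k + 3) powr (\<alpha> + 1/2)" by (simp add: L_def)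
    moreover have "((2 * real k + 3) powr (\<alpha> + 1/2))\<^sup>2 = (2 * real k + 3) powr (2 * \<alpha> + 1)"
      by (simp add: powr_power algebra_simps)
    ultimately show ?thesis using A by (simp add: power_mult_distrib)
  qed
  have bX: "total_variance * (2 * weight_const \<alpha> * (exp 1)\<^sup>2 * (2 * real k + 3) powr (2 * \<alpha> + 1)
    * J) \<le> (L k / (real k + 1))\<^sup>2" for k
    unfolding L2 A_def by (simp add: algebra_simps)
  have bY: "total_variance * (2 * (exp 1)\<^sup>2 * (2 * real k + 3) powr (2 * \<alpha> + 1) * J)
    \<le> (L k / (real k + 1))\<^sup>2" for k
  proof (rule order_trans[OF _ bX])
    have "total_variance * (2 * 1 * (exp 1)\<^sup>2 * (2 * real k + 3) powr (2 * \<alpha> + 1) * J)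
      \<le> total_variance * (2 * weight_const \<alpha> * (exp 1)\<^sup>2 * (2 * real k + 3) powr (2 * \<alpha> + 1) * J)"
      using k1 J0 total_variance_nonneg by (intro mult_left_mono mult_right_mono) auto
    then show "total_variance * (2 * (exp 1)\<^sup>2 * (2 * real k + 3) powr (2 * \<alpha> + 1) * J)
      \<le> total_variance * (2 * weight_const \<alpha> * (exp 1)\<^sup>2 * (2 * real k + 3) powr (2 * \<alpha> + 1) * J)"
      by simp
  qed
  have momY: "(\<integral>\<^sup>+\<omega>. ennreal ((cmod (coef (Y \<omega>) k))\<^sup>2) \<partial>P) \<le> ennreal ((L k / (real k + 1))\<^sup>2)" for k
  proof (rule order_trans[OF gaussian_coef_moment[OF P.prob_space_axioms alpha'
    total_variance_nonneg measurable_coef[OF Y Ym] _ _ _ complex_qform_continuous chY]])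
    show "0 \<le> complex_qform w" for w by (simp add: complex_qform_def qform_nonneg)
    show "complex_qform w \<le> total_variance * (cmod w)\<^sup>2" for w using complex_qform_abs_le[of w]
      by simp
    show "complex_qform (of_real c * w) = c\<^sup>2 * complex_qform w" for c w
      using complex_qform_scale[of c w] by (simp add: complex_qform_def)
    show "ennreal (total_variance * (2 * (exp 1)\<^sup>2 * (2 * real k + 3) powr (2 * \<alpha> + 1)
      * (\<integral>y. gamma_weight (2 * \<alpha>) 1 y \<partial>lborel))) \<le> ennreal ((L k / (real k + 1))\<^sup>2)"
      using bY[of k] unfolding J_def by (rule ennreal_leI)
  qed
  show "((\<lambda>s. \<integral>\<omega>. F (rescaled_D \<alpha> eta theta s \<omega>) \<partial>M) \<longlongrightarrow> (\<integral>\<omega>. F (Y \<omega>) \<partial>P)) (at_right 0)"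
    unfolding tendsto_at_iff_sequentially
  proof (intro allI impI)
    fix s :: "nat \<Rightarrow> real" assume s0: "\<forall>i. s i \<in> {0<..} - {0}" and s1: "s \<longlonglongrightarrow> 0"
    have s: "s i > 0" for i using s0 by auto
    show "((\<lambda>s. \<integral>\<omega>. F (rescaled_D \<alpha> eta theta s \<omega>) \<partial>M) \<circ> s) \<longlonglongrightarrow> (\<integral>\<omega>. F (Y \<omega>) \<partial>P)"
      unfolding o_def
    proof (rule hol_test_fun_convergence[OF M P.prob_space_axioms F Lsub Lpos _ _ _ Y Ym momY])
      show "rescaled_D \<alpha> eta theta (s n) \<omega> holomorphic_on H0" for n \<omega>
        by (rule rescaled_D_holomorphic[OF s])
      show "(\<lambda>\<omega>. rescaled_D \<alpha> eta theta (s n) \<omega> z) \<in> borel_measurable M" if "z \<in> H0" for n z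
        by (rule measurable_rescaled_D[OF meas s that])
      show "(\<integral>\<^sup>+\<omega>. ennreal ((cmod (coef (rescaled_D \<alpha> eta theta (s n) \<omega>) k))\<^sup>2) \<partial>M)
        \<le> ennreal ((L k / (real k + 1))\<^sup>2)" for n k
        by (rule order_trans[OF rescaled_D_coef_moment[OF alpha' s]
          ennreal_leI[OF bX[unfolded J_def]]])
      show "(\<lambda>n. \<integral>\<omega>. iexp (Re (\<Sum>k<K. t k * coef (rescaled_D \<alpha> eta theta (s n) \<omega>) k)) \<partial>M)
        \<longlonglongrightarrow> (\<integral>\<omega>. iexp (Re (\<Sum>k<K. t k * coef (Y \<omega>) k)) \<partial>P)" for K t
        unfolding chY by (rule rescaled_D_coef_char[OF alpha' s s1])
    qed
  qed
qed

end
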